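(* Uniformly for $Y^{1/5}\le R\le Y^{1/3}$ and primes $p\le R^{1/2}$, one has $$\sum_{\substack{n\ge1\\ p\nmid n}} g\!\left(\frac nY\right)\mu^2(n)2^{\omega(n)}\Lambda_{0,R}(pn)^2\ll_g\left(\frac{\log p}{\log R}+\frac1{\log Y}\right)\frac{Y}{\log Y}\ll_g\frac{(1+\log p)\,Y}{(\log Y)^2},$$ where the implied constants depend only on $g$ (not on $Y,R,p$).
   Context: Fix a nonnegative $g\in C_c^\infty((0,\infty))$ supported in $[1,2]$ with $\int_0^\infty g(x)\,dx=1$. Let $Y>e$ and $R>1$. Here $\mu$ is the Möbius function, $\omega(n)$ is the number of distinct prime divisors of $n$, $\mathbf 1_E$ is the indicator of a condition $E$, and $v_+=\max\{v,0\}$. Put $G_0(x)=x_+^2$ and $$\Lambda_{0,R}(m)=\sum_{d\mid m}\mu(d)\,G_0\!\left(\frac{\log(R/d)}{\log R}\right)\mathbf 1_{d\le R}.$$ *)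

theory Defs
  imports "HOL-Analysis.Analysis" "HOL-Computational_Algebra.Computational_Algebra"
begin

text \<open>For open \<open>U\<close>, only the values of \<open>f\<close> on \<open>U\<close> matter in the next two definitions;
  for \<open>U = {0<..}\<close> they describe functions on the half-line, embedded in total functions on the reals.\<close>

definition smooth_on :: "real set \<Rightarrow> (real \<Rightarrow> real) \<Rightarrow> bool" where
  "smooth_on U f \<longleftrightarrow> (\<forall>k. (deriv ^^ k) f differentiable_on U)"

text \<open>Support relative to \<open>U\<close>, i.e. the closure in \<open>U\<close> of the set where \<open>f\<close> does not vanish.\<close>

definition supp_on :: "real set \<Rightarrow> (real \<Rightarrow> real) \<Rightarrow> real set" where
  "supp_on U f = U \<inter> closure (support_on U f)"

definition test_function_on :: "real set \<Rightarrow> (real \<Rightarrow> real) \<Rightarrow> bool" where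
  "test_function_on U f \<longleftrightarrow> smooth_on U f \<and> compact (supp_on U f)"

definition omega :: "nat \<Rightarrow> nat" where
  "omega n = card (prime_factors n)"

definition moebius_mu :: "nat \<Rightarrow> real" where
  "moebius_mu n = (if squarefree n then (- 1) ^ omega n else 0)"

definition G0 :: "real \<Rightarrow> real" where
  "G0 x = (max x 0)\<^sup>2"

text \<open>Used for \<open>m \<ge> 1\<close> only, where the set of divisors is finite.\<close>

definition Lambda0 :: "real \<Rightarrow> nat \<Rightarrow> real" where
  "Lambda0 R m = (\<Sum>d | d dvd m. moebius_mu d * G0 (ln (R / real d) / ln R) * of_bool (real d \<le> R))"

end

theory Submission
  imports Defs "HOL-Probability.Probability" "HOL-Real_Asymp.Real_Asymp"
begin

text \<open>For squarefree \<open>n\<close> prime to \<open>p\<close> one has \<open>2^\<omega>(n) = \<tau>(n)\<close>, and \<open>\<Lambda>(pn)\<close> is the sum of a weight \<open>w\<close> over the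
sets of primes dividing \<open>n\<close>. The weight of a set with product \<open>m\<close> is \<open>\<mu>(m)\<close> times the difference of
\<open>log\<^sub>+\<^sup>2\<close> at \<open>R/m\<close> and at \<open>R/(pm)\<close>, divided by \<open>log\<^sup>2 R\<close> (\<open>Lambda0_eq\<close>); the gain for small \<open>p\<close> comes from
this difference. The sum of weights makes sense for every \<open>n\<close>, so by positivity it suffices to bound
the sum of \<open>\<tau>(n) L(n)\<^sup>2\<close> over \<open>Y/2 < n \<le> 2Y\<close>, where \<open>L(n)\<close> is that sum of weights.

Write \<open>G(x)\<close> for the sum of \<open>\<tau>(n) L(n)\<^sup>2\<close> over \<open>x < n \<le> 4x\<close>. Opening the square and applying the hyperbola
method to each divisibility condition gives \<open>G(x) = x (a log x + b) + O(R^(5/4) x^(1/2))\<close> with some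
\<open>a, b\<close> (\<open>sieve_sum_asymptotic\<close>). The classical way is to evaluate \<open>a\<close> and \<open>b\<close>, which are two different
quadratic forms in \<open>w\<close>. That is avoided here: as \<open>G \<ge> 0\<close>, the nearly linear sequence \<open>G(4^j x)/(4^j x)\<close>
starts with a term that is at most about twice its average (\<open>linear_average\<close>). The average over
\<open>j \<le> log Y\<close> is at most a constant times \<open>1 / log Y\<close> times the sum of \<open>\<tau>(n) L(n)\<^sup>2 / n\<close> over \<open>n \<le> 2Y\<^sup>3\<close>.
In the latter sum, \<open>L(n)\<close> depends only on the set of primes dividing \<open>n\<close>; grouping by that set bounds
it by a product over primes, which is \<open>O(log\<^sup>2 Y)\<close> (\<open>mertens_upper\<close>), times a single quadratic form
\<open>Q\<close> (\<open>sieve_logsum_le_selberg\<close>).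

Selberg's diagonalisation turns \<open>Q\<close> into a sum of squares over squarefree \<open>c\<close>. The square at \<open>c\<close> is, up
to a factor, that of \<open>U(R/c) - U(R/(pc))\<close>, where \<open>U(X)\<close> is the sum of \<open>\<mu>(m) \<rho>(m) log\<^sub>+\<^sup>2(X/m)\<close> over \<open>m\<close> prime to
\<open>c\<close>, with \<open>\<rho>(q) = 2/q - 1/q\<^sup>2\<close> at primes. It is shown that \<open>U(X)\<close> is a constant up to \<open>O(1/(1 + log\<^sub>+ X))\<close>,
with a dependence on \<open>c\<close> that is harmless on average (\<open>coprime_sieve_sum_nearly\<close>). The constant cancels
in the difference, and summing the squared error over \<open>c\<close> gives \<open>Q = O((1 + log p) / log\<^sup>3 R)\<close>
(\<open>quadratic_form_bound\<close>). As \<open>log R\<close> and \<open>log Y\<close> are of the same size, the factors combine to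
\<open>Y (1 + log p) / log\<^sup>2 Y\<close>.

The statement on \<open>U\<close> has the depth of the prime number theorem. It is first proved for the double sum
of \<open>\<mu>(m) \<mu>(m') / (m m') log\<^sub>+\<^sup>2(X/(m m'))\<close>, whose Laplace transform is \<open>2 / (z\<^sup>3 \<zeta>(1+z)\<^sup>2)\<close>
(\<open>sieve2_asymptotic\<close>). After removal of an explicit function the transform is Lipschitz in the
vertical direction with an integrable constant, uniformly up to the line \<open>Re z = 0\<close>
(\<open>sieve_LT_lipschitz\<close>), and one difference in frequency is worth one factor \<open>1 / log X\<close> in the function.
The Lipschitz bound needs a lower bound for \<open>\<zeta>\<close> near its line of convergence; the inequality
\<open>3 + 4 cos \<theta> + cos 2\<theta> \<ge> 0\<close> provides it (\<open>zeta_lower\<close>). The passage from the double sum to \<open>U\<close> replaces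
the primes one after the other, which costs a convergent product because \<open>1 - \<rho>(q) T\<close> and
\<open>(1 - T/q)\<^sup>2\<close>, with \<open>T\<close> the dilation \<open>u(X) \<mapsto> u(X/q)\<close>, differ by \<open>O(1/q\<^sup>2)\<close> (\<open>nearly_exchange\<close>).\<close>

section \<open>The zeta function to the right of Re s = 1\<close>

text \<open>\<open>x\<close> to the power \<open>-s\<close>, for positive real \<open>x\<close>.\<close>

definition npow :: "real \<Rightarrow> complex \<Rightarrow> complex" where
  "npow x s = exp (- (s * complex_of_real (ln x)))"

lemma norm_npow: "x > 0 \<Longrightarrow> norm (npow x s) = x powr (- Re s)"
  by (simp add: npow_def powr_def)

lemma npow_mult: "x > 0 \<Longrightarrow> y > 0 \<Longrightarrow> npow (x * y) s = npow x s * npow y s"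
  by (simp add: npow_def ln_mult exp_add [symmetric] algebra_simps)

lemma npow_1 [simp]: "npow 1 s = 1"
  by (simp add: npow_def)

lemma npow_minus_1: "x > 0 \<Longrightarrow> npow x (s - 1) = of_real x * npow x s"
proof -
  assume x: "x > 0"
  have "npow x (s - 1) = exp (of_real (ln x)) * npow x s"
    by (simp add: npow_def exp_add [symmetric] algebra_simps)
  also have "exp (of_real (ln x) :: complex) = of_real x"
    using x by (metis exp_ln exp_of_real)
  finally show ?thesis .
qed

lemma npow_deriv_x: "x > 0 \<Longrightarrow> ((\<lambda>x. npow x s) has_vector_derivative (- s / of_real x * npow x s)) (at x within S)"
proof -
  assume x: "x > 0"
  have 1: "((\<lambda>x. complex_of_real (ln x)) has_vector_derivative of_real (inverse x)) (at x within S)"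
    by (rule has_vector_derivative_of_real) (use x in \<open>auto intro!: derivative_eq_intros simp: has_real_derivative_iff_has_vector_derivative [symmetric] field_simps\<close>)
  have 2: "((\<lambda>u. exp (- (s * u))) has_field_derivative (- s * exp (- (s * u)))) (at u)" for u
    by (auto intro!: derivative_eq_intros)
  have "((\<lambda>u. exp (- (s * u))) \<circ> (\<lambda>x. complex_of_real (ln x)) has_vector_derivative
      of_real (inverse x) * (- s * exp (- (s * of_real (ln x))))) (at x within S)"
    by (rule field_vector_diff_chain_within [OF 1 has_field_derivative_at_within [OF 2]])
  thus ?thesis by (simp add: npow_def o_def field_simps)
qed

lemma npow_deriv_s: "((\<lambda>s. npow x s) has_field_derivative (- of_real (ln x) * npow x s)) (at s within S)"
  unfolding npow_def by (auto intro!: derivative_eq_intros)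

lemma norm_npow_le: "y \<ge> 1 \<Longrightarrow> Re s \<ge> 1 \<Longrightarrow> norm (npow y s) \<le> 1 / y"
  using powr_mono [of "- Re s" "-1" y] by (simp add: norm_npow powr_minus_divide)

lemma npow_diff_s:
  assumes "y \<ge> 1" "Re s \<ge> 1" "Re s' \<ge> 1"
  shows "norm (npow y s - npow y s') \<le> norm (s - s') * ln y / y"
proof -
  have "norm (npow y s - npow y s') \<le> (ln y / y) * norm (s - s')"
  proof (rule field_differentiable_bound [of "{s. Re s \<ge> 1}" "npow y"])
    show "convex {s. 1 \<le> Re s}" by (rule convex_halfspace_Re_ge)
    show "(npow y has_field_derivative (- of_real (ln y) * npow y z)) (at z within {s. 1 \<le> Re s})" for z
      by (rule npow_deriv_s)
    show "norm (- of_real (ln y) * npow y z) \<le> ln y / y" if "z \<in> {s. 1 \<le> Re s}" for z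
      using norm_npow_le [of y z] that assms mult_left_mono[of "norm (npow y z)" "1/y" "ln y"] by (simp add: norm_mult)
  qed (use assms in auto)
  thus ?thesis by (simp add: mult.commute)
qed

lemma vector_derivative_bound_Icc:
  fixes f :: "real \<Rightarrow> complex"
  assumes "\<And>x. x \<in> {a..b} \<Longrightarrow> (f has_vector_derivative f' x) (at x within {a..b})"
    and B: "\<And>x. x \<in> {a..b} \<Longrightarrow> norm (f' x) \<le> B" and "x \<in> {a..b}" "y \<in> {a..b}"
  shows "norm (f x - f y) \<le> B * \<bar>x - y\<bar>"
proof -
  have "norm (f x - f y) \<le> B * norm (x - y)"
  proof (rule differentiable_bound [of "{a..b}" f "\<lambda>x h. h *\<^sub>R f' x"])
    show "(f has_derivative (\<lambda>h. h *\<^sub>R f' x)) (at x within {a..b})" if "x \<in> {a..b}" for x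
      using assms(1)[OF that] by (simp add: has_vector_derivative_def)
    show "onorm (\<lambda>h. h *\<^sub>R f' x) \<le> B" if "x \<in> {a..b}" for x
    proof (rule onorm_bound)
      show "0 \<le> B" using norm_ge_zero B[OF that] by (rule order_trans)
      show "norm (h *\<^sub>R f' x) \<le> B * norm h" for h
        using mult_right_mono[OF B[OF that], of "\<bar>h\<bar>"] by (simp add: mult.commute)
    qed
  qed (use assms in auto)
  thus ?thesis by simp
qed

lemma npow_diff_x:
  assumes "n \<ge> 1" "y \<in> {n..n+1}" "Re s \<ge> 1"
  shows "norm (npow n s - npow y s) \<le> norm s / n\<^sup>2"
proof -
  have "norm (npow n s - npow y s) \<le> norm s / n\<^sup>2 * \<bar>n - y\<bar>"
  proof (rule vector_derivative_bound_Icc [where f = "\<lambda>x. npow x s" and a = n and b = "n+1"])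
    fix x assume x: "x \<in> {n..n+1}"
    show "((\<lambda>x. npow x s) has_vector_derivative (- s / of_real x * npow x s)) (at x within {n..n+1})"
      by (rule npow_deriv_x) (use x assms in auto)
    have "norm s / x * norm (npow x s) \<le> norm s / n * (1 / n)"
      using x assms norm_npow_le [of x s]
      by (intro mult_mono frac_le) (auto intro: order_trans [OF _ frac_le])
    thus "norm (- s / of_real x * npow x s) \<le> norm s / n\<^sup>2"
      using x assms by (simp add: norm_mult norm_divide power2_eq_square)
  qed (use assms in auto)
  also have "\<dots> \<le> norm s / n\<^sup>2 * 1" using assms by (intro mult_left_mono) auto
  finally show ?thesis by simp
qed

text \<open>The derivative in \<open>x\<close> of the difference is \<open>-((s - s') x\<^sup>-\<^sup>s + s' (x\<^sup>-\<^sup>s - x\<^sup>-\<^sup>s\<^sup>')) / x\<close>, so that a factor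
\<open>1/n\<close> from differentiating in \<open>x\<close> is gained at the cost of one factor \<open>|s'|\<close>.\<close>

lemma npow_diff_both:
  assumes "n \<ge> 1" "y \<in> {n..n+1}" "Re s \<ge> 1" "Re s' \<ge> 1"
  shows "norm ((npow n s - npow n s') - (npow y s - npow y s')) \<le> norm (s - s') * norm s' * (1 + ln (n+1)) / n\<^sup>2"
proof -
  have s': "norm s' \<ge> 1" using assms(4) complex_Re_le_cmod [of s'] by linarith
  have "norm ((npow n s - npow n s') - (npow y s - npow y s')) \<le> norm (s - s') * norm s' * (1 + ln (n+1)) / n\<^sup>2 * \<bar>n - y\<bar>"
  proof (rule vector_derivative_bound_Icc [where f = "\<lambda>x. npow x s - npow x s'" and a = n and b = "n+1"])
    fix x assume x: "x \<in> {n..n+1}"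
    have x1: "x \<ge> 1" using x assms by auto
    show "((\<lambda>x. npow x s - npow x s') has_vector_derivative (- s / of_real x * npow x s - (- s' / of_real x * npow x s'))) (at x within {n..n+1})"
      by (intro has_vector_derivative_diff npow_deriv_x) (use x1 in auto)
    have "- s / of_real x * npow x s - (- s' / of_real x * npow x s')
        = - ((s - s') * npow x s + s' * (npow x s - npow x s')) / of_real x"
      using x1 by (simp add: field_simps)
    also have "norm \<dots> = norm ((s - s') * npow x s + s' * (npow x s - npow x s')) / x"
      using x1 by (simp only: norm_divide norm_minus_cancel norm_of_real abs_of_nonneg order_trans [OF zero_le_one])
    also have "\<dots> \<le> (norm (s - s') * (1 / x) + norm s' * (norm (s - s') * ln x / x)) / x"
    proof (rule divide_right_mono)
      show "norm ((s - s') * npow x s + s' * (npow x s - npow x s')) \<le> (norm (s - s') * (1 / x) + norm s' * (norm (s - s') * ln x / x))"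
        unfolding norm_mult [symmetric]
        by (rule norm_triangle_le, unfold norm_mult, intro add_mono mult_left_mono norm_npow_le npow_diff_s assms x1 norm_ge_zero)
    qed (use x1 in auto)
    also have "\<dots> = norm (s - s') * (1 + norm s' * ln x) / x\<^sup>2"
      using x1 by (simp add: field_simps power2_eq_square)
    also have "\<dots> \<le> norm (s - s') * (norm s' * (1 + ln (n+1))) / n\<^sup>2"
    proof (intro frac_le mult_left_mono)
      have "ln x \<le> ln (n+1)" using x x1 by auto
      hence "norm s' * ln x \<le> norm s' * ln (n+1)" by (intro mult_left_mono) auto
      thus "1 + norm s' * ln x \<le> norm s' * (1 + ln (n+1))" using s' by (simp add: algebra_simps)
    qed (use x assms in auto)
    finally show "norm (- s / of_real x * npow x s - (- s' / of_real x * npow x s')) \<le> norm (s - s') * norm s' * (1 + ln (n+1)) / n\<^sup>2"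
      by (simp add: mult.assoc)
  qed (use assms in auto)
  also have "\<dots> \<le> norm (s - s') * norm s' * (1 + ln (n+1)) / n\<^sup>2 * 1" using assms by (intro mult_left_mono) auto
  finally show ?thesis by simp
qed

lemma norm_integral_unit_le:
  fixes f :: "real \<Rightarrow> complex"
  assumes "(f has_integral i) {n..n+1}" "\<And>x. x \<in> {n..n+1} \<Longrightarrow> norm (f x) \<le> B"
  shows "norm i \<le> B"
proof -
  have "0 \<le> B" using norm_ge_zero assms(2)[of n] by (rule order_trans) auto
  thus ?thesis using has_integral_bound_real [of B "{}" f i n "n+1"] assms by simp
qed

text \<open>The difference between \<open>n\<^sup>-\<^sup>s\<close> and the integral of \<open>x\<^sup>-\<^sup>s\<close> over the unit interval that follows \<open>n\<close>;
these terms sum to \<open>\<zeta>(s) - 1/(s - 1)\<close> and converge absolutely also on the line \<open>Re s = 1\<close>.\<close>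

definition zeta_term :: "real \<Rightarrow> complex \<Rightarrow> complex" where
  "zeta_term n s = npow n s - (npow n (s - 1) - npow (n + 1) (s - 1)) / (s - 1)"

lemma zeta_term_integral:
  assumes "n \<ge> 1" "s \<noteq> 1"
  shows "((\<lambda>x. npow n s - npow x s) has_integral zeta_term n s) {n..n+1}"
proof -
  have "((\<lambda>x. npow x s) has_integral (- npow (n+1) (s - 1) / (s - 1) - (- npow n (s - 1) / (s - 1)))) {n..n+1}"
  proof (rule fundamental_theorem_of_calculus)
    fix x assume x: "x \<in> {n..n+1}"
    hence x0: "x > 0" using assms by auto
    have "((\<lambda>x. - npow x (s - 1) / (s - 1)) has_vector_derivative - (- (s - 1) / of_real x * npow x (s - 1)) / (s - 1)) (at x within {n..n+1})"
      by (intro has_vector_derivative_divide has_vector_derivative_minus npow_deriv_x x0)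
    also have "- (- (s - 1) / of_real x * npow x (s - 1)) / (s - 1) = npow x s"
      using assms x0 by (simp add: npow_minus_1 divide_simps) (simp add: algebra_simps)
    finally show "((\<lambda>x. - npow x (s - 1) / (s - 1)) has_vector_derivative npow x s) (at x within {n..n+1})" .
  qed (use assms in auto)
  moreover have "((\<lambda>x. npow n s) has_integral npow n s) {n..n+1}"
    using has_integral_const_real [of "npow n s" n "n+1"] by simp
  ultimately have "((\<lambda>x. npow n s - npow x s) has_integral npow n s - (- npow (n+1) (s - 1) / (s - 1) - (- npow n (s - 1) / (s - 1)))) {n..n+1}"
    by (rule has_integral_diff[rotated])
  thus ?thesis by (simp add: zeta_term_def diff_divide_distrib)
qed

lemma powr_interpolate:
  fixes x a b :: real
  assumes "x \<ge> 0" "x \<le> a" "x \<le> b" "0 \<le> t" "t \<le> 1"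
  shows "x \<le> a powr (1 - t) * b powr t"
proof (cases "x = 0")
  case False
  hence "x = x powr (1 - t) * x powr t" using assms by (simp add: powr_add [symmetric])
  also have "\<dots> \<le> a powr (1 - t) * b powr t"
    using assms by (intro mult_mono powr_mono2) auto
  finally show ?thesis .
qed auto

text \<open>The exponent of growth in \<open>|s|\<close> that is accepted for \<open>\<zeta>\<close>. Any value in the unit interval is attainable; at \<open>1/20\<close> the
twentieth power of the growth factor, which occurs in \<open>sieve_LT_lipschitz\<close>, still costs only one
factor \<open>|s|\<close>.\<close>

definition zeta_exp :: real where "zeta_exp = 1/20"

text \<open>The trivial bound \<open>2/n\<close> is not summable and the mean value bound \<open>|s|/n\<^sup>2\<close> grows too fast in \<open>s\<close>. A
geometric mean of the two is summable and grows like an arbitrarily small power of \<open>|s|\<close>.\<close>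

lemma norm_zeta_term_le:
  assumes "n \<ge> 1" "Re s \<ge> 1" "s \<noteq> 1"
  shows "norm (zeta_term n s) \<le> norm s / n\<^sup>2" "norm (zeta_term n s) \<le> 2 * (norm s powr zeta_exp * n powr (- 1 - zeta_exp))"
proof -
  have s1: "norm s \<ge> 1" using assms complex_Re_le_cmod [of s] by linarith
  have "norm (zeta_term n s) \<le> norm s / n\<^sup>2 "
    by (rule norm_integral_unit_le [OF zeta_term_integral]) (use assms npow_diff_x in auto)
  thus 1: "norm (zeta_term n s) \<le> norm s / n\<^sup>2" by simp
  have "norm (zeta_term n s) \<le> 2 / n "
  proof (rule norm_integral_unit_le [OF zeta_term_integral])
    fix x assume x: "x \<in> {n..n+1}"
    have "norm (npow n s - npow x s) \<le> norm (npow n s) + norm (npow x s)" by (rule norm_triangle_ineq4)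
    also have "\<dots> \<le> 1 / n + 1 / x" using x assms by (intro add_mono norm_npow_le) auto
    also have "\<dots> \<le> 1 / n + 1 / n" using x assms by (intro add_mono frac_le) auto
    finally show "norm (npow n s - npow x s) \<le> 2 / n" by simp
  qed (use assms in auto)
  hence 2: "norm (zeta_term n s) \<le> 2 / n" by simp
  have "norm (zeta_term n s) \<le> (2 / n) powr (1 - zeta_exp) * (2 * norm s / n\<^sup>2) powr zeta_exp"
  proof (rule powr_interpolate)
    have "norm s / n\<^sup>2 \<le> 2 * norm s / n\<^sup>2" by (intro divide_right_mono) auto
    thus "norm (zeta_term n s) \<le> 2 * norm s / n\<^sup>2" using 1 by linarith
  qed (use 2 in \<open>auto simp: zeta_exp_def\<close>)
  also have "\<dots> = 2 * (norm s powr zeta_exp * n powr (- 1 - zeta_exp))"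
  proof -
    have "(2 / n) powr (1 - zeta_exp) * (2 * norm s / n\<^sup>2) powr zeta_exp = (2 / n) powr (1 - zeta_exp) * ((2 / n) * (norm s / n)) powr zeta_exp"
      by (simp add: power2_eq_square)
    also have "\<dots> = (2 / n) powr (1 - zeta_exp) * (2 / n) powr zeta_exp * (norm s / n) powr zeta_exp"
      using assms by (subst powr_mult) auto
    also have "(2 / n) powr (1 - zeta_exp) * (2 / n) powr zeta_exp = 2 / n" using assms by (simp add: powr_add [symmetric])
    also have "(norm s / n) powr zeta_exp = norm s powr zeta_exp * n powr (- zeta_exp)"
      using assms by (simp add: powr_divide powr_minus_divide)
    finally show ?thesis using assms by (simp add: powr_diff powr_minus_divide field_simps)
  qed
  finally show "norm (zeta_term n s) \<le> 2 * (norm s powr zeta_exp * n powr (- 1 - zeta_exp))" .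
qed

text \<open>The same interpolation for differences in \<open>s\<close>: each of the two bounds gains the factor \<open>|s - s'|\<close> at the
cost of a logarithm of \<open>n\<close>.\<close>

lemma norm_zeta_term_diff_le:
  assumes "n \<ge> 1" "Re s \<ge> 1" "s \<noteq> 1" "Re s' \<ge> 1" "s' \<noteq> 1"
  shows "norm (zeta_term n s - zeta_term n s') \<le> 2 * (norm (s - s') * norm s' powr zeta_exp * ((1 + ln (n+1)) * n powr (- 1 - zeta_exp)))"
proof -
  define L where "L = 1 + ln (n+1)"
  have L: "L \<ge> 1" using assms by (auto simp: L_def)
  have s1: "norm s' \<ge> 1" using assms complex_Re_le_cmod [of s'] by linarith
  have int: "((\<lambda>x. (npow n s - npow n s') - (npow x s - npow x s')) has_integral zeta_term n s - zeta_term n s') {n..n+1}"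
    using has_integral_diff [OF zeta_term_integral [of n s] zeta_term_integral [of n s']] assms
    by (simp add: algebra_simps)
  have "norm (zeta_term n s - zeta_term n s') \<le> norm (s - s') * norm s' * L / n\<^sup>2 "
    by (rule norm_integral_unit_le [OF int]) (use assms npow_diff_both L in \<open>auto simp: L_def\<close>)
  hence 1: "norm (zeta_term n s - zeta_term n s') \<le> norm (s - s') * norm s' * L / n\<^sup>2" by simp
  have "norm (zeta_term n s - zeta_term n s') \<le> norm (s - s') * 2 * L / n "
  proof (rule norm_integral_unit_le [OF int])
    fix x assume x: "x \<in> {n..n+1}"
    have *: "norm (npow x s - npow x s') \<le> norm (s - s') * L / n" if x: "x \<in> {n..n+1}" for x
    proof -
      have "norm (npow x s - npow x s') \<le> norm (s - s') * ln x / x" by (rule npow_diff_s) (use x assms in auto)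
      also have "\<dots> \<le> norm (s - s') * L / n"
      proof (intro frac_le mult_left_mono)
        have "ln x \<le> ln (n+1)" using x assms by auto
        thus "ln x \<le> L" by (simp add: L_def)
      qed (use x assms L in auto)
      finally show ?thesis .
    qed
    have "norm ((npow n s - npow n s') - (npow x s - npow x s')) \<le> norm (s - s') * L / n + norm (s - s') * L / n"
      by (rule order_trans [OF norm_triangle_ineq4 add_mono]) (use * x assms in auto)
    thus "norm ((npow n s - npow n s') - (npow x s - npow x s')) \<le> norm (s - s') * 2 * L / n" by (simp add: mult_ac)
  qed
  hence 2: "norm (zeta_term n s - zeta_term n s') \<le> 2 * norm (s - s') * L / n" by (simp add: mult_ac)
  define M where "M = 2 * norm (s - s') * L / n"
  have M: "M \<ge> 0" using assms L by (auto simp: M_def)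
  have "norm (zeta_term n s - zeta_term n s') \<le> M powr (1 - zeta_exp) * (M * (norm s' / n)) powr zeta_exp"
  proof (rule powr_interpolate)
    have "norm (s - s') * norm s' * L / n\<^sup>2 \<le> M * (norm s' / n)"
      using assms L by (auto simp: M_def power2_eq_square field_simps)
    thus "norm (zeta_term n s - zeta_term n s') \<le> M * (norm s' / n)" using 1 by linarith
  qed (use 2 in \<open>auto simp: zeta_exp_def M_def\<close>)
  also have "\<dots> = M powr (1 - zeta_exp) * M powr zeta_exp * (norm s' / n) powr zeta_exp"
    using assms M by (subst powr_mult) auto
  also have "M powr (1 - zeta_exp) * M powr zeta_exp = M" using M by (simp add: powr_add [symmetric])
  also have "(norm s' / n) powr zeta_exp = norm s' powr zeta_exp * n powr (- zeta_exp)"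
    using assms by (simp add: powr_divide powr_minus_divide)
  also have "M * (norm s' powr zeta_exp * n powr (- zeta_exp)) = 2 * (norm (s - s') * norm s' powr zeta_exp * (L * n powr (- 1 - zeta_exp)))"
    using assms by (simp add: M_def powr_diff powr_minus_divide field_simps)
  finally show ?thesis by (simp add: L_def)
qed

lemma summable_zeta_powr: "a > 1 \<Longrightarrow> summable (\<lambda>n. real (Suc n) powr (- a))"
  using summable_real_powr_iff [of "-a"] by (subst summable_Suc_iff [of "\<lambda>n. real n powr (-a)"]) auto

lemma summable_zeta_reg_const: "summable (\<lambda>n. 2 * ((1 + ln (real (Suc n) + 1)) * real (Suc n) powr (- 1 - zeta_exp)))"
proof (rule summable_comparison_test_bigo)
  show "summable (\<lambda>n. norm (real (Suc n) powr (- (1 + 1/40))))"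
    using summable_zeta_powr [of "1 + 1/40"] by simp
  show "(\<lambda>n. 2 * ((1 + ln (real (Suc n) + 1)) * real (Suc n) powr (- 1 - zeta_exp))) \<in> O(\<lambda>n. real (Suc n) powr (- (1 + 1/40)))"
    unfolding zeta_exp_def by real_asymp
qed

definition zeta_reg_const :: real where
  "zeta_reg_const = (\<Sum>n. 2 * ((1 + ln (real (Suc n) + 1)) * real (Suc n) powr (- 1 - zeta_exp)))"

definition zeta :: "complex \<Rightarrow> complex" where "zeta s = (\<Sum>n. npow (real (Suc n)) s)"
definition zeta_reg :: "complex \<Rightarrow> complex" where "zeta_reg s = (\<Sum>n. zeta_term (real (Suc n)) s)"

lemma norm_zeta_term_le':
  assumes "Re s \<ge> 1" "s \<noteq> 1"
  shows "norm (zeta_term (real (Suc n)) s) \<le> 2 * ((1 + ln (real (Suc n) + 1)) * real (Suc n) powr (- 1 - zeta_exp)) * norm s powr zeta_exp"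
proof -
  have "norm (zeta_term (real (Suc n)) s) \<le> 2 * (norm s powr zeta_exp * (1 * real (Suc n) powr (- 1 - zeta_exp)))"
    using norm_zeta_term_le(2) [of "real (Suc n)" s] assms by simp
  also have "\<dots> \<le> 2 * (norm s powr zeta_exp * ((1 + ln (real (Suc n) + 1)) * real (Suc n) powr (- 1 - zeta_exp)))"
    by (intro mult_left_mono mult_right_mono) auto
  finally show ?thesis by (simp add: mult_ac)
qed

lemma summable_zeta_term: "Re s \<ge> 1 \<Longrightarrow> s \<noteq> 1 \<Longrightarrow> summable (\<lambda>n. zeta_term (real (Suc n)) s)"
  by (rule summable_comparison_test' [OF summable_mult2 [OF summable_zeta_reg_const]]) (rule norm_zeta_term_le')

lemma zeta_reg_const_nonneg: "zeta_reg_const \<ge> 0"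
  unfolding zeta_reg_const_def by (intro suminf_nonneg summable_zeta_reg_const) auto

lemma norm_zeta_reg_le:
  assumes "Re s \<ge> 1" "s \<noteq> 1"
  shows "norm (zeta_reg s) \<le> zeta_reg_const * norm s powr zeta_exp"
proof -
  have "norm (zeta_reg s) \<le> (\<Sum>n. 2 * ((1 + ln (real (Suc n) + 1)) * real (Suc n) powr (- 1 - zeta_exp)) * norm s powr zeta_exp)"
    unfolding zeta_reg_def by (rule norm_suminf_le) (use norm_zeta_term_le' [OF assms] summable_mult2 [OF summable_zeta_reg_const] in auto)
  also have "\<dots> = zeta_reg_const * norm s powr zeta_exp"
    unfolding zeta_reg_const_def by (rule suminf_mult2 [symmetric]) (rule summable_zeta_reg_const)
  finally show ?thesis .
qed

lemma norm_zeta_reg_diff_le: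
  assumes "Re s \<ge> 1" "s \<noteq> 1" "Re s' \<ge> 1" "s' \<noteq> 1"
  shows "norm (zeta_reg s - zeta_reg s') \<le> zeta_reg_const * norm (s - s') * norm s' powr zeta_exp"
proof -
  have "zeta_reg s - zeta_reg s' = (\<Sum>n. zeta_term (real (Suc n)) s - zeta_term (real (Suc n)) s')"
    unfolding zeta_reg_def by (intro suminf_diff summable_zeta_term assms)
  also have "norm \<dots> \<le> (\<Sum>n. 2 * ((1 + ln (real (Suc n) + 1)) * real (Suc n) powr (- 1 - zeta_exp)) * (norm (s - s') * norm s' powr zeta_exp))"
  proof (rule norm_suminf_le [OF _ summable_mult2 [OF summable_zeta_reg_const]])
    fix n show "norm (zeta_term (real (Suc n)) s - zeta_term (real (Suc n)) s') \<le> 2 * ((1 + ln (real (Suc n) + 1)) * real (Suc n) powr (- 1 - zeta_exp)) * (norm (s - s') * norm s' powr zeta_exp)"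
      using norm_zeta_term_diff_le [of "real (Suc n)" s s'] assms by (simp only: mult_ac) simp
  qed
  also have "\<dots> = zeta_reg_const * (norm (s - s') * norm s' powr zeta_exp)"
    unfolding zeta_reg_const_def by (rule suminf_mult2 [symmetric]) (rule summable_zeta_reg_const)
  finally show ?thesis by (simp add: mult_ac)
qed

text \<open>Near \<open>s = 1\<close> an explicit small constant is needed, to keep \<open>1 + z H(1 + z)\<close> away from \<open>0\<close>.\<close>

lemma norm_zeta_reg_le_linear:
  assumes "Re s \<ge> 1" "s \<noteq> 1"
  shows "norm (zeta_reg s) \<le> 2 * norm s"
proof -
  have sq: "(\<lambda>n. 1 / (real (Suc n))\<^sup>2) sums (pi\<^sup>2 / 6)"
    using inverse_squares_sums by (simp add: add.commute)
  have "norm (zeta_reg s) \<le> (\<Sum>n. norm s * (1 / (real (Suc n))\<^sup>2))"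
    unfolding zeta_reg_def by (rule norm_suminf_le) (use norm_zeta_term_le(1) [OF _ assms] summable_mult [OF sums_summable [OF sq]] in auto)
  also have "\<dots> = norm s * (pi\<^sup>2 / 6)"
    using suminf_mult [OF sums_summable [OF sq], of "norm s"] sums_unique [OF sq] by simp
  also have "\<dots> \<le> norm s * 2"
  proof (rule mult_left_mono)
    have "pi \<le> 3.3" using pi_less_4 pi_approx by simp
    hence "pi * pi \<le> 3.3 * 3.3" using pi_ge_zero by (intro mult_mono) auto
    thus "pi\<^sup>2 / 6 \<le> 2" by (simp add: power2_eq_square)
  qed auto
  finally show ?thesis by (simp add: mult.commute)
qed

lemma summable_norm_npow: "Re s > 1 \<Longrightarrow> summable (\<lambda>n. norm (npow (real (Suc n)) s))"
  using summable_zeta_powr [of "Re s"] by (simp add: norm_npow)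

text \<open>Telescoping: the integrals over unit intervals that are subtracted in the terms of \<open>zeta_reg\<close> add up
to the integral of \<open>x\<^sup>-\<^sup>s\<close> over \<open>x \<ge> 1\<close>.\<close>

lemma zeta_eq:
  assumes "Re s > 1"
  shows "zeta s = 1 / (s - 1) + zeta_reg s"
proof -
  have s1: "s \<noteq> 1" using assms by auto
  have lim: "(\<lambda>n. npow (real (Suc n)) (s - 1) / (s - 1)) \<longlonglongrightarrow> 0 / (s - 1)"
  proof (rule tendsto_divide [OF tendsto_norm_zero_cancel tendsto_const])
    have "(\<lambda>n. real (Suc n) powr (- (Re s - 1))) \<longlonglongrightarrow> 0"
      by (rule tendsto_neg_powr [OF _ filterlim_compose [OF filterlim_real_sequentially filterlim_Suc]]) (use assms in auto)
    thus "(\<lambda>n. norm (npow (real (Suc n)) (s - 1))) \<longlonglongrightarrow> 0" by (simp add: norm_npow)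
  qed (use s1 in auto)
  have "(\<lambda>n. npow (real (Suc n)) (s - 1) / (s - 1) - npow (real (Suc (Suc n))) (s - 1) / (s - 1)) sums (npow (real (Suc 0)) (s - 1) / (s - 1) - 0)"
    by (rule telescope_sums') (use lim in simp)
  moreover have "(\<lambda>n. npow (real (Suc n)) s) sums zeta s"
    unfolding zeta_def by (intro summable_sums summable_norm_cancel [OF summable_norm_npow]) (use assms in auto)
  ultimately have "(\<lambda>n. npow (real (Suc n)) s - (npow (real (Suc n)) (s - 1) / (s - 1) - npow (real (Suc (Suc n))) (s - 1) / (s - 1)))
      sums (zeta s - (npow (real (Suc 0)) (s - 1) / (s - 1) - 0))"
    by (rule sums_diff[rotated])
  moreover have "(\<lambda>n. npow (real (Suc n)) s - (npow (real (Suc n)) (s - 1) / (s - 1) - npow (real (Suc (Suc n))) (s - 1) / (s - 1)))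
    = (\<lambda>n. zeta_term (real (Suc n)) s)"
    by (rule ext) (simp add: zeta_term_def diff_divide_distrib add_ac)
  ultimately have "(\<lambda>n. zeta_term (real (Suc n)) s) sums (zeta s - 1 / (s - 1))" by simp
  thus ?thesis by (simp add: zeta_reg_def sums_iff)
qed

section \<open>Euler products\<close>

text \<open>The truncated Euler product of \<open>1/\<zeta>\<close>.\<close>

definition euler_prod :: "nat \<Rightarrow> complex \<Rightarrow> complex" where
  "euler_prod N s = (\<Prod>q | prime q \<and> q \<le> N. 1 - npow (real q) s)"

lemma finite_primes_le [simp]: "finite {q::nat. prime q \<and> q \<le> N}"
  by (rule finite_subset [of _ "{..N}"]) auto

lemma npow_has_sum:
  assumes "Re s > 1"
  shows "((\<lambda>n. npow (real n) s) has_sum zeta s) {1..}"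
proof -
  have "((\<lambda>n. npow (real (Suc n)) s) has_sum zeta s) UNIV"
    unfolding zeta_def by (intro norm_summable_imp_has_sum summable_sums summable_norm_npow summable_norm_cancel [OF summable_norm_npow] assms)
  moreover have "bij_betw Suc UNIV {1..}"
    by (auto simp: bij_betw_def image_iff Suc_le_eq gr0_conv_Suc)
  ultimately show ?thesis
    using has_sum_reindex_bij_betw [of Suc UNIV "{1..}" "\<lambda>n. npow (real n) s" "zeta s"] by simp
qed

text \<open>The sieve of Eratosthenes: multiplying by \<open>1 - q\<^sup>-\<^sup>s\<close> removes the multiples of \<open>q\<close> from the sum.\<close>

lemma npow_has_sum_coprime:
  assumes "Re s > 1" "finite S" "\<And>q. q \<in> S \<Longrightarrow> prime q"
  shows "((\<lambda>n. npow (real n) s) has_sum ((\<Prod>q\<in>S. 1 - npow (real q) s) * zeta s)) {n. n \<ge> 1 \<and> (\<forall>q\<in>S. \<not> q dvd n)}"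
  using assms(2,3)
proof (induction S rule: finite_induct)
  case empty
  have "{n. n \<ge> (1::nat) \<and> (\<forall>q\<in>{}. \<not> q dvd n)} = {1..}" by auto
  thus ?case using npow_has_sum [OF assms(1)] by simp
next
  case (insert q S)
  define A where "A = {n::nat. n \<ge> 1 \<and> (\<forall>q\<in>S. \<not> q dvd n)}"
  define c where "c = (\<Prod>q\<in>S. 1 - npow (real q) s) * zeta s"
  have q: "prime q" using insert by auto
  have A: "((\<lambda>n. npow (real n) s) has_sum c) A" using insert by (simp add: A_def c_def)
  have "((\<lambda>n. npow (real q) s * npow (real n) s) has_sum (npow (real q) s * c)) A"
    by (rule has_sum_cmult_right [OF A])
  also have "?this \<longleftrightarrow> ((\<lambda>n. npow (real (q * n)) s) has_sum (npow (real q) s * c)) A"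
    by (rule has_sum_cong) (use q in \<open>auto simp: A_def npow_mult prime_gt_0_nat\<close>)
  also have "\<dots> \<longleftrightarrow> ((\<lambda>n. npow (real n) s) has_sum (npow (real q) s * c)) ((\<lambda>n. q * n) ` A)"
    by (subst has_sum_reindex) (use q in \<open>auto simp: o_def inj_on_def prime_gt_0_nat\<close>)
  finally have B: "((\<lambda>n. npow (real n) s) has_sum (npow (real q) s * c)) ((\<lambda>n. q * n) ` A)" .
  have BA: "(\<lambda>n. q * n) ` A \<subseteq> A"
  proof safe
    fix n assume n: "n \<in> A"
    have "\<not> r dvd q * n" if "r \<in> S" for r
    proof -
      have "prime r" "r \<noteq> q" using insert that by auto
      hence "\<not> r dvd q" using q by (metis primes_dvd_imp_eq)
      thus ?thesis using n that \<open>prime r\<close> by (auto simp: A_def prime_dvd_mult_iff)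
    qed
    thus "q * n \<in> A" using n q by (auto simp: A_def prime_gt_0_nat Suc_le_eq)
  qed
  have "((\<lambda>n. npow (real n) s) has_sum (c - npow (real q) s * c)) (A - (\<lambda>n. q * n) ` A)"
    by (rule has_sum_Diff [OF A B BA])
  moreover have "A - (\<lambda>n. q * n) ` A = {n. n \<ge> 1 \<and> (\<forall>r\<in>insert q S. \<not> r dvd n)}"
  proof (intro equalityI subsetI CollectI conjI ballI notI)
    fix n assume "n \<in> A - (\<lambda>n. q * n) ` A"
    hence n: "n \<in> A" "n \<notin> (\<lambda>n. q * n) ` A" by auto
    show "n \<ge> 1" using n by (auto simp: A_def)
    fix r assume r: "r \<in> insert q S" "r dvd n"
    have "q dvd n" using r n by (auto simp: A_def)
    then obtain m where m: "n = q * m" by auto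
    hence "m \<in> A" using n q by (auto simp: A_def intro: dvd_mult Suc_leI)
    thus False using n m by auto
  qed (auto simp: A_def)
  moreover have "c - npow (real q) s * c = (\<Prod>q\<in>insert q S. 1 - npow (real q) s) * zeta s"
    using insert by (simp add: c_def algebra_simps)
  ultimately show ?case by simp
qed

text \<open>What remains after sieving by the primes up to \<open>N\<close> is the term \<open>n = 1\<close> and a part of the tail \<open>n > N\<close>.\<close>

lemma euler_prod_zeta_tendsto:
  assumes "Re s > 1"
  shows "(\<lambda>N. euler_prod N s * zeta s) \<longlonglongrightarrow> 1"
proof -
  define a where "a = (\<lambda>n::nat. real n powr (- Re s))"
  have sa: "a summable_on {1..}"
  proof -
    have "(\<lambda>n. real (Suc n) powr (- Re s)) summable_on UNIV"
      by (rule summable_nonneg_imp_summable_on) (use summable_zeta_powr assms in auto)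
    moreover have "bij_betw Suc UNIV {1..}"
      by (auto simp: bij_betw_def image_iff Suc_le_eq gr0_conv_Suc)
    ultimately show ?thesis
      using summable_on_reindex_bij_betw [of Suc UNIV "{1..}" a] by (simp add: a_def)
  qed
  have tail: "(\<lambda>N. infsum a {Suc N..}) \<longlonglongrightarrow> 0"
  proof -
    have "infsum a {Suc N..} = infsum a {1..} - (\<Sum>n=1..N. a n)" for N
    proof -
      have "infsum a ({1..} - {1..N}) = infsum a {1..} - infsum a {1..N}"
        by (rule infsum_Diff [OF sa]) auto
      moreover have "{1..} - {1..N} = {Suc N..}" by auto
      ultimately show ?thesis by simp
    qed
    moreover have "(\<lambda>N. \<Sum>n=1..N. a n) \<longlonglongrightarrow> infsum a {1..}"
    proof -
      have "((\<lambda>n. if n \<in> {1..} then a n else 0) has_sum infsum a {1..}) UNIV"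
        by (rule iffD2 [OF has_sum_cong_neutral [where T = "{1..}" and g = a] has_sum_infsum [OF sa]]) auto
      hence "(\<lambda>n. if n \<in> {1..} then a n else 0) sums infsum a {1..}" by (rule has_sum_imp_sums)
      hence "(\<lambda>N. \<Sum>n\<le>N. if n \<in> {1..} then a n else 0) \<longlonglongrightarrow> infsum a {1..}"
        by (simp add: sums_def_le)
      moreover have "(\<Sum>n\<le>N. if n \<in> {1..} then a n else 0) = (\<Sum>n=1..N. a n)" for N
        by (rule sum.mono_neutral_cong_right) auto
      ultimately show ?thesis by simp
    qed
    ultimately have "(\<lambda>N. infsum a {Suc N..}) \<longlonglongrightarrow> infsum a {1..} - infsum a {1..}"
      by (simp only: tendsto_diff tendsto_const)
    thus ?thesis by (simp only: diff_self)
  qed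
  have "norm (euler_prod N s * zeta s - 1) \<le> infsum a {Suc N..}" for N
  proof -
    define A where "A = {n::nat. n \<ge> 1 \<and> (\<forall>q\<in>{q. prime q \<and> q \<le> N}. \<not> q dvd n)}"
    have hs: "((\<lambda>n. npow (real n) s) has_sum (euler_prod N s * zeta s)) A"
      unfolding A_def euler_prod_def by (rule npow_has_sum_coprime) (use assms in auto)
    have "1 \<in> A" by (auto simp: A_def)
    have "((\<lambda>n. npow (real n) s) has_sum (euler_prod N s * zeta s - 1)) (A - {1})"
    proof (rule has_sum_Diff [OF hs])
      show "((\<lambda>n. npow (real n) s) has_sum 1) {1}" using has_sum_finite [of "{1::nat}" "\<lambda>n. npow (real n) s"] by simp
    qed (use \<open>1 \<in> A\<close> in auto)
    hence eq: "euler_prod N s * zeta s - 1 = infsum (\<lambda>n. npow (real n) s) (A - {1})" by (simp add: infsumI)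
    have sub: "A - {1} \<subseteq> {Suc N..}"
    proof
      fix n assume n: "n \<in> A - {1}"
      hence "n \<noteq> 1" by auto
      then obtain q where "prime q" "q dvd n" by (metis prime_factor_nat)
      hence "q > N" "q \<le> n" using n by (auto simp: A_def intro: dvd_imp_le)
      thus "n \<in> {Suc N..}" by auto
    qed
    have sN: "a summable_on {Suc N..}" by (rule summable_on_subset [OF sa]) auto
    have "norm (euler_prod N s * zeta s - 1) \<le> infsum (\<lambda>n. norm (npow (real n) s)) (A - {1})"
      unfolding eq
    proof (rule norm_infsum_bound)
      have "a summable_on (A - {1})" by (rule summable_on_subset [OF sN sub])
      thus "(\<lambda>n. norm (npow (real n) s)) summable_on A - {1}"
        by (rule summable_on_cong [THEN iffD1, rotated]) (auto simp: a_def A_def norm_npow)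
    qed
    also have "\<dots> = infsum a (A - {1})" by (rule infsum_cong) (auto simp: a_def A_def norm_npow)
    also have "\<dots> \<le> infsum a {Suc N..}"
      by (rule infsum_mono_neutral) (use sub sN summable_on_subset [OF sN sub] in \<open>auto simp: a_def\<close>)
    finally show ?thesis .
  qed
  hence "(\<lambda>N. euler_prod N s * zeta s - 1) \<longlonglongrightarrow> 0"
    by (intro Lim_null_comparison [OF _ tail]) auto
  thus ?thesis by (rule LIM_zero_cancel)
qed

section \<open>A lower bound for zeta\<close>

lemma ln_norm_one_minus_sums:
  fixes z :: complex
  assumes "norm z < 1"
  shows "(\<lambda>n. - Re (z ^ n) / real n) sums ln (norm (1 - z))"
proof -
  have "(\<lambda>n. - ((- (- z)) ^ n) / of_nat n) sums Ln (1 + - z)"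
    by (rule Ln_series') (use assms in simp)
  hence "(\<lambda>n. Re (- (z ^ n) / of_real (real n))) sums Re (Ln (1 + - z))"
    using sums_Re by fastforce
  moreover have "Re (Ln (1 + - z)) = ln (norm (1 - z))"
    using assms by (subst Re_Ln) auto
  ultimately show ?thesis by (simp only: Re_divide_of_real uminus_complex.sel)
qed

text \<open>The logarithm of the left side is \<open>-\<Sum> x\<^sup>n/n (3 + 4 cos n\<theta> + cos 2n\<theta>)\<close> where \<open>w = e\<^sup>i\<^sup>\<theta>\<close>, and the trigonometric
factor is \<open>2 (1 + cos n\<theta>)\<^sup>2\<close>.\<close>

lemma three_four_one_local:
  fixes w :: complex and x :: real
  assumes "norm w = 1" "0 \<le> x" "x < 1"
  shows "norm (1 - of_real x :: complex) ^ 3 * norm (1 - of_real x * w) ^ 4 * norm (1 - of_real x * w\<^sup>2) \<le> 1"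
proof -
  have lt: "norm (of_real x :: complex) < 1" "norm (of_real x * w) < 1" "norm (of_real x * w\<^sup>2) < 1"
    using assms by (auto simp: norm_mult norm_power)
  have pos: "norm (1 - of_real x :: complex) > 0" "norm (1 - of_real x * w) > 0" "norm (1 - of_real x * w\<^sup>2) > 0"
    using lt by auto
  have "(\<lambda>n. 3 * (- Re (of_real x ^ n) / real n) + 4 * (- Re ((of_real x * w) ^ n) / real n) + (- Re ((of_real x * w\<^sup>2) ^ n) / real n))
     sums (3 * ln (norm (1 - of_real x :: complex)) + 4 * ln (norm (1 - of_real x * w)) + ln (norm (1 - of_real x * w\<^sup>2)))"
    by (intro sums_add sums_mult ln_norm_one_minus_sums lt)
  moreover have "3 * (- Re (of_real x ^ n) / real n) + 4 * (- Re ((of_real x * w) ^ n) / real n) + (- Re ((of_real x * w\<^sup>2) ^ n) / real n) \<le> 0" for n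
  proof -
    define u where "u = w ^ n"
    have nu: "(Re u)\<^sup>2 + (Im u)\<^sup>2 = 1" using assms by (simp add: u_def norm_power flip: cmod_power2)
    have "(of_real x * w\<^sup>2) ^ n = of_real (x ^ n) * u\<^sup>2"
      by (simp add: u_def power_mult_distrib mult.commute flip: power_mult)
    hence 1: "Re ((of_real x * w\<^sup>2) ^ n) = x ^ n * (2 * (Re u)\<^sup>2 - 1)"
      using nu by (simp add: power2_eq_square)
    have 2: "Re ((of_real x * w) ^ n) = x ^ n * Re u" by (simp add: u_def power_mult_distrib flip: of_real_power)
    have 3: "Re (of_real x ^ n) = x ^ n" by (simp flip: of_real_power)
    have "3 * (- Re (of_real x ^ n) / real n) + 4 * (- Re ((of_real x * w) ^ n) / real n) + (- Re ((of_real x * w\<^sup>2) ^ n) / real n)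
       = - (x ^ n * (2 * (1 + Re u)\<^sup>2)) / real n"
      unfolding 1 2 3 by (cases "n = 0") (simp_all add: power2_eq_square field_simps)
    also have "\<dots> \<le> 0" using assms by (intro divide_nonpos_nonneg) auto
    finally show ?thesis .
  qed
  ultimately have "3 * ln (norm (1 - of_real x :: complex)) + 4 * ln (norm (1 - of_real x * w)) + ln (norm (1 - of_real x * w\<^sup>2)) \<le> 0"
    by (elim sums_le [OF _ _ sums_zero, rotated])
  hence "ln (norm (1 - of_real x :: complex) ^ 3 * norm (1 - of_real x * w) ^ 4 * norm (1 - of_real x * w\<^sup>2)) \<le> 0"
    using pos by (simp add: ln_mult ln_realpow)
  thus ?thesis using pos by (subst (asm) ln_le_zero_iff) auto
qed

lemma three_four_one_euler_prod:
  assumes "\<sigma> > 1"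
  shows "norm (euler_prod N (of_real \<sigma>)) ^ 3 * norm (euler_prod N (Complex \<sigma> t)) ^ 4 * norm (euler_prod N (Complex \<sigma> (2 * t))) \<le> 1"
proof -
  have "norm (euler_prod N (of_real \<sigma>)) ^ 3 * norm (euler_prod N (Complex \<sigma> t)) ^ 4 * norm (euler_prod N (Complex \<sigma> (2 * t)))
     = (\<Prod>q | prime q \<and> q \<le> N. norm (1 - npow (real q) (of_real \<sigma>)) ^ 3 * norm (1 - npow (real q) (Complex \<sigma> t)) ^ 4 * norm (1 - npow (real q) (Complex \<sigma> (2 * t))))"
    by (simp add: euler_prod_def prod.distrib prod_power_distrib flip: prod_norm)
  also have "\<dots> \<le> 1"
  proof (rule prod_le_1, safe)
    fix q :: nat assume q: "prime q"
    define x where "x = real q powr (- \<sigma>)"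
    define w where "w = exp (- (\<i> * of_real t * of_real (ln (real q))))"
    have q1: "real q > 1" using prime_gt_1_nat [OF q] by simp
    have x: "x \<ge> 0" "x < 1" using q1 assms by (auto simp: x_def powr_less_one)
    have w: "norm w = 1" by (simp add: w_def)
    have 1: "npow (real q) (of_real \<sigma>) = of_real x"
      using q1 by (simp add: npow_def x_def powr_def flip: exp_of_real)
    have npc: "npow (real q) (Complex \<sigma> t) = of_real x * exp (- (\<i> * of_real t * of_real (ln (real q))))" for t
    proof -
      have "npow (real q) (Complex \<sigma> t) = exp (of_real (- \<sigma> * ln (real q)) + - (\<i> * of_real t * of_real (ln (real q))))"
        unfolding npow_def by (rule arg_cong [of _ _ exp]) (simp add: complex_eq_iff)
      also have "\<dots> = of_real (exp (- \<sigma> * ln (real q))) * exp (- (\<i> * of_real t * of_real (ln (real q))))"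
        unfolding exp_add by (simp only: exp_of_real)
      finally show ?thesis using q1 by (simp add: x_def powr_def)
    qed
    have 2: "npow (real q) (Complex \<sigma> t) = of_real x * w" by (simp add: npc w_def)
    have 3: "npow (real q) (Complex \<sigma> (2 * t)) = of_real x * w\<^sup>2"
      by (simp add: npc w_def mult_ac flip: exp_double)
    show "norm (1 - npow (real q) (of_real \<sigma>)) ^ 3 * norm (1 - npow (real q) (Complex \<sigma> t)) ^ 4 * norm (1 - npow (real q) (Complex \<sigma> (2 * t))) \<le> 1"
      unfolding 1 2 3 by (rule three_four_one_local) (use x w in auto)
  qed auto
  finally show ?thesis .
qed

lemma zeta_nonzero: "Re s > 1 \<Longrightarrow> zeta s \<noteq> 0"
  using euler_prod_zeta_tendsto [of s] LIMSEQ_unique [of "\<lambda>_. 0::complex" 0 1] by auto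

lemma euler_prod_tendsto:
  assumes "Re s > 1"
  shows "(\<lambda>N. euler_prod N s) \<longlonglongrightarrow> 1 / zeta s"
proof -
  have "(\<lambda>N. euler_prod N s * zeta s / zeta s) \<longlonglongrightarrow> 1 / zeta s"
    by (intro tendsto_divide euler_prod_zeta_tendsto tendsto_const zeta_nonzero assms)
  thus ?thesis using zeta_nonzero [OF assms] by simp
qed

lemma three_four_one_zeta:
  assumes "\<sigma> > 1"
  shows "1 \<le> norm (zeta (of_real \<sigma>)) ^ 3 * norm (zeta (Complex \<sigma> t)) ^ 4 * norm (zeta (Complex \<sigma> (2 * t)))"
proof -
  define L where "L = norm (1 / zeta (of_real \<sigma>)) ^ 3 * norm (1 / zeta (Complex \<sigma> t)) ^ 4 * norm (1 / zeta (Complex \<sigma> (2 * t)))"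
  have "(\<lambda>N. norm (euler_prod N (of_real \<sigma>)) ^ 3 * norm (euler_prod N (Complex \<sigma> t)) ^ 4 * norm (euler_prod N (Complex \<sigma> (2 * t)))) \<longlonglongrightarrow> L"
    unfolding L_def by (intro tendsto_intros euler_prod_tendsto) (use assms in auto)
  hence "L \<le> 1" by (rule LIMSEQ_le_const2) (use three_four_one_euler_prod [OF assms] in auto)
  moreover have "zeta (of_real \<sigma>) \<noteq> 0" "zeta (Complex \<sigma> t) \<noteq> 0" "zeta (Complex \<sigma> (2 * t)) \<noteq> 0"
    using assms by (auto intro!: zeta_nonzero)
  ultimately show ?thesis by (simp add: L_def norm_divide power_divide field_simps)
qed

text \<open>The hypothesis \<open>quart\<close> is what the inequality with exponents \<open>3, 4, 1\<close> yields; it degenerates as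
\<open>d\<close> tends to \<open>0\<close>. The Lipschitz bound carries the value at a well chosen \<open>d0\<close> over to all smaller \<open>d\<close>.\<close>

lemma quartic_lower_bound:
  fixes F :: "real \<Rightarrow> real"
  assumes A: "A \<ge> 1" and nonneg: "\<And>d. F d \<ge> 0"
    and quart: "\<And>d. 0 < d \<Longrightarrow> d \<le> 1 \<Longrightarrow> d ^ 3 / (125 * A) \<le> F d ^ 4"
    and lip: "\<And>d d'. 0 < d \<Longrightarrow> 0 < d' \<Longrightarrow> \<bar>F d - F d'\<bar> \<le> A * \<bar>d - d'\<bar>"
    and d: "0 < d" "d \<le> 1"
  shows "F d \<ge> 1 / (2000 * A ^ 4)"
proof -
  (* For this d0 the lower bound from quart at d0 is exactly 2 A d0, twice the variation below d0. *)
  define d0 where "d0 = 1 / (2000 * A ^ 5)"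
  have "1 \<le> A ^ 5" using A by (rule one_le_power)
  hence "1 \<le> 2000 * A ^ 5" by linarith
  hence d0: "d0 > 0" "d0 \<le> 1" using A by (auto simp: d0_def divide_le_eq_1)
  have key: "F e \<ge> 2 * A * d0" if e: "d0 \<le> e" "e \<le> 1" for e
  proof -
    have "(2 * A * d0) ^ 4 = d0 ^ 3 / (125 * A)"
      using A by (simp add: d0_def field_simps power_mult_distrib eval_nat_numeral)
    also have "\<dots> \<le> e ^ 3 / (125 * A)" using e d0 A by (intro divide_right_mono power_mono) auto
    also have "\<dots> \<le> F e ^ 4" using e d0 by (intro quart) auto
    finally show ?thesis using nonneg [of e] power_le_imp_le_base [of "2 * A * d0" 3 "F e"] by (simp add: eval_nat_numeral)
  qed
  have "F d \<ge> A * d0"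
  proof (cases "d0 \<le> d")
    case True
    moreover have "0 \<le> A * d0" using A d0 by simp
    ultimately show ?thesis using key [of d] d by linarith
  next
    case False
    hence "\<bar>F d - F d0\<bar> \<le> A * (d0 - d)" using lip [of d d0] d d0 by (simp add: abs_if)
    moreover have "A * (d0 - d) \<le> A * d0" using A d by (intro mult_left_mono) auto
    ultimately show ?thesis using key [of d0] d0 by linarith
  qed
  also have "A * d0 = 1 / (2000 * A ^ 4)" using A by (simp add: d0_def eval_nat_numeral)
  finally show ?thesis .
qed

text \<open>Dominates \<open>zeta_reg_const\<close>, with room for the contribution of the pole at distance at least \<open>1/8\<close>.\<close>

definition zeta_const :: real where "zeta_const = 64 + zeta_reg_const"

lemma zeta_const_ge: "zeta_const \<ge> 64" "zeta_reg_const \<le> zeta_const" using zeta_reg_const_nonneg by (auto simp: zeta_const_def)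

text \<open>A bound that is uniform up to the line \<open>Re s = 1\<close>: \<open>quartic_lower_bound\<close> applied to \<open>d \<mapsto> |\<zeta>(1 + d + it)|\<close>, with
\<open>A\<close> a bound both for \<open>|\<zeta>|\<close> at height \<open>2t\<close> and for the Lipschitz constant of \<open>\<zeta>\<close> at height \<open>t\<close>.\<close>

lemma zeta_lower:
  assumes "0 < d" "d \<le> 1" "\<bar>t\<bar> \<ge> 1/8"
  shows "norm (zeta (Complex (1 + d) t)) \<ge> 1 / (2000 * (zeta_const * (2 + 2 * \<bar>t\<bar>) powr zeta_exp) ^ 4)"
proof -
  define A where "A = zeta_const * (2 + 2 * \<bar>t\<bar>) powr zeta_exp"
  have a1: "(2 + 2 * \<bar>t\<bar>) powr zeta_exp \<ge> 1" by (rule ge_one_powr_ge_zero) (auto simp: zeta_exp_def)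
  have powr_le: "norm s powr zeta_exp \<le> (2 + 2 * \<bar>t\<bar>) powr zeta_exp" if "norm s \<le> 2 + 2 * \<bar>t\<bar>" for s :: complex
    using that by (intro powr_mono2) (auto simp: zeta_exp_def)
  have KHA: "zeta_reg_const * (2 + 2 * \<bar>t\<bar>) powr zeta_exp + 64 \<le> A"
    using a1 by (simp add: A_def zeta_const_def distrib_right)
  have A1: "A \<ge> 1" using KHA mult_nonneg_nonneg [OF zeta_reg_const_nonneg powr_ge_zero, of "2 + 2 * \<bar>t\<bar>" zeta_exp] by linarith
  have nC: "norm (Complex (1 + d) u) \<le> 1 + d + \<bar>u\<bar>" if "d > 0" for d u
    using cmod_le [of "Complex (1 + d) u"] that by simp
  (* Cutting off at d = 1 gives a function that satisfies the Lipschitz bound for all positive arguments. *)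
  define F where "F = (\<lambda>d. norm (zeta (Complex (1 + min d 1) t)))"
  have "F d \<ge> 1 / (2000 * A ^ 4)"
  proof (rule quartic_lower_bound [OF A1, where F = F and d = d])
    fix e :: real assume e: "0 < e" "e \<le> 1"
    define X where "X = norm (zeta (of_real (1 + e)))"
    define Z where "Z = norm (zeta (Complex (1 + e) (2 * t)))"
    have "zeta (of_real (1 + e)) = 1 / of_real e + zeta_reg (of_real (1 + e))"
      using zeta_eq [of "of_real (1 + e)"] e by simp
    hence "X \<le> norm (1 / of_real e :: complex) + norm (zeta_reg (of_real (1 + e)))"
      unfolding X_def by (metis norm_triangle_ineq)
    also have "norm (zeta_reg (of_real (1 + e))) \<le> 2 * norm (of_real (1 + e) :: complex)"
      by (rule norm_zeta_reg_le_linear) (use e in \<open>auto simp: complex_eq_iff\<close>)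
    also have "norm (of_real (1 + e) :: complex) = 1 + e" using e by (simp only: norm_of_real)
    also have "norm (1 / of_real e :: complex) + 2 * (1 + e) \<le> 5 / e"
    proof -
      have "4 \<le> 4 / e" using e by (simp add: field_simps)
      moreover have "norm (1 / of_real e :: complex) = 1 / e" using e by (simp add: norm_divide)
      moreover have "5 / e = 1 / e + 4 / e" by (simp add: add_divide_distrib [symmetric])
      ultimately show ?thesis using e by simp
    qed
    finally have X: "X \<le> 5 / e" by simp
    have "zeta (Complex (1 + e) (2 * t)) = 1 / (Complex (1 + e) (2 * t) - 1) + zeta_reg (Complex (1 + e) (2 * t))"
      by (rule zeta_eq) (use e in simp)
    hence "Z \<le> norm (1 / (Complex (1 + e) (2 * t) - 1)) + norm (zeta_reg (Complex (1 + e) (2 * t)))"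
      unfolding Z_def by (metis norm_triangle_ineq)
    also have "norm (1 / (Complex (1 + e) (2 * t) - 1)) \<le> 1 / (1/4)"
      unfolding norm_divide norm_one
      using abs_Im_le_cmod [of "Complex (1 + e) (2 * t) - 1"] assms by (intro frac_le) auto
    also have "norm (zeta_reg (Complex (1 + e) (2 * t))) \<le> zeta_reg_const * norm (Complex (1 + e) (2 * t)) powr zeta_exp"
      by (rule norm_zeta_reg_le) (use e in \<open>auto simp: complex_eq_iff\<close>)
    also have "\<dots> \<le> zeta_reg_const * (2 + 2 * \<bar>t\<bar>) powr zeta_exp"
      by (intro mult_left_mono powr_le zeta_reg_const_nonneg) (use nC [of e "2 * t"] e in auto)
    finally have "Z \<le> 4 + zeta_reg_const * (2 + 2 * \<bar>t\<bar>) powr zeta_exp" by simp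
    hence Z: "Z \<le> A" using KHA by linarith
    have Fe: "F e = norm (zeta (Complex (1 + e) t))" using e by (simp add: F_def min_def)
    have "1 \<le> X ^ 3 * F e ^ 4 * Z"
      using three_four_one_zeta [of "1 + e" t] e by (simp add: X_def Fe Z_def)
    also have "\<dots> \<le> (5 / e) ^ 3 * F e ^ 4 * A"
      using X Z e by (intro mult_mono power_mono) (auto simp: X_def Z_def Fe)
    finally show "e ^ 3 / (125 * A) \<le> F e ^ 4"
      using e A1 by (simp add: field_simps power_divide)
  next
    fix e e' :: real assume e: "0 < e" "0 < e'"
    define s where "s = Complex (1 + min e 1) t"
    define s' where "s' = Complex (1 + min e' 1) t"
    have Re: "Re s > 1" "Re s' > 1" "s \<noteq> 1" "s' \<noteq> 1" using e by (auto simp: s_def s'_def complex_eq_iff)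
    have ns: "norm (s - s') \<le> \<bar>e - e'\<bar>"
    proof -
      have "s - s' = of_real (min e 1 - min e' 1)" by (simp add: s_def s'_def complex_eq_iff)
      hence "norm (s - s') = \<bar>min e 1 - min e' 1\<bar>" by (simp only: norm_of_real)
      thus ?thesis by (simp add: min_def abs_if)
    qed
    have ge: "norm (s - 1) \<ge> 1/8" "norm (s' - 1) \<ge> 1/8"
      using abs_Im_le_cmod [of "s - 1"] abs_Im_le_cmod [of "s' - 1"] assms by (auto simp: s_def s'_def)
    have "zeta s - zeta s' = (s' - s) / ((s - 1) * (s' - 1)) + (zeta_reg s - zeta_reg s')"
      using Re by (simp add: zeta_eq divide_simps) (simp add: algebra_simps)
    hence "norm (zeta s - zeta s') \<le> norm ((s' - s) / ((s - 1) * (s' - 1))) + norm (zeta_reg s - zeta_reg s')"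
      by (metis norm_triangle_ineq)
    also have "norm ((s' - s) / ((s - 1) * (s' - 1))) \<le> norm (s - s') / ((1/8) * (1/8))"
      unfolding norm_divide norm_mult norm_minus_commute [of s' s]
      using ge by (intro frac_le mult_mono) auto
    also have "norm (zeta_reg s - zeta_reg s') \<le> zeta_reg_const * norm (s - s') * norm s' powr zeta_exp"
      by (rule norm_zeta_reg_diff_le) (use Re in auto)
    also have "\<dots> \<le> zeta_reg_const * norm (s - s') * (2 + 2 * \<bar>t\<bar>) powr zeta_exp"
      by (intro mult_left_mono powr_le mult_nonneg_nonneg zeta_reg_const_nonneg)
        (use nC [of "min e' 1" t] e in \<open>auto simp: s'_def\<close>)
    also have "norm (s - s') / ((1/8) * (1/8)) + zeta_reg_const * norm (s - s') * (2 + 2 * \<bar>t\<bar>) powr zeta_exp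
       = (zeta_reg_const * (2 + 2 * \<bar>t\<bar>) powr zeta_exp + 64) * norm (s - s')" by (simp add: algebra_simps)
    also have "\<dots> \<le> A * \<bar>e - e'\<bar>" using KHA ns A1 by (intro mult_mono) auto
    finally have "norm (zeta s - zeta s') \<le> A * \<bar>e - e'\<bar>" by simp
    thus "\<bar>F e - F e'\<bar> \<le> A * \<bar>e - e'\<bar>"
      using norm_triangle_ineq3 [of "zeta s" "zeta s'"] by (simp add: F_def s_def s'_def)
  qed (use assms in \<open>auto simp: F_def\<close>)
  thus ?thesis using assms by (simp add: F_def A_def min_def)
qed

section \<open>The limiting Laplace transform\<close>

text \<open>The function in \<open>sieve_LT_eq\<close>, with \<open>\<zeta>(1 + z) = 1/z + H\<close> inserted and common powers of \<open>z\<close>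
cancelled, so that nothing singular is left at \<open>z = 0\<close>.\<close>

definition sieve_LT :: "complex \<Rightarrow> complex" where
  "sieve_LT z = 2 * (1 - zeta_reg (1 + z)) * (2 + z + z * zeta_reg (1 + z)) / ((1 + z * zeta_reg (1 + z)) * (1 + z))\<^sup>2"

lemma sieve_LT_eq:
  assumes "Re z > 0"
  shows "sieve_LT z = 2 / (z ^ 3 * (zeta (1 + z))\<^sup>2) - 2 / (z * (1 + z)\<^sup>2)"
proof -
  have z0: "z \<noteq> 0" "1 + z \<noteq> 0" using assms by (auto simp: complex_eq_iff)
  define J where "J = 1 + z * zeta_reg (1 + z)"
  have J: "J = z * zeta (1 + z)" using zeta_eq [of "1 + z"] assms z0 by (simp add: J_def field_simps)
  have J0: "J \<noteq> 0" using zeta_nonzero [of "1 + z"] assms z0 by (simp add: J)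
  have *: "2 / (z * J\<^sup>2) - 2 / (z * w\<^sup>2) = 2 * (w\<^sup>2 - J\<^sup>2) / (z * (J * w)\<^sup>2)" if "w \<noteq> 0" for w
    using z0 J0 that by (simp add: field_simps power2_eq_square)
  have "z ^ 3 * (zeta (1 + z))\<^sup>2 = z * J\<^sup>2" by (simp add: J power2_eq_square power3_eq_cube)
  hence "2 / (z ^ 3 * (zeta (1 + z))\<^sup>2) - 2 / (z * (1 + z)\<^sup>2) = 2 * ((1 + z)\<^sup>2 - J\<^sup>2) / (z * (J * (1 + z))\<^sup>2)"
    using z0 J0 * [of "1 + z"] by simp
  also have "(1 + z)\<^sup>2 - J\<^sup>2 = z * ((1 - zeta_reg (1 + z)) * (2 + z + z * zeta_reg (1 + z)))"
    by (simp add: J_def power2_eq_square algebra_simps)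
  also have "2 * (z * ((1 - zeta_reg (1 + z)) * (2 + z + z * zeta_reg (1 + z)))) / (z * (J * (1 + z))\<^sup>2) = sieve_LT z"
    unfolding sieve_LT_def J_def [symmetric] using z0 by simp
  finally show ?thesis ..
qed

text \<open>The quotient rule with all sizes made explicit. Numerators are \<open>O(a\<^sup>2 T)\<close> and the denominators are at least
\<open>T\<^sup>4 / a\<^sup>8\<close> up to constants, so that the quotient gains \<open>T\<^sup>-\<^sup>3\<close> and loses a power of \<open>a\<close>; the
exponents of \<open>k\<close> and \<open>a\<close> are not optimal.\<close>

lemma quotient_lipschitz_algebra:
  fixes z z' H H' :: complex and k a T e :: real
  defines "N \<equiv> \<lambda>z H. 2 * (1 - H) * (2 + z + z * H)" and "D \<equiv> \<lambda>z H. (1 + z * H) * (1 + z)"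
  assumes k: "k \<ge> 1" and a: "a \<ge> 1" and T: "T \<ge> 1" and e: "e \<ge> 0"
    and H: "norm H \<le> k * a" "norm H' \<le> k * a" and z: "norm z \<le> k * T" "norm z' \<le> k * T"
    and dz: "norm (z - z') \<le> e" and dH: "norm (H - H') \<le> k * a * e"
    and D: "norm (D z H) \<ge> T\<^sup>2 / (k * a ^ 4)" "norm (D z' H') \<ge> T\<^sup>2 / (k * a ^ 4)"
  shows "norm (N z H / (D z H)\<^sup>2 - N z' H' / (D z' H')\<^sup>2) \<le> 2000 * k ^ 13 * a ^ 20 * e / T ^ 3"
proof -
  have ka: "k * a \<ge> 1" using k a mult_mono [of 1 k 1 a] by simp
  have kT: "k * T \<ge> 1" using k T mult_mono [of 1 k 1 T] by simp
  have kk: "k * T * (k * a) \<ge> 1" using ka kT mult_mono [of 1 "k*T" 1 "k*a"] by simp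
  define M where "M = k * T * (k * a)"
  have M1: "M \<ge> 1" "k * T \<le> M" "k * a \<le> M"
    using kk ka kT mult_left_mono [of 1 "k * a" "k * T"] mult_right_mono [of 1 "k * T" "k * a"] k a T by (auto simp: M_def)
  have zH: "norm (z * H) \<le> M" "norm (z' * H') \<le> M"
    unfolding norm_mult M_def using z H k a T by (intro mult_mono; simp)+
  have dzH: "norm (z * H - z' * H') \<le> 2 * M * e"
  proof -
    have "z * H - z' * H' = (z - z') * H + z' * (H - H')" by (simp add: algebra_simps)
    hence "norm (z * H - z' * H') \<le> norm ((z - z') * H) + norm (z' * (H - H'))" by (metis norm_triangle_ineq)
    also have "\<dots> \<le> e * (k * a) + (k * T) * (k * a * e)"
      unfolding norm_mult using z H dz dH e k a T by (intro add_mono mult_mono) auto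
    also have "\<dots> \<le> M * e + M * e" using M1 e mult_right_mono [of "k * a" M e] by (simp add: M_def mult_ac)
    finally show ?thesis by simp
  qed
  have f1: "norm (1 - H) \<le> 2 * (k * a)" "norm (1 - H') \<le> 2 * (k * a)"
    using norm_triangle_ineq4 [of 1 H] norm_triangle_ineq4 [of 1 H'] H ka by auto
  have f2: "norm (2 + z + z * H) \<le> 4 * M" "norm (2 + z' + z' * H') \<le> 4 * M"
    using norm_triangle_ineq [of "2 + z" "z * H"] norm_triangle_ineq [of 2 z] norm_triangle_ineq [of "2 + z'" "z' * H'"] norm_triangle_ineq [of 2 z'] z zH M1
    by auto
  have N': "norm (N z' H') \<le> 16 * (k * a) * M"
    unfolding N_def norm_mult using mult_mono [OF f1(2) f2(2)] k a T M1 by (simp add: mult_ac)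
  have dN: "norm (N z H - N z' H') \<le> 20 * (k * a) * M * e"
  proof -
    have "N z H - N z' H' = 2 * ((H' - H) * (2 + z + z * H) + (1 - H') * ((z - z') + (z * H - z' * H')))"
      by (simp add: N_def algebra_simps)
    hence "norm (N z H - N z' H') \<le> 2 * (norm ((H' - H) * (2 + z + z * H)) + norm ((1 - H') * ((z - z') + (z * H - z' * H'))))"
      by (simp add: norm_mult norm_triangle_ineq del: distrib_left_numeral) (metis norm_mult norm_triangle_ineq)
    also have "norm ((H' - H) * (2 + z + z * H)) \<le> (k * a * e) * (4 * M)"
      unfolding norm_mult norm_minus_commute [of H'] using dH f2(1) k a e by (intro mult_mono) auto
    also have "norm ((1 - H') * ((z - z') + (z * H - z' * H'))) \<le> (2 * (k * a)) * (e + 2 * M * e)"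
      unfolding norm_mult using f1(2) dz dzH k a e norm_triangle_ineq [of "z - z'" "z * H - z' * H'"] by (intro mult_mono) auto
    also have "e + 2 * M * e \<le> 3 * M * e" using M1 e mult_right_mono [of 1 M e] by simp
    also have "2 * (k * a * e * (4 * M) + 2 * (k * a) * (3 * M * e)) = 20 * (k * a) * M * e" by simp
    finally show ?thesis using k a by simp
  qed
  have z1: "norm (1 + z) \<le> 2 * (k * T)" "norm (1 + z') \<le> 2 * (k * T)"
    using norm_triangle_ineq [of 1 z] norm_triangle_ineq [of 1 z'] z kT by auto
  have J: "norm (1 + z * H) \<le> 2 * M" "norm (1 + z' * H') \<le> 2 * M"
    using norm_triangle_ineq [of 1 "z * H"] norm_triangle_ineq [of 1 "z' * H'"] zH M1 by auto
  have Du: "norm (D z H) \<le> 4 * M * (k * T)" "norm (D z' H') \<le> 4 * M * (k * T)"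
    unfolding D_def norm_mult using mult_mono [OF J(1) z1(1)] mult_mono [OF J(2) z1(2)] M1 by simp_all
  have dD: "norm (D z' H' - D z H) \<le> 6 * M * (k * T) * e"
  proof -
    have "D z' H' - D z H = - ((z * H - z' * H') * (1 + z)) - (1 + z' * H') * (z - z')"
      by (simp add: D_def algebra_simps)
    hence "norm (D z' H' - D z H) \<le> norm ((z * H - z' * H') * (1 + z)) + norm ((1 + z' * H') * (z - z'))"
      by (metis norm_minus_cancel norm_triangle_ineq4)
    also have "\<dots> \<le> (2 * M * e) * (2 * (k * T)) + (2 * M) * e"
      unfolding norm_mult using dzH z1(1) J(2) dz M1 e by (intro add_mono mult_mono) auto
    finally have "norm (D z' H' - D z H) \<le> (2 * M * e) * (2 * (k * T)) + (2 * M) * e" .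
    moreover have "(2 * M * e) * 1 \<le> (2 * M * e) * (k * T)" by (rule mult_left_mono [OF kT]) (use M1 e in simp)
    ultimately show ?thesis by (simp add: mult_ac)
  qed
  define L where "L = T\<^sup>2 / (k * a ^ 4)"
  have L: "L > 0" using T k a by (auto simp: L_def)
  have Lz: "L \<le> norm (D z H)" "L \<le> norm (D z' H')" using D by (auto simp: L_def)
  have D0: "D z H \<noteq> 0" "D z' H' \<noteq> 0" using L Lz by auto
  have "N z H / (D z H)\<^sup>2 - N z' H' / (D z' H')\<^sup>2
      = (N z H - N z' H') / (D z H)\<^sup>2 + N z' H' * (D z' H' - D z H) * (D z' H' + D z H) / ((D z H)\<^sup>2 * (D z' H')\<^sup>2)"
    using D0 by (simp add: field_simps power2_eq_square)
  also have "norm \<dots> \<le> norm ((N z H - N z' H') / (D z H)\<^sup>2) + norm (N z' H' * (D z' H' - D z H) * (D z' H' + D z H) / ((D z H)\<^sup>2 * (D z' H')\<^sup>2))"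
    by (rule norm_triangle_ineq)
  also have "norm ((N z H - N z' H') / (D z H)\<^sup>2) \<le> (20 * (k * a) * M * e) / L\<^sup>2"
    unfolding norm_divide norm_power using dN L Lz k a T e M1 by (intro frac_le power_mono) auto
  also have "norm (N z' H' * (D z' H' - D z H) * (D z' H' + D z H) / ((D z H)\<^sup>2 * (D z' H')\<^sup>2))
      \<le> ((16 * (k * a) * M) * (6 * M * (k * T) * e) * (8 * M * (k * T))) / (L\<^sup>2 * L\<^sup>2)"
    unfolding norm_divide norm_mult norm_power
  proof (intro frac_le mult_mono power_mono)
    show "norm (D z' H' + D z H) \<le> 8 * M * (k * T)" using norm_triangle_ineq [of "D z' H'" "D z H"] Du by linarith
  qed (use N' dD L Lz k a T e M1 in auto)
  also have "(20 * (k * a) * M * e) / L\<^sup>2 = 20 * (k ^ 5 * a ^ 10) * e / T ^ 3"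
    using k a T by (simp add: L_def M_def field_simps eval_nat_numeral)
  also have "\<dots> \<le> 20 * (k ^ 13 * a ^ 20) * e / T ^ 3"
    using k a T e by (intro divide_right_mono mult_right_mono mult_left_mono mult_mono power_increasing) auto
  also have "((16 * (k * a) * M) * (6 * M * (k * T) * e) * (8 * M * (k * T))) / (L\<^sup>2 * L\<^sup>2) = 768 * (k ^ 13 * a ^ 20) * e / T ^ 3"
    using k a T by (simp add: L_def M_def field_simps eval_nat_numeral)
  also have "20 * (k ^ 13 * a ^ 20) * e / T ^ 3 + 768 * (k ^ 13 * a ^ 20) * e / T ^ 3 = 788 * (k ^ 13 * a ^ 20 * e / T ^ 3)"
    by simp
  also have "\<dots> \<le> 2000 * (k ^ 13 * a ^ 20 * e / T ^ 3)"
    using k a T e by (intro mult_right_mono) auto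
  finally show ?thesis by (simp add: mult_ac)
qed

text \<open>Away from \<open>z = 0\<close> the last bound is \<open>zeta_lower\<close>, since \<open>1 + z H(1 + z) = z \<zeta>(1 + z)\<close>; near \<open>z = 0\<close> it
holds because \<open>z H(1 + z)\<close> is small.\<close>

lemma sieve_LT_point_bounds:
  fixes d t :: real
  defines "z \<equiv> Complex d t" and "T \<equiv> 2 + 2 * \<bar>t\<bar>" and "a \<equiv> (2 + 2 * \<bar>t\<bar>) powr zeta_exp"
  assumes d: "0 < d" "d \<le> 1/8"
  shows "norm (zeta_reg (1 + z)) \<le> zeta_const * a" "norm z \<le> T" "norm (1 + z) \<le> T"
    "T\<^sup>2 / (144000 * zeta_const ^ 4 * a ^ 4) \<le> norm ((1 + z * zeta_reg (1 + z)) * (1 + z))"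
proof -
  have a1: "a \<ge> 1" unfolding a_def by (rule ge_one_powr_ge_zero) (auto simp: zeta_exp_def)
  have nz: "norm z \<le> d + \<bar>t\<bar>" using cmod_le [of z] d by (simp add: z_def)
  show zT: "norm z \<le> T" using nz d by (simp add: T_def)
  show z1T: "norm (1 + z) \<le> T" using norm_triangle_ineq [of 1 z] nz d by (simp add: T_def)
  have z1: "1 + z \<noteq> 1" "Re (1 + z) \<ge> 1" "Re (1 + z) > 1" using d by (auto simp: z_def complex_eq_iff)
  have "norm (zeta_reg (1 + z)) \<le> zeta_reg_const * norm (1 + z) powr zeta_exp" using z1 by (intro norm_zeta_reg_le) auto
  also have "\<dots> \<le> zeta_const * a"
    unfolding a_def T_def [symmetric] using z1T zeta_const_ge zeta_reg_const_nonneg by (intro mult_mono powr_mono2) (auto simp: zeta_exp_def)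
  finally show "norm (zeta_reg (1 + z)) \<le> zeta_const * a" .
  have J: "T / (36000 * zeta_const ^ 4 * a ^ 4) \<le> norm (1 + z * zeta_reg (1 + z))"
  proof (cases "\<bar>t\<bar> \<ge> 1/8")
    case True
    have z0: "z \<noteq> 0" using d by (auto simp: z_def complex_eq_iff)
    have "1 + z * zeta_reg (1 + z) = z * zeta (1 + z)" using zeta_eq [of "1 + z"] z1 z0 by (simp add: field_simps)
    moreover have "1 + z = Complex (1 + d) t" by (simp add: z_def complex_eq_iff)
    ultimately have "norm (1 + z * zeta_reg (1 + z)) = norm z * norm (zeta (Complex (1 + d) t))" by (simp add: norm_mult)
    moreover have "norm z * norm (zeta (Complex (1 + d) t)) \<ge> (T / 18) * (1 / (2000 * (zeta_const * a) ^ 4))"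
    proof (intro mult_mono)
      show "T / 18 \<le> norm z" using abs_Im_le_cmod [of z] True by (simp add: T_def z_def)
      show "1 / (2000 * (zeta_const * a) ^ 4) \<le> norm (zeta (Complex (1 + d) t))"
        unfolding a_def using zeta_lower [of d t] d True by simp
    qed auto
    moreover have "(T / 18) * (1 / (2000 * (zeta_const * a) ^ 4)) = T / (36000 * zeta_const ^ 4 * a ^ 4)" by (simp add: power_mult_distrib)
    ultimately show ?thesis by linarith
  next
    case False
    have "norm z \<le> 1/4" using nz d False by simp
    hence "norm z * norm (zeta_reg (1 + z)) \<le> (1/4) * (2 * (5/4))"
      using norm_zeta_reg_le_linear [of "1 + z"] z1 norm_triangle_ineq [of 1 z] by (intro mult_mono) auto
    hence "norm (z * zeta_reg (1 + z)) \<le> 5/8" by (simp add: norm_mult)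
    hence "norm (1 + z * zeta_reg (1 + z)) \<ge> 3/8" using norm_triangle_ineq2 [of 1 "- (z * zeta_reg (1 + z))"] by simp
    moreover have "T / (36000 * zeta_const ^ 4 * a ^ 4) \<le> 3 / 8"
    proof -
      have "1 \<le> zeta_const ^ 4 * a ^ 4" using mult_mono [of 1 "zeta_const^4" 1 "a^4"] one_le_power [of zeta_const 4] one_le_power [of a 4] a1 zeta_const_ge by simp
      hence "T \<le> 3 / 8 * (36000 * (zeta_const ^ 4 * a ^ 4))" using False by (simp add: T_def)
      thus ?thesis using a1 zeta_const_ge by (simp add: field_simps)
    qed
    ultimately show ?thesis by linarith
  qed
  have "T / 4 \<le> norm (1 + z)"
    using abs_Im_le_cmod [of "1 + z"] abs_Re_le_cmod [of "1 + z"] d by (simp add: T_def z_def)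
  hence "T / (36000 * zeta_const ^ 4 * a ^ 4) * (T / 4) \<le> norm (1 + z * zeta_reg (1 + z)) * norm (1 + z)"
    using J by (intro mult_mono) (auto simp: T_def)
  thus "T\<^sup>2 / (144000 * zeta_const ^ 4 * a ^ 4) \<le> norm ((1 + z * zeta_reg (1 + z)) * (1 + z))"
    by (simp add: norm_mult power2_eq_square)
qed

text \<open>Uniformity in \<open>d\<close> lets the abscissa \<open>d\<close> tend to \<open>0\<close> with the frequency resolution in \<open>sieve_err_fourier\<close>, and
the factor \<open>inverse (1 + t\<^sup>2)\<close> makes the bound integrable along vertical lines. The algebra loses the
growth factor to the power \<open>20\<close>, that is one factor \<open>T\<close>, and leaves \<open>T / T\<^sup>3\<close>.\<close>

lemma sieve_LT_lipschitz:
  "\<exists>C\<ge>0. \<forall>d t e. 0 < d \<and> d \<le> 1/8 \<and> \<bar>e\<bar> \<le> 4 \<longrightarrow>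
     norm (sieve_LT (Complex d (t + e)) - sieve_LT (Complex d t)) \<le> C * \<bar>e\<bar> * inverse (1 + t\<^sup>2)"
proof -
  (* A common constant for the bounds at both points; the shift by at most 4 costs a factor 5 in T and in a. *)
  define k where "k = 10 ^ 10 * zeta_const ^ 4"
  have K14: "0 < zeta_const" "1 \<le> zeta_const ^ 4" "zeta_const \<le> zeta_const ^ 4" using zeta_const_ge one_le_power [of zeta_const 4] power_increasing [of 1 4 zeta_const] by auto
  have k: "k \<ge> 1" "5 * zeta_const \<le> k" "5 \<le> k" using K14 by (auto simp: k_def)
  show ?thesis
  proof (intro exI [of _ "2000 * k ^ 13"] conjI allI impI)
    fix d t e :: real assume as: "0 < d \<and> d \<le> 1/8 \<and> \<bar>e\<bar> \<le> 4"
    define z z' where "z = Complex d (t + e)" "z' = Complex d t"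
    define T a where "T = 2 + 2 * \<bar>t\<bar>" "a = (2 + 2 * \<bar>t\<bar>) powr zeta_exp"
    define T' a' where "T' = 2 + 2 * \<bar>t + e\<bar>" "a' = (2 + 2 * \<bar>t + e\<bar>) powr zeta_exp"
    note defs = z_z'_def T_a_def T'_a'_def
    have T1: "T \<ge> 1" "T' \<ge> 1" "T' \<le> 5 * T" "T \<le> 5 * T'" using as by (auto simp: defs abs_if split: if_splits)
    have a1: "a \<ge> 1" unfolding defs by (rule ge_one_powr_ge_zero) (auto simp: zeta_exp_def)
    have a'1: "a' \<ge> 1" unfolding defs by (rule ge_one_powr_ge_zero) (auto simp: zeta_exp_def)
    have a': "a' \<le> 5 * a"
    proof -
      have "a' = T' powr zeta_exp" by (simp add: defs)
      also have "\<dots> \<le> (5 * T) powr zeta_exp" using T1 by (intro powr_mono2) (auto simp: zeta_exp_def)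
      also have "\<dots> = 5 powr zeta_exp * a" unfolding T_a_def by (subst powr_mult) auto
      also have "5 powr zeta_exp \<le> (5::real) powr 1" by (intro powr_mono) (auto simp: zeta_exp_def)
      finally show ?thesis using a1 by simp
    qed
    have pt: "norm (zeta_reg (1 + z')) \<le> zeta_const * a" "norm z' \<le> T" "norm (1 + z') \<le> T"
      "T\<^sup>2 / (144000 * zeta_const ^ 4 * a ^ 4) \<le> norm ((1 + z' * zeta_reg (1 + z')) * (1 + z'))"
      unfolding defs by (rule sieve_LT_point_bounds; use as in simp)+
    have pt': "norm (zeta_reg (1 + z)) \<le> zeta_const * a'" "norm z \<le> T'" "norm (1 + z) \<le> T'"
      "T'\<^sup>2 / (144000 * zeta_const ^ 4 * a' ^ 4) \<le> norm ((1 + z * zeta_reg (1 + z)) * (1 + z))"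
      unfolding defs by (rule sieve_LT_point_bounds; use as in simp)+
    have "norm (sieve_LT z - sieve_LT z') \<le> 2000 * k ^ 13 * a ^ 20 * \<bar>e\<bar> / T ^ 3"
      unfolding sieve_LT_def
    proof (rule quotient_lipschitz_algebra)
      have "zeta_const * a' \<le> zeta_const * (5 * a)" using a' zeta_const_ge by (intro mult_left_mono) auto
      also have "\<dots> \<le> k * a" using mult_right_mono [OF k(2), of a] a1 by (simp add: mult_ac)
      finally show "norm (zeta_reg (1 + z)) \<le> k * a" using pt'(1) by simp
      have "zeta_const * a \<le> k * a" using a1 k zeta_const_ge by (intro mult_right_mono) auto
      thus "norm (zeta_reg (1 + z')) \<le> k * a" using pt(1) by simp
      have "5 * T \<le> k * T" using k T1 by (intro mult_right_mono) auto
      thus "norm z \<le> k * T" "norm z' \<le> k * T" using pt(2) pt'(2) T1 by linarith+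
      have zz: "z - z' = \<i> * of_real e" by (simp add: defs complex_eq_iff)
      hence nzz: "norm (z - z') = \<bar>e\<bar>" by (simp add: norm_mult)
      thus "norm (z - z') \<le> \<bar>e\<bar>" by simp
      have "norm (zeta_reg (1 + z) - zeta_reg (1 + z')) \<le> zeta_reg_const * norm ((1 + z) - (1 + z')) * norm (1 + z') powr zeta_exp"
        by (rule norm_zeta_reg_diff_le) (use as in \<open>auto simp: defs complex_eq_iff\<close>)
      also have "(1 + z) - (1 + z') = z - z'" by simp
      also have "zeta_reg_const * norm (z - z') * norm (1 + z') powr zeta_exp \<le> k * \<bar>e\<bar> * a"
        unfolding nzz
      proof (intro mult_mono)
        show "norm (1 + z') powr zeta_exp \<le> a" using pt(3) by (auto simp: defs zeta_exp_def intro!: powr_mono2)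
        show "zeta_reg_const \<le> k" using zeta_const_ge k by linarith
      qed (use k in auto)
      finally show "norm (zeta_reg (1 + z) - zeta_reg (1 + z')) \<le> k * a * \<bar>e\<bar>" by (simp add: mult_ac)
      have "T\<^sup>2 / (k * a ^ 4) \<le> T\<^sup>2 / (144000 * zeta_const ^ 4 * a ^ 4)"
        using K14 a1 by (intro divide_left_mono mult_right_mono) (auto simp: k_def)
      thus "T\<^sup>2 / (k * a ^ 4) \<le> norm ((1 + z' * zeta_reg (1 + z')) * (1 + z'))" using pt(4) by linarith
      have "T\<^sup>2 / (k * a ^ 4) = T\<^sup>2 / (10 ^ 10 * zeta_const ^ 4 * a ^ 4)" by (simp add: k_def)
      also have "\<dots> \<le> (5 * T')\<^sup>2 / (10 ^ 10 * zeta_const ^ 4 * a ^ 4)"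
        using T1 a1 K14 by (intro divide_right_mono power_mono) auto
      also have "\<dots> \<le> (5 * T')\<^sup>2 / (10 ^ 10 * zeta_const ^ 4 * (a' / 5) ^ 4)"
        using a' a1 a'1 K14 T1 by (intro divide_left_mono mult_left_mono power_mono) auto
      also have "\<dots> = (625 * 25 / 10 ^ 10) * (T'\<^sup>2 / (zeta_const ^ 4 * a' ^ 4))"
        by (simp add: power_divide power_mult_distrib)
      also have "\<dots> \<le> (1 / 144000) * (T'\<^sup>2 / (zeta_const ^ 4 * a' ^ 4))"
        using K14 a'1 T1 by (intro mult_right_mono) auto
      also have "\<dots> = T'\<^sup>2 / (144000 * zeta_const ^ 4 * a' ^ 4)" by simp
      finally show "T\<^sup>2 / (k * a ^ 4) \<le> norm ((1 + z * zeta_reg (1 + z)) * (1 + z))" using pt'(4) by linarith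
    qed (use k a1 T1 in auto)
    (* The choice zeta_exp = 1/20 is made for this step. *)
    also have "a ^ 20 = T"
      using T1 by (simp add: defs powr_realpow [symmetric] powr_powr zeta_exp_def)
    also have "2000 * k ^ 13 * T * \<bar>e\<bar> / T ^ 3 = 2000 * k ^ 13 * \<bar>e\<bar> * inverse (T\<^sup>2)"
      using T1 by (simp add: field_simps eval_nat_numeral)
    also have "\<dots> \<le> 2000 * k ^ 13 * \<bar>e\<bar> * inverse (1 + t\<^sup>2)"
    proof (intro mult_left_mono le_imp_inverse_le)
      have "1 + \<bar>t\<bar>\<^sup>2 \<le> (1 + \<bar>t\<bar>)\<^sup>2" unfolding power2_sum by simp
      also have "\<dots> \<le> T\<^sup>2" unfolding T_a_def by (intro power_mono) auto
      finally show "1 + t\<^sup>2 \<le> T\<^sup>2" by simp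
    qed (use k in \<open>auto intro: add_pos_nonneg\<close>)
    finally show "norm (sieve_LT (Complex d (t + e)) - sieve_LT (Complex d t)) \<le> 2000 * k ^ 13 * \<bar>e\<bar> * inverse (1 + t\<^sup>2)"
      by (simp add: defs)
  qed (use k in auto)
qed

section \<open>Bounding a function by its Fourier transform\<close>

lemma gaussian_fourier:
  "(LINT u|lborel. std_normal_density u *\<^sub>R iexp (- (x * u))) = complex_of_real (sqrt (2 * pi) * std_normal_density x)"
proof -
  have "char std_normal_distribution (- x) = of_real (exp (- (x\<^sup>2) / 2))"
    by (simp add: char_std_normal_distribution)
  also have "char std_normal_distribution (- x) = (LINT u|lborel. std_normal_density u *\<^sub>R iexp (- x * u))"
    unfolding char_def by (subst integral_density) auto
  finally show ?thesis by (simp add: std_normal_density_def)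
qed

text \<open>Fourier inversion for a Gaussian average of \<open>\<phi>\<close>: writing one Gaussian as the transform of another
moves the transform onto \<open>\<phi>\<close> by Fubini.\<close>

lemma gaussian_average_bound:
  fixes \<phi> :: "real \<Rightarrow> complex"
  defines "F \<equiv> \<lambda>u. LINT s|lborel. iexp (- (u * s)) * \<phi> s"
  assumes int: "integrable lborel \<phi>" and F: "integrable lborel F" and e: "e > 0"
  shows "norm (LINT x|lborel. std_normal_density x *\<^sub>R \<phi> (t + e * x)) \<le> (LINT u|lborel. norm (F u)) / (2 * pi)"
proof -
  define G where "G = (\<lambda>x u. std_normal_density u *\<^sub>R (iexp (- (x * u)) * \<phi> (t + e * x)))"
  have meas [measurable]: "\<phi> \<in> borel_measurable borel" using int by auto
  have int': "integrable lborel (\<lambda>x. \<phi> (t + e * x))"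
    using lborel_integrable_real_affine [OF int, of e t] e by simp
  have Gint: "integrable (lborel \<Otimes>\<^sub>M lborel) (\<lambda>(x, u). G x u)"
  proof (rule lborel_pair.Fubini_integrable)
    show "(\<lambda>(x, u). G x u) \<in> borel_measurable (lborel \<Otimes>\<^sub>M lborel)"
      unfolding G_def by measurable
    have "(LINT u|lborel. norm (case (x, u) of (x, u) \<Rightarrow> G x u)) = norm (\<phi> (t + e * x))" for x
      by (simp add: G_def norm_mult integral_normal_density)
    thus "integrable lborel (\<lambda>x. LINT u|lborel. norm (case (x, u) of (x, u) \<Rightarrow> G x u))"
      using int' by simp
    show "AE x in lborel. integrable lborel (\<lambda>u. case (x, u) of (x, u) \<Rightarrow> G x u)"
    proof (rule AE_I2)
      fix x :: real
      show "integrable lborel (\<lambda>u. case (x, u) of (x, u) \<Rightarrow> G x u)"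
        unfolding prod.case
      proof (rule Bochner_Integration.integrable_bound)
        show "integrable lborel (\<lambda>u. std_normal_density u * norm (\<phi> (t + e * x)))"
          by (intro integrable_mult_left) auto
        show "G x \<in> borel_measurable lborel" unfolding G_def by measurable
      qed (auto simp: G_def norm_mult)
    qed
  qed
  have inner: "norm (LINT x|lborel. iexp (- (x * u)) * \<phi> (t + e * x)) = norm (F (u / e)) / e" for u
  proof -
    have "F (u / e) = e *\<^sub>R (LINT x|lborel. iexp (- (u / e * (t + e * x))) * \<phi> (t + e * x))"
      unfolding F_def using e by (subst lborel_integral_real_affine [of e _ t]) auto
    also have "(LINT x|lborel. iexp (- (u / e * (t + e * x))) * \<phi> (t + e * x))
       = (LINT x|lborel. iexp (- (u / e * t)) * (iexp (- (x * u)) * \<phi> (t + e * x)))"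
    proof (intro Bochner_Integration.integral_cong refl)
      fix x :: real
      have "- (u / e * (t + e * x)) = - (u / e * t) + - (x * u)" using e by (simp add: field_simps)
      thus "iexp (- (u / e * (t + e * x))) * \<phi> (t + e * x) = iexp (- (u / e * t)) * (iexp (- (x * u)) * \<phi> (t + e * x))"
        by (simp only: of_real_add distrib_left exp_add mult.assoc)
    qed
    finally have "norm (F (u / e)) = e * norm (LINT x|lborel. iexp (- (x * u)) * \<phi> (t + e * x))"
      using e by (simp add: norm_mult)
    thus ?thesis using e by simp
  qed
  have "complex_of_real (sqrt (2 * pi)) * (LINT x|lborel. std_normal_density x *\<^sub>R \<phi> (t + e * x))
      = (LINT x|lborel. (LINT u|lborel. G x u))"
  proof -
    have "(LINT u|lborel. G x u) = complex_of_real (sqrt (2 * pi)) * (std_normal_density x *\<^sub>R \<phi> (t + e * x))" for x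
    proof -
      have "(LINT u|lborel. G x u) = (LINT u|lborel. (std_normal_density u *\<^sub>R iexp (- (x * u))) * \<phi> (t + e * x))"
        unfolding G_def by simp
      also have "\<dots> = (LINT u|lborel. std_normal_density u *\<^sub>R iexp (- (x * u))) * \<phi> (t + e * x)"
        by (rule integral_mult_left_zero)
      finally show ?thesis unfolding gaussian_fourier by (simp add: scaleR_conv_of_real)
    qed
    thus ?thesis by (simp only: integral_mult_right_zero)
  qed
  also have "\<dots> = (LINT u|lborel. (LINT x|lborel. G x u))"
    by (rule lborel_pair.Fubini_integral [OF Gint, symmetric])
  also have "norm \<dots> \<le> (LINT u|lborel. norm (F (u / e)) / (e * sqrt (2 * pi)))"
  proof (rule Bochner_Integration.integral_norm_bound_integral)
    show "integrable lborel (\<lambda>u. LINT x|lborel. G x u)"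
      using lborel_pair.integrable_snd [OF Gint] by simp
    have "integrable lborel (\<lambda>u. F (0 + (1 / e) * u))"
      by (rule lborel_integrable_real_affine [OF F]) (use e in auto)
    thus "integrable lborel (\<lambda>u. norm (F (u / e)) / (e * sqrt (2 * pi)))"
      by (intro integrable_divide integrable_norm) (simp add: mult.commute)
    fix u :: real assume "u \<in> space lborel"
    have "(LINT x|lborel. G x u) = std_normal_density u *\<^sub>R (LINT x|lborel. iexp (- (x * u)) * \<phi> (t + e * x))"
      unfolding G_def by (rule integral_scaleR_right)
    hence "norm (LINT x|lborel. G x u) = std_normal_density u * (norm (F (u / e)) / e)"
      using inner [of u] by simp
    also have "\<dots> \<le> 1 / sqrt (2 * pi) * (norm (F (u / e)) / e)"
      using e by (intro mult_right_mono) (auto simp: std_normal_density_def field_simps)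
    finally show "norm (LINT x|lborel. G x u) \<le> norm (F (u / e)) / (e * sqrt (2 * pi))" by (simp add: mult.commute)
  qed
  also have "\<dots> = (LINT u|lborel. norm (F u)) / sqrt (2 * pi)"
  proof -
    have "(LINT u|lborel. norm (F u)) = \<bar>1 / e\<bar> *\<^sub>R (LINT u|lborel. norm (F (0 + 1 / e * u)))"
      by (rule lborel_integral_real_affine) (use e in auto)
    hence "(LINT u|lborel. norm (F (u / e))) = e * (LINT u|lborel. norm (F u))" using e by (simp add: mult.commute)
    thus ?thesis using e by (simp add: field_simps)
  qed
  finally have main: "sqrt (2 * pi) * norm (LINT x|lborel. std_normal_density x *\<^sub>R \<phi> (t + e * x)) \<le> (LINT u|lborel. norm (F u)) / sqrt (2 * pi)"
    by (simp add: norm_mult)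
  have *: "y \<le> X / (s * s)" if "s > 0" "s * y \<le> X / s" for s y X :: real
    using that by (simp add: field_simps)
  have "norm (LINT x|lborel. std_normal_density x *\<^sub>R \<phi> (t + e * x)) \<le> (LINT u|lborel. norm (F u)) / (sqrt (2 * pi) * sqrt (2 * pi))"
    by (rule * [OF _ main]) simp
  also have "sqrt (2 * pi) * sqrt (2 * pi) = 2 * pi" by simp
  finally show ?thesis .
qed

text \<open>The consequence \<open>|\<phi>(t)| \<le> \<parallel>F\<parallel>\<^sub>1 / 2\<pi>\<close> of Fourier inversion, obtained by letting the width of the Gaussian
in \<open>gaussian_average_bound\<close> tend to \<open>0\<close>.\<close>

lemma fourier_sup_bound:
  fixes \<phi> :: "real \<Rightarrow> complex"
  defines "F \<equiv> \<lambda>u. LINT s|lborel. iexp (- (u * s)) * \<phi> s"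
  assumes int: "integrable lborel \<phi>" and F: "integrable lborel F"
    and bd: "\<And>x. norm (\<phi> x) \<le> M" and cont: "isCont \<phi> t"
  shows "norm (\<phi> t) \<le> (LINT u|lborel. norm (F u)) / (2 * pi)"
proof -
  have meas [measurable]: "\<phi> \<in> borel_measurable borel" using int by auto
  have "(\<lambda>k. LINT x|lborel. std_normal_density x *\<^sub>R \<phi> (t + inverse (real (Suc k)) * x)) \<longlonglongrightarrow> (LINT x|lborel. std_normal_density x *\<^sub>R \<phi> t)"
  proof (rule integral_dominated_convergence [where w = "\<lambda>x. std_normal_density x * M"])
    show "AE x in lborel. (\<lambda>k. std_normal_density x *\<^sub>R \<phi> (t + inverse (real (Suc k)) * x)) \<longlonglongrightarrow> std_normal_density x *\<^sub>R \<phi> t"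
    proof (intro AE_I2 tendsto_scaleR tendsto_const isCont_tendsto_compose [OF cont])
      fix x :: real
      have "(\<lambda>k. t + inverse (real (Suc k)) * x) \<longlonglongrightarrow> t + 0 * x"
        by (intro tendsto_intros LIMSEQ_inverse_real_of_nat)
      thus "(\<lambda>k. t + inverse (real (Suc k)) * x) \<longlonglongrightarrow> t" by simp
    qed
    show "AE x in lborel. norm (std_normal_density x *\<^sub>R \<phi> (t + inverse (real (Suc k)) * x)) \<le> std_normal_density x * M" for k
      using bd by (intro AE_I2) (auto intro!: mult_left_mono)
  qed auto
  moreover have "(LINT x|lborel. std_normal_density x *\<^sub>R \<phi> t) = \<phi> t"
    by (subst integral_scaleR_left) auto
  ultimately have "(\<lambda>k. norm (LINT x|lborel. std_normal_density x *\<^sub>R \<phi> (t + inverse (real (Suc k)) * x))) \<longlonglongrightarrow> norm (\<phi> t)"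
    by (metis tendsto_norm)
  thus ?thesis
    by (rule LIMSEQ_le_const2) (use gaussian_average_bound [OF int, of _ t] F in \<open>auto simp: F_def\<close>)
qed

section \<open>Sieve operators and Laplace transforms\<close>

text \<open>The operator \<open>1 - a T\<^sub>q\<close>, where \<open>T\<^sub>q\<close> is the dilation \<open>u(X) \<mapsto> u(X/q)\<close>. Sieve sums arise from products of
such operators, and multiplying by a further prime is one more application.\<close>

definition subshift :: "real \<Rightarrow> nat \<Rightarrow> (real \<Rightarrow> real) \<Rightarrow> real \<Rightarrow> real" where
  "subshift a q u X = u X - a * u (X / real q)"

text \<open>The product of the operators \<open>1 - \<alpha>(q) T\<^sub>q\<close> over \<open>q \<in> A\<close>, expanded. For a set of primes this is the sum of
\<open>\<mu>(m) \<alpha>(m) u(X/m)\<close> over the squarefree \<open>m\<close> composed of these primes, with \<open>\<alpha>\<close> extended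
multiplicatively.\<close>

definition subshifts :: "nat set \<Rightarrow> (nat \<Rightarrow> real) \<Rightarrow> (real \<Rightarrow> real) \<Rightarrow> real \<Rightarrow> real" where
  "subshifts A \<alpha> u X = (\<Sum>B\<in>Pow A. (\<Prod>q\<in>B. - \<alpha> q) * u (X / real (\<Prod>B)))"

lemma subshifts_empty [simp]: "subshifts {} \<alpha> u = u"
  by (rule ext) (simp add: subshifts_def)

lemma subshifts_subshift: "subshifts A \<alpha> (subshift a q u) = subshift a q (subshifts A \<alpha> u)"
  by (rule ext) (simp add: subshifts_def subshift_def right_diff_distrib sum_subtractf sum_distrib_left mult_ac)

lemma subshifts_insert:
  assumes "finite A" "q \<notin> A"
  shows "subshifts (insert q A) \<alpha> u = subshift (\<alpha> q) q (subshifts A \<alpha> u)"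
proof
  fix X :: real
  have fin: "finite B" if "B \<in> Pow A" for B using that assms(1) finite_subset by auto
  have nq: "q \<notin> B" if "B \<in> Pow A" for B using that assms(2) by auto
  have "subshifts (insert q A) \<alpha> u X = (\<Sum>B\<in>Pow A \<union> insert q ` Pow A. (\<Prod>q\<in>B. - \<alpha> q) * u (X / real (\<Prod>B)))"
    by (simp add: subshifts_def Pow_insert)
  also have "\<dots> = subshifts A \<alpha> u X + (\<Sum>B\<in>insert q ` Pow A. (\<Prod>q\<in>B. - \<alpha> q) * u (X / real (\<Prod>B)))"
    unfolding subshifts_def by (rule sum.union_disjoint) (use assms in auto)
  also have "(\<Sum>B\<in>insert q ` Pow A. (\<Prod>q\<in>B. - \<alpha> q) * u (X / real (\<Prod>B)))
      = (\<Sum>B\<in>Pow A. (\<Prod>q\<in>insert q B. - \<alpha> q) * u (X / real (\<Prod>(insert q B))))"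
  proof -
    have "inj_on (insert q) (Pow A)"
      by (rule inj_onI) (metis Diff_insert_absorb nq)
    thus ?thesis by (simp only: sum.reindex o_def)
  qed
  also have "\<dots> = (\<Sum>B\<in>Pow A. - \<alpha> q * ((\<Prod>q\<in>B. - \<alpha> q) * u (X / real q / real (\<Prod>B))))"
    by (intro sum.cong refl) (simp add: fin nq)
  also have "\<dots> = - \<alpha> q * subshifts A \<alpha> u (X / real q)" unfolding subshifts_def by (rule sum_distrib_left [symmetric])
  finally show "subshifts (insert q A) \<alpha> u X = subshift (\<alpha> q) q (subshifts A \<alpha> u) X" by (simp add: subshift_def)
qed

lemma prod_primes_ge_1:
  assumes "\<And>q. q \<in> B \<Longrightarrow> prime (q::nat)"
  shows "real (\<Prod>B) \<ge> 1"
proof -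
  have "\<Prod>B \<ge> 1" using assms by (intro prod_ge_1) (auto simp: Suc_le_eq prime_gt_0_nat)
  thus ?thesis by (metis of_nat_1 of_nat_mono)
qed

lemma subshifts_zero:
  assumes "\<And>q. q \<in> A \<Longrightarrow> prime q" "\<And>Y. 0 < Y \<Longrightarrow> Y \<le> 1 \<Longrightarrow> u Y = 0" "0 < X" "X \<le> 1"
  shows "subshifts A \<alpha> u X = 0"
  unfolding subshifts_def
proof (rule sum.neutral, rule ballI)
  fix B assume "B \<in> Pow A"
  hence "real (\<Prod>B) \<ge> 1" using assms(1) by (intro prod_primes_ge_1) auto
  hence "u (X / real (\<Prod>B)) = 0" using assms(3,4) by (intro assms(2)) auto
  thus "(\<Prod>q\<in>B. - \<alpha> q) * u (X / real (\<Prod>B)) = 0" by simp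
qed

lemma subshifts_cong:
  assumes "\<And>q. q \<in> A \<Longrightarrow> prime q" "\<And>Y. 0 < Y \<Longrightarrow> Y \<le> X \<Longrightarrow> u Y = u' Y" "0 < X"
  shows "subshifts A \<alpha> u X = subshifts A \<alpha> u' X"
  unfolding subshifts_def
proof (rule sum.cong [OF refl])
  fix B assume "B \<in> Pow A"
  hence "real (\<Prod>B) \<ge> 1" using assms(1) by (intro prod_primes_ge_1) auto
  hence "u (X / real (\<Prod>B)) = u' (X / real (\<Prod>B))"
    using assms(3) mult_left_mono [of 1 "real (\<Prod>B)" X] by (intro assms(2)) (auto simp: field_simps)
  thus "(\<Prod>q\<in>B. - \<alpha> q) * u (X / real (\<Prod>B)) = (\<Prod>q\<in>B. - \<alpha> q) * u' (X / real (\<Prod>B))" by simp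
qed

text \<open>Dilations by primes that are at least \<open>X\<close> only produce values of \<open>u\<close> at arguments at most \<open>1\<close>.\<close>

lemma subshifts_stable:
  assumes "finite B" "finite A" "\<And>q. q \<in> A \<union> B \<Longrightarrow> prime q" "\<And>q. q \<in> B \<Longrightarrow> X \<le> real q"
    "\<And>Y. 0 < Y \<Longrightarrow> Y \<le> 1 \<Longrightarrow> u Y = 0" "0 < X"
  shows "subshifts (A \<union> B) \<alpha> u X = subshifts A \<alpha> u X"
  using assms(1,3,4)
proof (induction B rule: finite_induct)
  case (insert q B)
  show ?case
  proof (cases "q \<in> A")
    case True thus ?thesis using insert by (simp add: insert_absorb)
  next
    case False
    have q0: "real q > 0" using insert.prems(1) [of q] prime_gt_0_nat by auto
    have "subshifts (A \<union> insert q B) \<alpha> u X = subshifts (A \<union> B) \<alpha> u X - \<alpha> q * subshifts (A \<union> B) \<alpha> u (X / real q)"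
      using insert False assms(2) by (simp add: subshifts_insert subshift_def)
    also have "subshifts (A \<union> B) \<alpha> u (X / real q) = 0"
      using insert.prems q0 assms(5,6) by (intro subshifts_zero) auto
    finally show ?thesis using insert by simp
  qed
qed auto

text \<open>\<open>L\<close> is the bilateral Laplace transform at \<open>z\<close> of \<open>t \<mapsto> u(e\<^sup>t)\<close>. The dilation \<open>T\<^sub>q\<close> becomes multiplication by
\<open>q\<^sup>-\<^sup>z\<close>.\<close>

definition has_LT :: "(real \<Rightarrow> real) \<Rightarrow> complex \<Rightarrow> complex \<Rightarrow> bool" where
  "has_LT u z L \<longleftrightarrow> has_bochner_integral lborel (\<lambda>t. of_real (u (exp t)) * exp (- (z * of_real t))) L"

lemma has_LT_subshift:
  assumes "has_LT u z L" "q > 0"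
  shows "has_LT (subshift a q u) z ((1 - of_real a * npow (real q) z) * L)"
proof -
  define h where "h = (\<lambda>t::real. complex_of_real (u (exp t)) * exp (- (z * of_real t)))"
  have "has_bochner_integral lborel (\<lambda>t. h (- ln (real q) + 1 * t)) (L /\<^sub>R \<bar>1\<bar>)"
    using assms(1) lborel_has_bochner_integral_real_affine_iff [of 1 h L "- ln (real q)"] by (simp add: has_LT_def h_def)
  hence 1: "has_bochner_integral lborel (\<lambda>t. h (t - ln (real q))) L" by simp
  have B: "has_bochner_integral lborel (\<lambda>t. h t - (of_real a * npow (real q) z) * h (t - ln (real q))) (L - (of_real a * npow (real q) z) * L)"
    using assms(1) 1 unfolding has_LT_def h_def [symmetric]
    by (intro has_bochner_integral_diff has_bochner_integral_mult_right) auto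
  have eq: "h t - (of_real a * npow (real q) z) * h (t - ln (real q)) = of_real (subshift a q u (exp t)) * exp (- (z * of_real t))" for t
  proof -
    have "npow (real q) z * exp (- (z * of_real (t - ln (real q)))) = exp (- (z * of_real t))"
      unfolding npow_def exp_add [symmetric] by (simp add: algebra_simps)
    moreover have "exp (t - ln (real q)) = exp t / real q" using assms(2) by (simp add: exp_diff)
    ultimately show ?thesis by (simp add: h_def subshift_def algebra_simps)
  qed
  show ?thesis using B by (simp only: has_LT_def eq left_diff_distrib mult_1_left)
qed

lemma has_LT_subshifts:
  assumes "finite A" "\<And>q. q \<in> A \<Longrightarrow> q > 0" "has_LT u z L"
  shows "has_LT (subshifts A \<alpha> u) z ((\<Prod>q\<in>A. 1 - of_real (\<alpha> q) * npow (real q) z) * L)"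
  using assms(1,2)
proof (induction A rule: finite_induct)
  case (insert q A)
  show ?case unfolding subshifts_insert [OF insert(1,2)]
    using has_LT_subshift [OF insert.IH, of q "\<alpha> q"] insert by (simp add: mult.assoc)
qed (use assms in auto)

lemma complex_laplace_FTC:
  fixes F f :: "real \<Rightarrow> complex"
  assumes deriv: "\<And>t. (F has_vector_derivative f t) (at t)" and cont: "continuous_on UNIV f"
    and lim: "(F \<longlongrightarrow> 0) at_top" and int: "set_integrable lborel {0..} f"
  shows "has_bochner_integral lborel (\<lambda>t. indicator {0..} t *\<^sub>R f t) (- F 0)"
proof -
  have "(LBINT t=0..\<infinity>. f t) = 0 - F 0"
  proof (rule interval_integral_FTC_integrable)
    show "set_integrable lborel (einterval 0 \<infinity>) f"
      by (rule set_integrable_subset [OF int]) (auto simp: einterval_def)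
    show "((F \<circ> real_of_ereal) \<longlongrightarrow> F 0) (at_right 0)"
      using has_vector_derivative_continuous [OF has_vector_derivative_at_within [OF deriv [of 0]], of "{0<..}"]
      by (simp add: ereal_tendsto_simps zero_ereal_def continuous_within)
    show "((F \<circ> real_of_ereal) \<longlongrightarrow> 0) (at_left \<infinity>)"
      using lim by (simp add: ereal_tendsto_simps)
    show "isCont f t" for t using cont by (simp add: continuous_on_eq_continuous_at)
  qed (use deriv in auto)
  hence "(LINT t|lborel. indicator {0<..} t *\<^sub>R f t) = - F 0"
    by (simp add: zero_ereal_def interval_integral_to_infinity_eq set_lebesgue_integral_def)
  moreover have "(LINT t|lborel. indicator {0<..} t *\<^sub>R f t) = (LINT t|lborel. indicator {0..} t *\<^sub>R f t)"
  proof (rule integral_cong_AE)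
    have [measurable]: "f \<in> borel_measurable borel" using cont by (rule borel_measurable_continuous_onI)
    show "(\<lambda>t. indicator {0<..} t *\<^sub>R f t) \<in> borel_measurable lborel" "(\<lambda>t. indicator {0..} t *\<^sub>R f t) \<in> borel_measurable lborel"
      by measurable
    show "AE t in lborel. indicator {0<..} t *\<^sub>R f t = indicator {0..} t *\<^sub>R f t"
      using AE_lborel_singleton [of "0::real"] by eventually_elim (auto split: split_indicator)
  qed
  ultimately have "(LINT t|lborel. indicator {0..} t *\<^sub>R f t) = - F 0" by simp
  thus ?thesis using int by (simp add: has_bochner_integral_iff set_integrable_def)
qed

lemma set_integrable_power_exp:
  assumes "Re w > 0"
  shows "set_integrable lborel {0..} (\<lambda>t. of_real (t ^ k) * exp (- (w * of_real t)))"
proof -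
  have "integrable lborel (\<lambda>x. x ^ k * exp (- x) * indicator {0::real..} x)"
  proof (rule integrableI_nn_integral_finite)
    show "(\<integral>\<^sup>+ x. ennreal (x ^ k * exp (- x) * indicator {0..} x) \<partial>lborel) = ennreal (real_of_nat (fact k))"
      unfolding nn_intergal_power_times_exp_Ici [symmetric]
      by (intro nn_integral_cong) (auto split: split_indicator)
  qed (auto split: split_indicator)
  hence "integrable lborel (\<lambda>x. (0 + Re w * x) ^ k * exp (- (0 + Re w * x)) * indicator {0::real..} (0 + Re w * x))"
    by (rule lborel_integrable_real_affine) (use assms in auto)
  hence "integrable lborel (\<lambda>x. inverse (Re w ^ k) * ((0 + Re w * x) ^ k * exp (- (0 + Re w * x)) * indicator {0::real..} (0 + Re w * x)))"
    by (rule integrable_mult_right)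
  thus ?thesis unfolding set_integrable_def
  proof (rule Bochner_Integration.integrable_bound)
    show "AE t in lborel. norm (indicator {0..} t *\<^sub>R (complex_of_real (t ^ k) * exp (- (w * of_real t))))
      \<le> norm (inverse (Re w ^ k) * ((0 + Re w * t) ^ k * exp (- (0 + Re w * t)) * indicator {0::real..} (0 + Re w * t)))"
      using assms by (intro AE_I2) (auto simp: norm_mult power_mult_distrib zero_le_mult_iff norm_power field_simps split: split_indicator)
  qed measurable
qed

lemma laplace_powers:
  assumes "Re w > 0"
  shows "has_bochner_integral lborel (\<lambda>t. indicator {0..} t *\<^sub>R (exp (- (w * of_real t)))) (1 / w)"
    and "has_bochner_integral lborel (\<lambda>t. indicator {0..} t *\<^sub>R (of_real t * exp (- (w * of_real t)))) (1 / w\<^sup>2)"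
    and "has_bochner_integral lborel (\<lambda>t. indicator {0..} t *\<^sub>R (of_real (t ^ 2) * exp (- (w * of_real t)))) (2 / w ^ 3)"
proof -
  have w0: "w \<noteq> 0" using assms by auto
  have lim: "((\<lambda>t. of_real (t ^ k) * exp (- (w * of_real t))) \<longlongrightarrow> 0) at_top" for k
  proof (rule tendsto_norm_zero_cancel)
    have "((\<lambda>t. t ^ k * exp (- (Re w * t))) \<longlongrightarrow> 0) at_top"
    proof -
      have "((\<lambda>t. inverse (Re w ^ k) * ((Re w * t) ^ k / exp (Re w * t))) \<longlongrightarrow> inverse (Re w ^ k) * 0) at_top"
        using assms by (intro tendsto_intros filterlim_compose [OF tendsto_power_div_exp_0] filterlim_tendsto_pos_mult_at_top [OF tendsto_const]) (auto intro: filterlim_ident)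
      thus ?thesis using assms by (simp add: power_mult_distrib exp_minus field_simps)
    qed
    moreover have "eventually (\<lambda>t. norm (complex_of_real (t ^ k) * exp (- (w * of_real t))) = t ^ k * exp (- (Re w * t))) at_top"
      using eventually_ge_at_top [of 0] by eventually_elim (simp add: norm_mult norm_power)
    ultimately show "((\<lambda>t. norm (complex_of_real (t ^ k) * exp (- (w * of_real t)))) \<longlongrightarrow> 0) at_top"
      by (subst tendsto_cong) auto
  qed
  have lim0: "((\<lambda>t. exp (- (w * of_real t))) \<longlongrightarrow> 0) at_top" using lim [of 0] by simp
  have lim1: "((\<lambda>t. of_real t * exp (- (w * of_real t))) \<longlongrightarrow> 0) at_top" using lim [of 1] by simp
  have dE: "((\<lambda>t. exp (- (w * of_real t))) has_vector_derivative (- w * exp (- (w * of_real t)))) (at t)" for t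
  proof -
    have "((\<lambda>z. exp (- (w * z))) has_field_derivative (- w * exp (- (w * of_real t)))) (at (of_real t))"
      by (auto intro!: derivative_eq_intros)
    thus ?thesis by (rule has_vector_derivative_real_field)
  qed
  have dp: "((\<lambda>t. complex_of_real t) has_vector_derivative 1) (at t)" for t
    using has_vector_derivative_of_real [OF DERIV_ident [unfolded has_real_derivative_iff_has_vector_derivative]] by simp
  have dp2: "((\<lambda>t. complex_of_real (t ^ 2)) has_vector_derivative (2 * of_real t)) (at t)" for t
  proof -
    have "((\<lambda>z::complex. z ^ 2) has_field_derivative (2 * of_real t)) (at (of_real t))"
      by (auto intro!: derivative_eq_intros)
    thus ?thesis using has_vector_derivative_real_field by fastforce
  qed
  define E where "E = (\<lambda>t. exp (- (w * complex_of_real t)))"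
  have dE': "(E has_vector_derivative (- w * E t)) (at t)" for t using dE by (simp add: E_def)
  have c: "continuous_on UNIV (\<lambda>t. of_real (t ^ k) * E t)" for k unfolding E_def by (intro continuous_intros)
  have int: "set_integrable lborel {0..} (\<lambda>t. of_real (t ^ k) * E t)" for k
    unfolding E_def by (rule set_integrable_power_exp [OF assms])
  have "has_bochner_integral lborel (\<lambda>t. indicator {0..} t *\<^sub>R E t) (- (- (1 / w) * E 0))"
  proof (rule complex_laplace_FTC)
    show "((\<lambda>t. - (1 / w) * E t) has_vector_derivative E t) (at t)" for t
      using has_vector_derivative_mult_right [OF dE' [of t], of "- (1 / w)"] w0 by simp
    show "((\<lambda>t. - (1 / w) * E t) \<longlongrightarrow> 0) at_top"
      unfolding E_def using tendsto_mult_right_zero [OF lim0] by blast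
  qed (use c [of 0] int [of 0] in auto)
  thus "has_bochner_integral lborel (\<lambda>t. indicator {0..} t *\<^sub>R (exp (- (w * of_real t)))) (1 / w)" by (simp add: E_def)
  have "has_bochner_integral lborel (\<lambda>t. indicator {0..} t *\<^sub>R (of_real t * E t)) (- ((- (1 / w)) * (of_real 0 * E 0) + (- (1 / w\<^sup>2)) * E 0))"
  proof (rule complex_laplace_FTC)
    fix t :: real
    have "((\<lambda>t. (- (1 / w)) * (of_real t * E t) + (- (1 / w\<^sup>2)) * E t) has_vector_derivative
       (- (1 / w)) * (of_real t * (- w * E t) + 1 * E t) + (- (1 / w\<^sup>2)) * (- w * E t)) (at t)"
      by (intro has_vector_derivative_add has_vector_derivative_mult_right has_vector_derivative_mult dE' dp)
    also have "(- (1 / w)) * (of_real t * (- w * E t) + 1 * E t) + (- (1 / w\<^sup>2)) * (- w * E t) = of_real t * E t"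
      using w0 by (simp add: field_simps power2_eq_square)
    finally show "((\<lambda>t. (- (1 / w)) * (of_real t * E t) + (- (1 / w\<^sup>2)) * E t) has_vector_derivative of_real t * E t) (at t)" .
  next
    have "((\<lambda>t. (- (1 / w)) * (of_real t * E t) + (- (1 / w\<^sup>2)) * E t) \<longlongrightarrow> (- (1 / w)) * 0 + (- (1 / w\<^sup>2)) * 0) at_top"
      unfolding E_def by (intro tendsto_intros lim0 lim1)
    thus "((\<lambda>t. (- (1 / w)) * (of_real t * E t) + (- (1 / w\<^sup>2)) * E t) \<longlongrightarrow> 0) at_top" by simp
  qed (use c [of 1] int [of 1] in auto)
  thus "has_bochner_integral lborel (\<lambda>t. indicator {0..} t *\<^sub>R (of_real t * exp (- (w * of_real t)))) (1 / w\<^sup>2)" by (simp add: E_def)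
  have "has_bochner_integral lborel (\<lambda>t. indicator {0..} t *\<^sub>R (of_real (t ^ 2) * E t))
      (- ((- (1 / w)) * (of_real (0 ^ 2) * E 0) + ((- (2 / w\<^sup>2)) * (of_real 0 * E 0) + (- (2 / w ^ 3)) * E 0)))"
  proof (rule complex_laplace_FTC)
    fix t :: real
    have "((\<lambda>t. (- (1 / w)) * (of_real (t ^ 2) * E t) + ((- (2 / w\<^sup>2)) * (of_real t * E t) + (- (2 / w ^ 3)) * E t)) has_vector_derivative
       (- (1 / w)) * (of_real (t ^ 2) * (- w * E t) + (2 * of_real t) * E t) + ((- (2 / w\<^sup>2)) * (of_real t * (- w * E t) + 1 * E t) + (- (2 / w ^ 3)) * (- w * E t))) (at t)"
      by (intro has_vector_derivative_add has_vector_derivative_mult_right has_vector_derivative_mult dE' dp dp2)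
    also have "(- (1 / w)) * (of_real (t ^ 2) * (- w * E t) + (2 * of_real t) * E t) + ((- (2 / w\<^sup>2)) * (of_real t * (- w * E t) + 1 * E t) + (- (2 / w ^ 3)) * (- w * E t)) = of_real (t ^ 2) * E t"
      using w0 by (simp add: field_simps power2_eq_square power3_eq_cube)
    finally show "((\<lambda>t. (- (1 / w)) * (of_real (t ^ 2) * E t) + ((- (2 / w\<^sup>2)) * (of_real t * E t) + (- (2 / w ^ 3)) * E t)) has_vector_derivative of_real (t ^ 2) * E t) (at t)" .
  next
    have "((\<lambda>t. (- (1 / w)) * (of_real (t ^ 2) * E t) + ((- (2 / w\<^sup>2)) * (of_real t * E t) + (- (2 / w ^ 3)) * E t)) \<longlongrightarrow> (- (1 / w)) * 0 + ((- (2 / w\<^sup>2)) * 0 + (- (2 / w ^ 3)) * 0)) at_top"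
      unfolding E_def by (intro tendsto_add tendsto_mult tendsto_const lim0 lim1 lim)
    thus "((\<lambda>t. (- (1 / w)) * (of_real (t ^ 2) * E t) + ((- (2 / w\<^sup>2)) * (of_real t * E t) + (- (2 / w ^ 3)) * E t)) \<longlongrightarrow> 0) at_top" by simp
  qed (use c [of 2] int [of 2] in auto)
  thus "has_bochner_integral lborel (\<lambda>t. indicator {0..} t *\<^sub>R (of_real (t ^ 2) * exp (- (w * of_real t)))) (2 / w ^ 3)" by (simp add: E_def)
qed

section \<open>The double sieve sum\<close>

definition log_sq :: "real \<Rightarrow> real" where "log_sq X = (max 0 (ln X))\<^sup>2"
text \<open>The function with Laplace transform \<open>2 / (z (1 + z)\<^sup>2)\<close>. It tends to \<open>2\<close> and matches the pole of the
transform of \<open>sieve2\<close> at \<open>z = 0\<close>; the factor \<open>(1 + z)\<^sup>2\<close> keeps the difference of the transforms integrable.\<close>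

definition model2 :: "real \<Rightarrow> real" where "model2 X = 2 * (1 - (1 + max 0 (ln X)) * exp (- max 0 (ln X)))"
definition primes_upto :: "nat \<Rightarrow> nat set" where "primes_upto N = {q. prime q \<and> q \<le> N}"
text \<open>The sum of \<open>\<mu>(m) \<mu>(m') / (m m') log\<^sub>+\<^sup>2(X/(m m'))\<close> over \<open>m, m'\<close> composed of primes up to \<open>N\<close>.\<close>

definition sieve2 :: "nat \<Rightarrow> real \<Rightarrow> real" where
  "sieve2 N = subshifts (primes_upto N) (\<lambda>q. 1 / real q) (subshifts (primes_upto N) (\<lambda>q. 1 / real q) log_sq)"
definition sieve_err :: "nat \<Rightarrow> real \<Rightarrow> real" where "sieve_err N X = sieve2 N X - model2 X"
definition sieve_LT_upto :: "nat \<Rightarrow> complex \<Rightarrow> complex" where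
  "sieve_LT_upto N z = (euler_prod N (1 + z))\<^sup>2 * (2 / z ^ 3) - 2 / (z * (1 + z)\<^sup>2)"

lemma finite_primes_upto [simp]: "finite (primes_upto N)" by (simp add: primes_upto_def)
lemma primes_upto_prime: "q \<in> primes_upto N \<Longrightarrow> prime q" by (simp add: primes_upto_def)
lemma primes_upto_pos: "q \<in> primes_upto N \<Longrightarrow> q > 0" by (simp add: primes_upto_def prime_gt_0_nat)

lemma log_sq_zero: "0 < X \<Longrightarrow> X \<le> 1 \<Longrightarrow> log_sq X = 0" by (simp add: log_sq_def)

lemma has_LT_log_sq:
  assumes "Re z > 0" shows "has_LT log_sq z (2 / z ^ 3)"
proof -
  have "(\<lambda>t. indicator {0..} t *\<^sub>R (of_real (t ^ 2) * exp (- (z * of_real t)))) = (\<lambda>t. complex_of_real (log_sq (exp t)) * exp (- (z * of_real t)))"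
    by (rule ext) (auto simp: log_sq_def max_def split: split_indicator)
  thus ?thesis using laplace_powers(3) [OF assms] by (simp only: has_LT_def)
qed

lemma has_LT_model2:
  assumes "Re z > 0" shows "has_LT model2 z (2 / (z * (1 + z)\<^sup>2))"
proof -
  have z: "z \<noteq> 0" "1 + z \<noteq> 0" using assms by (auto simp: complex_eq_iff)
  have z1: "Re (1 + z) > 0" using assms by simp
  have "has_bochner_integral lborel (\<lambda>t. 2 * (indicator {0..} t *\<^sub>R (exp (- (z * of_real t)))) -
      2 * (indicator {0..} t *\<^sub>R (exp (- ((1 + z) * of_real t)))) - 2 * (indicator {0..} t *\<^sub>R (of_real t * exp (- ((1 + z) * of_real t)))))
      (2 * (1 / z) - 2 * (1 / (1 + z)) - 2 * (1 / (1 + z)\<^sup>2))"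
    by (intro has_bochner_integral_diff has_bochner_integral_mult_right laplace_powers assms z1)
  moreover have "2 * (indicator {0..} t *\<^sub>R (exp (- (z * of_real t)))) -
      2 * (indicator {0..} t *\<^sub>R (exp (- ((1 + z) * of_real t)))) - 2 * (indicator {0..} t *\<^sub>R (of_real t * exp (- ((1 + z) * of_real t))))
      = complex_of_real (model2 (exp t)) * exp (- (z * of_real t))" for t
  proof (cases "t \<ge> 0")
    case True
    have "exp (- ((1 + z) * of_real t)) = of_real (exp (- t)) * exp (- (z * of_real t))"
      by (simp add: exp_of_real [symmetric] exp_add [symmetric] algebra_simps)
    thus ?thesis using True by (simp add: model2_def max_def algebra_simps)
  next
    case False
    thus ?thesis by (simp add: model2_def max_def)
  qed
  moreover have "2 * (1 / z) - 2 * (1 / (1 + z)) - 2 * (1 / (1 + z)\<^sup>2) = 2 / (z * (1 + z)\<^sup>2)"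
  proof -
    define w where "w = 1 + z"
    have "2 * (1 / z) - 2 * (1 / w) - 2 * (1 / w\<^sup>2) = 2 / (z * w\<^sup>2)"
      using z by (simp add: w_def [symmetric] divide_simps power2_eq_square) (simp add: w_def algebra_simps)
    thus ?thesis by (simp add: w_def)
  qed
  ultimately show ?thesis by (simp only: has_LT_def)
qed

lemma has_LT_sieve_err:
  assumes "Re z > 0" shows "has_LT (sieve_err N) z (sieve_LT_upto N z)"
proof -
  have *: "(\<Prod>q\<in>primes_upto N. 1 - of_real (1 / real q) * npow (real q) z) = euler_prod N (1 + z)"
    unfolding euler_prod_def primes_upto_def [symmetric]
  proof (rule prod.cong [OF refl])
    fix q assume "q \<in> primes_upto N"
    hence "real q > 0" using primes_upto_pos by simp
    thus "1 - of_real (1 / real q) * npow (real q) z = 1 - npow (real q) (1 + z)"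
      using npow_minus_1 [of "real q" "1 + z"] by (simp add: field_simps)
  qed
  have "has_LT (subshifts (primes_upto N) (\<lambda>q. 1 / real q) log_sq) z ((\<Prod>q\<in>primes_upto N. 1 - of_real (1 / real q) * npow (real q) z) * (2 / z ^ 3))"
    by (rule has_LT_subshifts [OF finite_primes_upto _ has_LT_log_sq [OF assms]]) (rule primes_upto_pos)
  hence "has_LT (subshifts (primes_upto N) (\<lambda>q. 1 / real q) log_sq) z (euler_prod N (1 + z) * (2 / z ^ 3))" using * by simp
  hence "has_LT (sieve2 N) z ((\<Prod>q\<in>primes_upto N. 1 - of_real (1 / real q) * npow (real q) z) * (euler_prod N (1 + z) * (2 / z ^ 3)))"
    unfolding sieve2_def by (rule has_LT_subshifts [OF finite_primes_upto, rotated]) (rule primes_upto_pos)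
  hence "has_LT (sieve2 N) z (euler_prod N (1 + z) * (euler_prod N (1 + z) * (2 / z ^ 3)))" using * by simp
  hence "has_bochner_integral lborel (\<lambda>t. of_real (sieve2 N (exp t)) * exp (- (z * of_real t)) - of_real (model2 (exp t)) * exp (- (z * of_real t))) (sieve_LT_upto N z)"
    using has_LT_model2 [OF assms] unfolding has_LT_def sieve_LT_upto_def power2_eq_square [of "euler_prod N (1 + z)"] mult.assoc
    by (intro has_bochner_integral_diff)
  thus ?thesis by (simp add: has_LT_def sieve_err_def left_diff_distrib)
qed

text \<open>A continuous function of \<open>t = log X\<close> that grows more slowly than every exponential, as required for
the Fourier argument on each line \<open>Re z = d > 0\<close>.\<close>

definition subexp :: "(real \<Rightarrow> real) \<Rightarrow> bool" where
  "subexp u \<longleftrightarrow> continuous_on UNIV (\<lambda>t. u (exp t)) \<and> (\<forall>d>0. \<exists>M. \<forall>t. \<bar>u (exp t)\<bar> * exp (- (d * t)) \<le> M)"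

lemma subexp_subshift:
  assumes "subexp u" "q > 0"
  shows "subexp (subshift a q u)"
proof -
  have exq: "exp t / real q = exp (t - ln (real q))" for t using assms(2) by (simp add: exp_diff)
  show ?thesis unfolding subexp_def
  proof (intro conjI allI impI)
    have "continuous_on UNIV (\<lambda>t. u (exp t))" using assms(1) by (simp add: subexp_def)
    hence "continuous_on UNIV (\<lambda>t. u (exp (t - ln (real q))))"
      by (rule continuous_on_compose2 [where t = UNIV]) (auto intro!: continuous_intros)
    thus "continuous_on UNIV (\<lambda>t. subshift a q u (exp t))"
      unfolding subshift_def exq using assms(1) by (intro continuous_intros) (auto simp: subexp_def)
    fix d :: real assume "d > 0"
    then obtain M where M: "\<bar>u (exp t)\<bar> * exp (- (d * t)) \<le> M" for t using assms(1) by (auto simp: subexp_def)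
    have "\<bar>subshift a q u (exp t)\<bar> * exp (- (d * t)) \<le> M + \<bar>a\<bar> * (M * exp (- (d * ln (real q))))" for t
    proof -
      have "\<bar>subshift a q u (exp t)\<bar> * exp (- (d * t)) \<le> (\<bar>u (exp t)\<bar> + \<bar>a\<bar> * \<bar>u (exp (t - ln (real q)))\<bar>) * exp (- (d * t))"
        unfolding subshift_def exq abs_mult [symmetric] by (intro mult_right_mono abs_triangle_ineq4) auto
      also have "\<dots> = \<bar>u (exp t)\<bar> * exp (- (d * t)) + \<bar>a\<bar> * ((\<bar>u (exp (t - ln (real q)))\<bar> * exp (- (d * (t - ln (real q))))) * exp (- (d * ln (real q))))"
        by (simp add: algebra_simps exp_add [symmetric])
      also have "\<dots> \<le> M + \<bar>a\<bar> * (M * exp (- (d * ln (real q))))"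
        by (intro add_mono mult_left_mono mult_right_mono M) auto
      finally show ?thesis .
    qed
    thus "\<exists>M. \<forall>t. \<bar>subshift a q u (exp t)\<bar> * exp (- (d * t)) \<le> M" by blast
  qed
qed

lemma subexp_subshifts:
  assumes "finite A" "\<And>q. q \<in> A \<Longrightarrow> q > 0" "subexp u"
  shows "subexp (subshifts A \<alpha> u)"
  using assms(1,2)
proof (induction A rule: finite_induct)
  case (insert q A)
  thus ?case unfolding subshifts_insert [OF insert(1,2)] by (intro subexp_subshift) auto
qed (use assms in auto)

lemma subexp_log_sq: "subexp log_sq"
  unfolding subexp_def
proof (intro conjI allI impI)
  show "continuous_on UNIV (\<lambda>t. log_sq (exp t))" unfolding log_sq_def by (simp, intro continuous_intros)
  fix d :: real assume d: "d > 0"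
  have "\<bar>log_sq (exp t)\<bar> * exp (- (d * t)) \<le> 2 / d\<^sup>2" for t
  proof (cases "t \<ge> 0")
    case True
    have "(d * t)\<^sup>2 / 2 \<le> exp (d * t)" using exp_lower_Taylor_quadratic [of "d * t"] True d mult_nonneg_nonneg [of d t] by linarith
    hence "t\<^sup>2 \<le> 2 / d\<^sup>2 * exp (d * t)" using d by (simp add: field_simps power_mult_distrib)
    thus ?thesis using True d by (simp add: log_sq_def max_def exp_minus field_simps)
  qed (simp add: log_sq_def max_def)
  thus "\<exists>M. \<forall>t. \<bar>log_sq (exp t)\<bar> * exp (- (d * t)) \<le> M" by blast
qed

lemma model2_range: "0 \<le> model2 X" "model2 X \<le> 2"
proof -
  define s where "s = max 0 (ln X)"
  have s: "s \<ge> 0" by (simp add: s_def)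
  have "1 + s \<le> exp s" by (rule exp_ge_add_one_self)
  hence "(1 + s) * exp (- s) \<le> exp s * exp (- s)" by (intro mult_right_mono) auto
  thus "0 \<le> model2 X" by (simp add: model2_def s_def [symmetric] exp_add [symmetric] flip: exp_minus)
  show "model2 X \<le> 2" using s by (simp add: model2_def s_def [symmetric])
qed

lemma subexp_model2: "subexp model2"
  unfolding subexp_def
proof (intro conjI allI impI)
  show "continuous_on UNIV (\<lambda>t. model2 (exp t))" unfolding model2_def by (simp, intro continuous_intros)
  fix d :: real assume d: "d > 0"
  have "\<bar>model2 (exp t)\<bar> * exp (- (d * t)) \<le> 2" for t
  proof (cases "t \<ge> 0")
    case True
    have "\<bar>model2 (exp t)\<bar> * exp (- (d * t)) \<le> 2 * 1"
      using model2_range [of "exp t"] d True by (intro mult_mono) auto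
    thus ?thesis by simp
  qed (simp add: model2_def max_def)
  thus "\<exists>M. \<forall>t. \<bar>model2 (exp t)\<bar> * exp (- (d * t)) \<le> M" by blast
qed

lemma subexp_sieve_err: "subexp (sieve_err N)"
proof -
  have y: "subexp (sieve2 N)" unfolding sieve2_def by (intro subexp_subshifts subexp_log_sq finite_primes_upto primes_upto_pos)
  show ?thesis unfolding subexp_def
  proof (intro conjI allI impI)
    show "continuous_on UNIV (\<lambda>t. sieve_err N (exp t))"
      unfolding sieve_err_def using y subexp_model2 by (intro continuous_intros) (auto simp: subexp_def)
    fix d :: real assume d: "d > 0"
    obtain M1 where M1: "\<bar>sieve2 N (exp t)\<bar> * exp (- (d * t)) \<le> M1" for t using y d by (auto simp: subexp_def)
    obtain M2 where M2: "\<bar>model2 (exp t)\<bar> * exp (- (d * t)) \<le> M2" for t using subexp_model2 d by (auto simp: subexp_def)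
    have "\<bar>sieve_err N (exp t)\<bar> * exp (- (d * t)) \<le> M1 + M2" for t
    proof -
      have "\<bar>sieve_err N (exp t)\<bar> * exp (- (d * t)) \<le> (\<bar>sieve2 N (exp t)\<bar> + \<bar>model2 (exp t)\<bar>) * exp (- (d * t))"
        unfolding sieve_err_def by (intro mult_right_mono abs_triangle_ineq4) auto
      thus ?thesis using M1 [of t] M2 [of t] by (simp add: distrib_right)
    qed
    thus "\<exists>M. \<forall>t. \<bar>sieve_err N (exp t)\<bar> * exp (- (d * t)) \<le> M" by blast
  qed
qed

text \<open>Each factor is at most \<open>1 + q\<^sup>-\<^sup>1\<^sup>-\<^sup>d\<close> in absolute value.\<close>

lemma euler_prod_bounded:
  assumes "d > 0"
  shows "\<exists>B. \<forall>N z. Re z = d \<longrightarrow> norm (euler_prod N (1 + z)) \<le> B"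
proof (intro exI allI impI)
  fix N z assume z: "Re z = d"
  have "norm (euler_prod N (1 + z)) \<le> (\<Prod>q\<in>primes_upto N. exp (real q powr (- (1 + d))))"
    unfolding euler_prod_def primes_upto_def [symmetric] prod_norm [symmetric]
  proof (rule prod_mono, safe)
    fix q assume "q \<in> primes_upto N"
    hence "real q > 0" using primes_upto_pos by simp
    hence "norm (1 - npow (real q) (1 + z)) \<le> 1 + real q powr (- (1 + d))"
      using norm_triangle_ineq4 [of 1 "npow (real q) (1 + z)"] z by (simp add: norm_npow)
    also have "\<dots> \<le> exp (real q powr (- (1 + d)))" by (rule exp_ge_add_one_self)
    finally show "norm (1 - npow (real q) (1 + z)) \<le> exp (real q powr (- (1 + d)))" .
  qed auto
  also have "\<dots> = exp (\<Sum>q\<in>primes_upto N. real q powr (- (1 + d)))" by (simp add: exp_sum)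
  also have "(\<Sum>q\<in>primes_upto N. real q powr (- (1 + d))) \<le> (\<Sum>n\<in>Suc ` {..N}. real n powr (- (1 + d)))"
  proof (rule sum_mono2)
    show "primes_upto N \<subseteq> Suc ` {..N}"
    proof
      fix q assume q: "q \<in> primes_upto N"
      hence "q = Suc (q - 1)" "q - 1 \<le> N" using primes_upto_pos [OF q] by (auto simp: primes_upto_def)
      thus "q \<in> Suc ` {..N}" by blast
    qed
  qed auto
  also have "\<dots> = (\<Sum>n\<le>N. real (Suc n) powr (- (1 + d)))" by (simp add: sum.reindex)
  also have "\<dots> \<le> (\<Sum>n. real (Suc n) powr (- (1 + d)))"
    by (rule sum_le_suminf [OF summable_zeta_powr]) (use assms in auto)
  finally show "norm (euler_prod N (1 + z)) \<le> exp (\<Sum>n. real (Suc n) powr (- (1 + d)))" by simp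
qed

text \<open>A dominating function for the limit \<open>N \<rightarrow> \<infinity>\<close> on a fixed vertical line; the constant may depend on \<open>d\<close>.\<close>

lemma sieve_LT_upto_bounded:
  assumes "0 < d" "d \<le> 1"
  shows "\<exists>K. \<forall>N u. norm (sieve_LT_upto N (Complex d u)) \<le> K * inverse (1 + u\<^sup>2)"
proof -
  obtain B where B: "norm (euler_prod N (1 + z)) \<le> B" if "Re z = d" for N z using euler_prod_bounded [OF assms(1)] by blast
  show ?thesis
  proof (intro exI allI)
    fix N u
    define z where "z = Complex d u"
    have zd: "Re z = d" by (simp add: z_def)
    have nz: "norm z \<ge> d" using abs_Re_le_cmod [of z] zd by simp
    have z0: "norm z > 0" using nz assms by linarith
    have nz2: "norm z ^ 2 \<ge> d\<^sup>2 * (1 + u\<^sup>2)"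
    proof -
      have "d\<^sup>2 * (1 + u\<^sup>2) = d\<^sup>2 + d\<^sup>2 * u\<^sup>2" by (simp add: algebra_simps)
      also have "d\<^sup>2 * u\<^sup>2 \<le> 1 * u\<^sup>2" using assms by (intro mult_right_mono) (auto simp: power_le_one)
      finally show ?thesis by (simp add: cmod_power2 z_def)
    qed
    have nz3: "norm z ^ 3 \<ge> d ^ 3 * (1 + u\<^sup>2)"
    proof -
      have "d * (d\<^sup>2 * (1 + u\<^sup>2)) \<le> norm z * norm z ^ 2" using nz nz2 assms by (intro mult_mono) auto
      thus ?thesis by (simp add: power2_eq_square power3_eq_cube mult_ac)
    qed
    have n1z: "norm (1 + z) ^ 2 \<ge> 1 + u\<^sup>2" using assms one_le_power [of "1 + d" 2] by (simp add: cmod_power2 z_def)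
    have u1: "1 + u\<^sup>2 > 0" by (simp add: add_pos_nonneg)
    have "norm (sieve_LT_upto N z) \<le> norm ((euler_prod N (1 + z))\<^sup>2 * (2 / z ^ 3)) + norm (2 / (z * (1 + z)\<^sup>2))"
      unfolding sieve_LT_upto_def by (rule norm_triangle_ineq4)
    also have "norm ((euler_prod N (1 + z))\<^sup>2 * (2 / z ^ 3)) \<le> B\<^sup>2 * (2 / (d ^ 3 * (1 + u\<^sup>2)))"
      unfolding norm_mult norm_divide norm_power norm_numeral
      using B [OF zd, of N] nz3 assms u1 by (intro mult_mono power_mono frac_le) auto
    also have "norm (2 / (z * (1 + z)\<^sup>2)) \<le> 2 / (d * (1 + u\<^sup>2))"
      unfolding norm_mult norm_divide norm_power norm_numeral
      using nz n1z assms u1 by (intro frac_le mult_mono) auto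
    finally have "norm (sieve_LT_upto N z) \<le> B\<^sup>2 * (2 / (d ^ 3 * (1 + u\<^sup>2))) + 2 / (d * (1 + u\<^sup>2))" by simp
    also have "\<dots> = (2 * B\<^sup>2 / d ^ 3 + 2 / d) * inverse (1 + u\<^sup>2)"
    proof -
      have "B\<^sup>2 * (2 / (d ^ 3 * v)) + 2 / (d * v) = (2 * B\<^sup>2 / d ^ 3 + 2 / d) * inverse v" if "v > 0" for v
        using assms that by (simp add: divide_simps)
      thus ?thesis using u1 by blast
    qed
    finally show "norm (sieve_LT_upto N (Complex d u)) \<le> (2 * B\<^sup>2 / d ^ 3 + 2 / d) * inverse (1 + u\<^sup>2)" by (simp add: z_def)
  qed
qed

lemma inverse_1_plus_square:
  "integrable lborel (\<lambda>x::real. inverse (1 + x\<^sup>2))" "(LINT x|lborel. inverse (1 + x\<^sup>2)) = pi"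
  using integrable_inverse_1_plus_square LBINT_inverse_1_plus_square
  by (simp_all add: set_integrable_def interval_lebesgue_integral_def set_lebesgue_integral_def einterval_def)

lemma sieve_LT_upto_tendsto:
  assumes "Re z > 0"
  shows "(\<lambda>N. sieve_LT_upto N z) \<longlonglongrightarrow> sieve_LT z"
proof -
  have "(\<lambda>N. sieve_LT_upto N z) \<longlonglongrightarrow> (1 / zeta (1 + z))\<^sup>2 * (2 / z ^ 3) - 2 / (z * (1 + z)\<^sup>2)"
    unfolding sieve_LT_upto_def by (intro tendsto_intros euler_prod_tendsto) (use assms in auto)
  thus ?thesis using sieve_LT_eq [OF assms] by (simp add: power_divide mult.commute)
qed

lemma primes_upto_split: "N \<le> N' \<Longrightarrow> primes_upto N' = primes_upto N \<union> (primes_upto N' - primes_upto N)" by (auto simp: primes_upto_def)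

lemma sieve2_stable:
  assumes "N \<le> N'" "0 < X" "X \<le> real (Suc N)"
  shows "sieve2 N' X = sieve2 N X"
proof -
  define B where "B = primes_upto N' - primes_upto N"
  have B: "finite B" "\<And>q. q \<in> primes_upto N \<union> B \<Longrightarrow> prime q" "\<And>q. q \<in> B \<Longrightarrow> real (Suc N) \<le> real q"
    using assms by (auto simp: B_def primes_upto_def)
  have P: "primes_upto N' = primes_upto N \<union> B" using primes_upto_split [OF assms(1)] by (simp add: B_def)
  have B': "X \<le> real q" if "q \<in> B" for q using B(3) [OF that] assms(3) by linarith
  have inner: "subshifts (primes_upto N') \<alpha> log_sq Y = subshifts (primes_upto N) \<alpha> log_sq Y" if "0 < Y" "Y \<le> X" for Y \<alpha>
    unfolding P
  proof (rule subshifts_stable [OF B(1) finite_primes_upto B(2)])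
    fix q assume "q \<in> B" thus "Y \<le> real q" using B'[of q] that by linarith
  qed (use that log_sq_zero in auto)
  have "sieve2 N' X = subshifts (primes_upto N') (\<lambda>q. 1 / real q) (subshifts (primes_upto N) (\<lambda>q. 1 / real q) log_sq) X"
    unfolding sieve2_def by (rule subshifts_cong) (use inner primes_upto_prime assms in auto)
  also have "\<dots> = sieve2 N X" unfolding P sieve2_def
  proof (rule subshifts_stable [OF B(1) finite_primes_upto B(2) B'])
    show "subshifts (primes_upto N) (\<lambda>q. 1 / real q) log_sq Y = 0" if "0 < Y" "Y \<le> 1" for Y
      by (rule subshifts_zero) (use that primes_upto_prime log_sq_zero in auto)
  qed (use assms in auto)
  finally show ?thesis .
qed

definition inv_log :: "real \<Rightarrow> real" where "inv_log X = 1 / (1 + max 0 (ln X))"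

text \<open>Multiplying \<open>v(e\<^sup>s) e\<^sup>-\<^sup>d\<^sup>s\<close> by \<open>e\<^sup>-\<^sup>i\<^sup>h\<^sup>s - 1\<close> replaces its Fourier transform by a difference of two values at
distance \<open>h\<close>, which the Lipschitz bound controls by \<open>C h\<close>. With \<open>h = \<pi>/t\<close> the multiplier has modulus \<open>2\<close> at
\<open>s = t\<close>, and with \<open>d = 1/(8t)\<close> the exponential is harmless there. The Lipschitz bound is for the
limiting transform; it may be used because \<open>sieve2 N\<close> at \<open>e\<^sup>t\<close> does not change when \<open>N\<close> grows.\<close>

lemma sieve_err_fourier:
  assumes C: "\<And>d t e. 0 < d \<Longrightarrow> d \<le> 1/8 \<Longrightarrow> \<bar>e\<bar> \<le> 4 \<Longrightarrow>
     norm (sieve_LT (Complex d (t + e)) - sieve_LT (Complex d t)) \<le> C * \<bar>e\<bar> * inverse (1 + t\<^sup>2)"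
    and t: "t \<ge> 1" and N: "exp t \<le> real (Suc N)"
  shows "\<bar>sieve_err N (exp t)\<bar> \<le> 4 * C / t"
proof -
  define d where "d = 1 / (8 * t)"
  define h where "h = pi / t"
  have d: "0 < d" "d \<le> 1/8" "d * t = 1/8" using t by (auto simp: d_def field_simps)
  have h: "0 < h" "h \<le> 4" "h * t = pi" using t pi_less_4 pi_gt_zero
    by (auto simp: h_def field_simps intro: order_trans [of pi 4])
  define \<phi> where "\<phi> = (\<lambda>N s. complex_of_real (sieve_err N (exp s)) * exp (- of_real (d * s)) * (iexp (- (h * s)) - 1))"
  define F where "F = (\<lambda>N u. LINT s|lborel. iexp (- (u * s)) * \<phi> N s)"
  have hb: "has_bochner_integral lborel (\<lambda>s. iexp (- (u * s)) * \<phi> N s) (sieve_LT_upto N (Complex d (u + h)) - sieve_LT_upto N (Complex d u))" for N u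
  proof -
    have "has_bochner_integral lborel (\<lambda>s. of_real (sieve_err N (exp s)) * exp (- (Complex d (u + h) * of_real s)) - of_real (sieve_err N (exp s)) * exp (- (Complex d u * of_real s)))
      (sieve_LT_upto N (Complex d (u + h)) - sieve_LT_upto N (Complex d u))"
      using has_LT_sieve_err [of "Complex d (u + h)" N] has_LT_sieve_err [of "Complex d u" N] d
      by (intro has_bochner_integral_diff) (simp_all add: has_LT_def)
    moreover have "of_real (sieve_err N (exp s)) * exp (- (Complex d (u + h) * of_real s)) - of_real (sieve_err N (exp s)) * exp (- (Complex d u * of_real s))
       = iexp (- (u * s)) * \<phi> N s" for s
    proof -
      have 1: "exp (- (Complex d (u + h) * of_real s)) = iexp (- (u * s)) * (exp (- of_real (d * s)) * iexp (- (h * s)))"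
        unfolding exp_add [symmetric] by (rule arg_cong [of _ _ exp]) (simp add: complex_eq_iff algebra_simps)
      have 2: "exp (- (Complex d u * of_real s)) = iexp (- (u * s)) * exp (- of_real (d * s))"
        unfolding exp_add [symmetric] by (rule arg_cong [of _ _ exp]) (simp add: complex_eq_iff algebra_simps)
      show ?thesis unfolding 1 2 \<phi>_def by (simp only: right_diff_distrib mult_1_right mult_1_left mult_ac)
    qed
    ultimately show ?thesis by (simp only:)
  qed
  have F: "F N u = sieve_LT_upto N (Complex d (u + h)) - sieve_LT_upto N (Complex d u)" for N u
    using hb [of u N] by (simp add: F_def has_bochner_integral_iff)
  have intphi: "integrable lborel (\<phi> N)" for N
    using hb [of 0 N] by (simp add: has_bochner_integral_iff)
  have contphi: "isCont (\<phi> N) s" for N s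
  proof -
    have "continuous_on UNIV (\<lambda>s. sieve_err N (exp s))" using subexp_sieve_err by (simp add: subexp_def)
    hence "continuous_on UNIV (\<phi> N)" unfolding \<phi>_def by (intro continuous_intros)
    thus ?thesis by (simp add: continuous_on_eq_continuous_at)
  qed
  have bdphi: "\<exists>M. \<forall>s. norm (\<phi> N s) \<le> M" for N
  proof -
    obtain M where M: "\<bar>sieve_err N (exp s)\<bar> * exp (- (d * s)) \<le> M" for s using subexp_sieve_err [of N] d(1) unfolding subexp_def by blast
    have "norm (\<phi> N s) \<le> M * 2" for s
    proof -
      have n1: "norm (exp (- complex_of_real (d * s))) = exp (- (d * s))" by simp
      have "norm (iexp (- (h * s)) - 1) \<le> 2" using norm_triangle_ineq4 [of "iexp (- (h * s))" 1] by simp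
      moreover have "M \<ge> 0" using M [of 0] by (meson abs_ge_zero exp_ge_zero mult_nonneg_nonneg order_trans)
      ultimately have "(\<bar>sieve_err N (exp s)\<bar> * exp (- (d * s))) * norm (iexp (- (h * s)) - 1) \<le> M * 2"
        by (intro mult_mono M) auto
      thus ?thesis by (simp only: \<phi>_def norm_mult norm_of_real n1)
    qed
    thus ?thesis by blast
  qed
  obtain K where K: "norm (sieve_LT_upto N (Complex d u)) \<le> K * inverse (1 + u\<^sup>2)" for N u using sieve_LT_upto_bounded [of d] d by auto
  have int1: "integrable lborel (\<lambda>u. K * inverse (1 + u\<^sup>2))" by (intro integrable_mult_right inverse_1_plus_square)
  have "integrable lborel (\<lambda>u. K * inverse (1 + (h + 1 * u)\<^sup>2))"
    by (intro integrable_mult_right lborel_integrable_real_affine [OF inverse_1_plus_square(1)]) auto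
  hence int2: "integrable lborel (\<lambda>u. K * inverse (1 + (u + h)\<^sup>2) + K * inverse (1 + u\<^sup>2))"
    using int1 by (simp add: add.commute [of h])
  have Fbound: "norm (F N u) \<le> K * inverse (1 + (u + h)\<^sup>2) + K * inverse (1 + u\<^sup>2)" for N u
    unfolding F by (rule order_trans [OF norm_triangle_ineq4 add_mono [OF K K]])
  have Fmeas [measurable]: "F N \<in> borel_measurable lborel" for N
  proof -
    have [measurable]: "\<phi> N \<in> borel_measurable borel" using intphi by auto
    show ?thesis unfolding F_def by measurable
  qed
  have Fint: "integrable lborel (F N)" for N
    by (rule Bochner_Integration.integrable_bound [OF int2 Fmeas], rule AE_I2, rule order_trans [OF Fbound]) simp
  define G where "G = (\<lambda>u. norm (sieve_LT (Complex d (u + h)) - sieve_LT (Complex d u)))"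
  have Flim: "(\<lambda>N. norm (F N u)) \<longlonglongrightarrow> G u" for u
    unfolding F G_def by (intro tendsto_intros sieve_LT_upto_tendsto) (use d in auto)
  have Gmeas [measurable]: "G \<in> borel_measurable lborel"
    by (rule borel_measurable_LIMSEQ_real [where u = "\<lambda>N u. norm (F N u)"]) (use Flim in auto)
  have lim: "(\<lambda>N. LINT u|lborel. norm (F N u)) \<longlonglongrightarrow> (LINT u|lborel. G u)"
    by (rule integral_dominated_convergence [OF Gmeas _ int2]) (use Flim Fbound in auto)
  (* The left side is constant in N' from N on, so the bound survives the limit by dominated convergence. *)
  have main: "norm (\<phi> N t) \<le> (LINT u|lborel. G u) / (2 * pi)"
  proof (rule LIMSEQ_le_const [OF tendsto_divide [OF lim tendsto_const]])
    show "\<exists>M. \<forall>N'\<ge>M. norm (\<phi> N t) \<le> (LINT u|lborel. norm (F N' u)) / (2 * pi)"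
    proof (intro exI allI impI)
      fix N' assume N': "N' \<ge> N"
      have "sieve_err N' (exp t) = sieve_err N (exp t)" using sieve2_stable [OF N' _ N] by (simp add: sieve_err_def)
      hence "\<phi> N t = \<phi> N' t" by (simp add: \<phi>_def)
      also obtain M where "\<forall>s. norm (\<phi> N' s) \<le> M" using bdphi by blast
      hence "norm (\<phi> N' t) \<le> (LINT u|lborel. norm (F N' u)) / (2 * pi)"
        unfolding F_def by (intro fourier_sup_bound intphi contphi) (use Fint in \<open>auto simp: F_def\<close>)
      finally show "norm (\<phi> N t) \<le> (LINT u|lborel. norm (F N' u)) / (2 * pi)" .
    qed
  qed simp
  have Gb: "G u \<le> C * h * inverse (1 + u\<^sup>2)" for u
    unfolding G_def using C [of d h u] d h by simp
  have "(LINT u|lborel. G u) \<le> (LINT u|lborel. C * h * inverse (1 + u\<^sup>2))"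
  proof (rule integral_mono)
    show "integrable lborel (\<lambda>u. C * h * inverse (1 + u\<^sup>2))" by (intro integrable_mult_right inverse_1_plus_square)
    thus "integrable lborel G"
    proof (rule Bochner_Integration.integrable_bound [OF _ Gmeas])
      have "norm (G u) \<le> norm (C * h * inverse (1 + u\<^sup>2))" for u
      proof -
        have "0 \<le> G u" by (simp add: G_def)
        thus ?thesis using Gb [of u] unfolding real_norm_def by linarith
      qed
      thus "AE u in lborel. norm (G u) \<le> norm (C * h * inverse (1 + u\<^sup>2))" by (rule AE_I2)
    qed
  qed (use Gb in auto)
  also have "\<dots> = C * h * pi" by (simp add: inverse_1_plus_square)
  finally have "norm (\<phi> N t) \<le> C * h * pi / (2 * pi)" using main by (meson divide_right_mono order_trans pi_ge_zero zero_le_mult_iff zero_le_numeral)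
  also have "\<dots> = C * h / 2" by simp
  finally have 1: "norm (\<phi> N t) \<le> C * h / 2" .
  have "norm (\<phi> N t) = \<bar>sieve_err N (exp t)\<bar> * exp (- (1/8)) * 2"
  proof -
    have e1: "iexp (- (h * t)) = -1" by (simp add: h exp_minus)
    show ?thesis unfolding \<phi>_def e1 d norm_mult by (simp add: exp_of_real [symmetric] flip: of_real_minus)
  qed
  moreover have "exp (- (1/8)) \<ge> (7/8::real)" using exp_ge_add_one_self [of "- (1/8)"] by simp
  ultimately have 2: "\<bar>sieve_err N (exp t)\<bar> * (7/8 * 2) \<le> C * h / 2"
    using 1 mult_left_mono [of "7/8" "exp (- (1/8))" "\<bar>sieve_err N (exp t)\<bar>"] by simp
  have "norm (sieve_LT (Complex (1/8) (0 + 1)) - sieve_LT (Complex (1/8) 0)) \<le> C" using C [of "1/8" 1 0] by simp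
  hence "C \<ge> 0" by (rule order_trans [OF norm_ge_zero])
  hence "C * h \<le> C * (4 / t)" using pi_less_4 t by (intro mult_left_mono) (auto simp: h_def divide_right_mono)
  hence "C * h / 2 \<le> (4 * C / t) * (7/8 * 2)" using \<open>C \<ge> 0\<close> t by (simp add: field_simps)
  with 2 show ?thesis by simp
qed

text \<open>Of the same depth as the prime number theorem. For \<open>X \<ge> e\<close> it is \<open>sieve_err_fourier\<close>; below \<open>e\<close> only the
prime \<open>2\<close> contributes.\<close>

lemma sieve2_asymptotic:
  "\<exists>C\<ge>2. \<forall>N X. 0 < X \<and> X \<le> real (Suc N) \<longrightarrow> \<bar>sieve2 N X - 2\<bar> \<le> C * inv_log X"
proof -
  obtain C where C0: "C \<ge> 0" and C: "\<And>d t e. 0 < d \<Longrightarrow> d \<le> 1/8 \<Longrightarrow> \<bar>e\<bar> \<le> 4 \<Longrightarrow>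
     norm (sieve_LT (Complex d (t + e)) - sieve_LT (Complex d t)) \<le> C * \<bar>e\<bar> * inverse (1 + t\<^sup>2)"
    using sieve_LT_lipschitz by blast
  show ?thesis
  proof (intro exI [of _ "8 * C + 100"] conjI allI impI)
    fix N :: nat and X :: real assume X: "0 < X \<and> X \<le> real (Suc N)"
    show "\<bar>sieve2 N X - 2\<bar> \<le> (8 * C + 100) * inv_log X"
    proof (cases "X < exp 1")
      case True
      have lX: "ln X \<le> 1" using True X by (metis less_imp_le ln_exp ln_le_cancel_iff exp_gt_zero)
      have l0: "log_sq Y \<le> 1" "log_sq Y \<ge> 0" if "0 < Y" "Y \<le> X" for Y
      proof -
        have "ln Y \<le> 1" using that X lX by (meson ln_le_cancel_iff order_trans)
        thus "log_sq Y \<le> 1" by (simp add: log_sq_def power_le_one)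
      qed (simp add: log_sq_def)
      have exp1: "exp (1::real) \<le> 3" by (rule exp_le)
      have "sieve2 N X = sieve2 (max N 2) X" using sieve2_stable [of N "max N 2" X] X by simp
      also have "\<dots> = sieve2 2 X" using True exp1 X by (intro sieve2_stable) auto
      also have "sieve2 2 X = log_sq X - log_sq (X / 2) + log_sq (X / 2 / 2) / 4"
      proof -
        have P2: "primes_upto 2 = insert 2 {}"
        proof -
          have "q = 2" if "prime q" "q \<le> 2" for q :: nat using prime_ge_2_nat [OF that(1)] that by simp
          thus ?thesis by (auto simp: primes_upto_def)
        qed
        show ?thesis unfolding sieve2_def P2 by (simp add: subshifts_insert subshift_def diff_divide_distrib)
      qed
      also have "\<bar>\<dots> - 2\<bar> \<le> 10"
      proof -
        have "0 \<le> log_sq X" "log_sq X \<le> 1" "0 \<le> log_sq (X/2)" "log_sq (X/2) \<le> 1" "0 \<le> log_sq (X/2/2)" "log_sq (X/2/2) \<le> 1"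
          using X by (auto intro!: l0)
        thus ?thesis by linarith
      qed
      also have "10 \<le> (8 * C + 100) * (1 / 2)" using C0 by simp
      also have "\<dots> \<le> (8 * C + 100) * inv_log X"
        using C0 lX unfolding inv_log_def by (intro mult_left_mono frac_le) auto
      finally show ?thesis .
    next
      case False
      define t where "t = ln X"
      have t: "t \<ge> 1" "exp t = X" using False X by (auto simp: t_def ln_ge_iff)
      have v: "\<bar>sieve_err N X\<bar> \<le> 4 * C / t" using sieve_err_fourier [of C t N] C t X by auto
      have "\<bar>model2 X - 2\<bar> = 2 * ((1 + t) * exp (- t))" using t by (simp add: model2_def t_def [symmetric] max_absorb2)
      also have "\<dots> \<le> 2 * (2 / t)"
      proof -
        have "t * (1 + t) \<le> 2 * exp t" using exp_lower_Taylor_quadratic [of t] t by (simp add: power2_eq_square algebra_simps)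
        thus ?thesis using t X by (simp add: exp_minus field_simps)
      qed
      finally have c: "\<bar>model2 X - 2\<bar> \<le> 4 / t" by simp
      have "\<bar>sieve2 N X - 2\<bar> \<le> \<bar>sieve_err N X\<bar> + \<bar>model2 X - 2\<bar>" unfolding sieve_err_def by linarith
      also have "\<dots> \<le> (4 * C + 4) / t" using v c by (simp add: add_divide_distrib)
      also have "\<dots> \<le> (8 * C + 100) / (1 + t)"
      proof -
        have "(4 * C + 4) * (1 + t) \<le> (4 * C + 4) * (2 * t)" using t C0 by (intro mult_left_mono) auto
        also have "\<dots> \<le> (8 * C + 100) * t" using t C0 by (simp add: algebra_simps)
        finally show ?thesis using t by (simp add: field_simps)
      qed
      finally show ?thesis using t by (simp add: inv_log_def t_def [symmetric] max_absorb2)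
    qed
  qed (use C0 in auto)
qed

section \<open>Exchanging primes one at a time\<close>

text \<open>The factor by which the error constant grows when \<open>1 - T\<^sub>q/q\<close> is inverted: the geometric series with
ratio \<open>(1 + log q)/q\<close>, where \<open>1 + log q\<close> bounds the growth of \<open>inv_log\<close> under \<open>T\<^sub>q\<close>.\<close>

definition inv_loss :: "nat \<Rightarrow> real" where "inv_loss q = 1 / (1 - (1 + ln (real q)) / real q)"
text \<open>The density of integers divisible by \<open>q\<close> when integers are weighted by the divisor function.\<close>

definition rho :: "nat \<Rightarrow> real" where "rho q = 2 / real q - 1 / (real q)\<^sup>2"
text \<open>The relative loss in replacing \<open>(1 - T\<^sub>q/q)\<^sup>2\<close> by \<open>1 - \<rho>(q) T\<^sub>q\<close>; it is summable over primes.\<close>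

definition swap_loss :: "nat \<Rightarrow> real" where "swap_loss q = (inv_loss q)\<^sup>2 * (2 + 3 * ln (real q)) / (real q)\<^sup>2"

lemma inv_log_pos: "inv_log X > 0" by (simp add: inv_log_def)
lemma inv_log_le_1: "inv_log X \<le> 1" by (simp add: inv_log_def)
lemma inv_log_1: "0 < X \<Longrightarrow> X \<le> 1 \<Longrightarrow> inv_log X = 1" by (simp add: inv_log_def)

lemma inv_log_div:
  assumes "k \<ge> 1" "X > 0"
  shows "inv_log (X / k) \<le> (1 + ln k) * inv_log X"
proof -
  have lk: "ln k \<ge> 0" using assms by simp
  have l: "ln (X / k) = ln X - ln k" using assms by (simp add: ln_div)
  define m where "m = max 0 (ln X - ln k)"
  have m: "m \<ge> 0" "max 0 (ln X) \<le> ln k + m" using lk by (auto simp: m_def)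
  have "1 + max 0 (ln X) \<le> (1 + ln k) * (1 + m)" 
  proof -
    have "(1 + ln k) * (1 + m) = 1 + ln k + m + ln k * m" by (simp add: algebra_simps)
    thus ?thesis using m(2) mult_nonneg_nonneg [OF lk m(1)] by linarith
  qed
  moreover have "1 + m > 0" "1 + max 0 (ln X) > 0" using m by auto
  ultimately show ?thesis unfolding inv_log_def l m_def [symmetric] by (simp add: field_simps)
qed

lemma inv_loss_denominator:
  assumes "q \<ge> 2"
  shows "1 - (1 + ln (real q)) / real q \<ge> 3/20"
proof -
  have "ln (real q) = ln 2 + ln (real q / 2)" using assms by (simp add: ln_div)
  also have "ln (real q / 2) \<le> real q / 2 - 1" by (rule ln_le_minus_one) (use assms in simp)
  finally have "1 + ln (real q) \<le> ln 2 + real q / 2" by simp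
  also have "ln (2::real) \<le> 7/10" using ln_2_less_1 ln2_le_25_over_36 by simp
  also have "7/10 + real q / 2 \<le> 17/20 * real q" using assms by simp
  finally have "(1 + ln (real q)) / real q \<le> 17/20" using assms by (simp add: divide_le_eq)
  thus ?thesis by simp
qed

lemma inv_loss_bounds:
  assumes "q \<ge> 2"
  shows "1 \<le> inv_loss q" "inv_loss q \<le> 7" "inv_loss q = 1 + inv_loss q * (1 + ln (real q)) / real q" "1 / (1 - 1 / real q) \<le> inv_loss q"
proof -
  define y where "y = (1 + ln (real q)) / real q"
  have y: "y \<ge> 0" "1 - y \<ge> 3/20" using inv_loss_denominator [OF assms] assms by (auto simp: y_def)
  have B: "inv_loss q = 1 / (1 - y)" by (simp add: inv_loss_def y_def)
  show "1 \<le> inv_loss q" unfolding B using y by (simp add: field_simps)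
  have "1 / (1 - y) \<le> 1 / (3/20)" using y by (intro frac_le) auto
  thus "inv_loss q \<le> 7" unfolding B by simp
  have "inv_loss q = 1 + inv_loss q * y" unfolding B using y by (simp add: field_simps)
  thus "inv_loss q = 1 + inv_loss q * (1 + ln (real q)) / real q" by (simp add: y_def)
  have "1 / real q \<le> y" using assms by (simp add: y_def divide_right_mono)
  thus "1 / (1 - 1 / real q) \<le> inv_loss q" unfolding B using y by (intro frac_le) auto
qed

text \<open>On \<open>(0, 1]\<close> the functions \<open>u\<close> in question vanish and \<open>inv_log\<close> equals \<open>1\<close>, so that the error there is all of
\<open>c\<close>; this is why \<open>M\<close> bounds \<open>c\<close> as well.\<close>

definition nearly :: "real \<Rightarrow> (real \<Rightarrow> real) \<Rightarrow> real \<Rightarrow> real \<Rightarrow> bool" where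
  "nearly X0 u c M \<longleftrightarrow> \<bar>c\<bar> \<le> M \<and> (\<forall>X. 0 < X \<and> X \<le> X0 \<longrightarrow> \<bar>u X - c\<bar> \<le> M * inv_log X)"

text \<open>Inverting \<open>1 - T\<^sub>q/q\<close>. Solve \<open>h(X) = (h(X) - h(X/q)/q) + h(X/q)/q\<close> upwards from \<open>X \<le> 1\<close>, where \<open>h\<close> vanishes;
\<open>inv_loss\<close> is the fixed point of the recursion for the error constant.\<close>

lemma nearly_unshift:
  assumes q: "q \<ge> 2" and zero: "\<And>Y. 0 < Y \<Longrightarrow> Y \<le> 1 \<Longrightarrow> h Y = 0"
    and near: "nearly X0 (subshift (1 / real q) q h) c M"
  shows "nearly X0 h (c / (1 - 1 / real q)) (M * inv_loss q)"
proof -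
  define c' where "c' = c / (1 - 1 / real q)"
  have q1: "1 - 1 / real q > 0" using q by simp
  have M: "M \<ge> 0" "\<bar>c\<bar> \<le> M" using near by (auto simp: nearly_def)
  have c': "c' = c + c' / real q" using q by (simp add: c'_def field_simps)
  have "\<bar>c'\<bar> = \<bar>c\<bar> * (1 / (1 - 1 / real q))" using q1 by (simp add: c'_def)
  also have "\<dots> \<le> M * inv_loss q" using M inv_loss_bounds(4) [OF q] q1 by (intro mult_mono) auto
  finally have c'M: "\<bar>c'\<bar> \<le> M * inv_loss q" .
  have small: "\<bar>h X - c'\<bar> \<le> M * inv_loss q * inv_log X" if "0 < X" "X \<le> 1" for X
    using that zero [of X] inv_log_1 [of X] c'M by simp
  have "\<bar>h X - c'\<bar> \<le> M * inv_loss q * inv_log X" if "0 < X" "X \<le> X0" "X < real q ^ n" for X n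
    using that
  proof (induction n arbitrary: X)
    case 0 thus ?case by (intro small) auto
  next
    case (Suc n)
    show ?case
    proof (cases "X \<le> 1")
      case True thus ?thesis using Suc by (intro small) auto
    next
      case False
      have "X / real q \<le> X * 1" using q Suc.prems by (simp add: divide_le_eq)
      hence IH: "\<bar>h (X / real q) - c'\<bar> \<le> M * inv_loss q * inv_log (X / real q)"
        using q Suc.prems by (intro Suc.IH) (auto simp: divide_less_eq mult.commute)
      have "h X - c' = (subshift (1 / real q) q h X - c) + (h (X / real q) - c') / real q"
        using c' by (simp add: subshift_def diff_divide_distrib)
      hence "\<bar>h X - c'\<bar> \<le> \<bar>subshift (1 / real q) q h X - c\<bar> + \<bar>h (X / real q) - c'\<bar> / real q"
        using abs_triangle_ineq [of "subshift (1 / real q) q h X - c" "(h (X / real q) - c') / real q"] q by simp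
      also have "\<dots> \<le> M * inv_log X + (M * inv_loss q * ((1 + ln (real q)) * inv_log X)) / real q"
      proof (intro add_mono divide_right_mono)
        show "\<bar>subshift (1 / real q) q h X - c\<bar> \<le> M * inv_log X" using near Suc.prems by (auto simp: nearly_def)
        have "M * inv_loss q * inv_log (X / real q) \<le> M * inv_loss q * ((1 + ln (real q)) * inv_log X)"
          using M inv_loss_bounds(1) [OF q] q Suc.prems by (intro mult_left_mono inv_log_div) auto
        thus "\<bar>h (X / real q) - c'\<bar> \<le> M * inv_loss q * ((1 + ln (real q)) * inv_log X)" using IH by linarith
      qed auto
      also have "\<dots> = M * inv_log X * (1 + inv_loss q * (1 + ln (real q)) / real q)" by (simp add: field_simps)
      also have "\<dots> = M * inv_log X * inv_loss q" using inv_loss_bounds(3) [OF q] by simp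
      finally show ?thesis by (simp add: mult_ac)
    qed
  qed
  (* The induction covers every X, since the powers of q are unbounded. *)
  moreover have "\<exists>n. X < real q ^ n" for X using q real_arch_pow [of "real q" X] by simp
  ultimately show ?thesis using c'M unfolding nearly_def c'_def by blast
qed

lemma nearly_unshift2:
  assumes q: "q \<ge> 2" and zero: "\<And>Y. 0 < Y \<Longrightarrow> Y \<le> 1 \<Longrightarrow> W Y = 0"
    and near: "nearly X0 (subshift (1 / real q) q (subshift (1 / real q) q W)) c M"
  shows "nearly X0 W (c / (1 - 1 / real q) / (1 - 1 / real q)) (M * (inv_loss q)\<^sup>2)"
proof -
  have "nearly X0 (subshift (1 / real q) q W) (c / (1 - 1 / real q)) (M * inv_loss q)"
  proof (rule nearly_unshift [OF q _ near])
    fix Y :: real assume Y: "0 < Y" "Y \<le> 1"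
    hence "Y / real q \<le> 1" "0 < Y / real q" using q by (auto simp: divide_le_eq)
    thus "subshift (1 / real q) q W Y = 0" using Y zero by (simp add: subshift_def)
  qed
  from nearly_unshift [OF q zero this] show ?thesis by (simp add: power2_eq_square mult.assoc)
qed

text \<open>Since \<open>1 - \<rho>(q) T = (1 - T/q)\<^sup>2 + (T - T\<^sup>2)/q\<^sup>2\<close>, the two operators differ by a term in which the constant
cancels and the error, controlled by \<open>nearly_unshift2\<close>, is multiplied by \<open>1/q\<^sup>2\<close>.\<close>

lemma nearly_exchange:
  assumes q: "q \<ge> 2" and zero: "\<And>Y. 0 < Y \<Longrightarrow> Y \<le> 1 \<Longrightarrow> W Y = 0"
    and near: "nearly X0 (subshift (1 / real q) q (subshift (1 / real q) q W)) c M"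
  shows "nearly X0 (subshift (rho q) q W) c (M * (1 + swap_loss q))"
  unfolding nearly_def
proof (intro conjI allI impI)
  have M: "M \<ge> 0" "\<bar>c\<bar> \<le> M" using near by (auto simp: nearly_def)
  have swap_loss: "swap_loss q \<ge> 0" using q by (auto simp: swap_loss_def)
  show "\<bar>c\<bar> \<le> M * (1 + swap_loss q)" using M mult_left_mono [of 1 "1 + swap_loss q" M] swap_loss by simp
  fix X :: real assume X: "0 < X \<and> X \<le> X0"
  define c' where "c' = c / (1 - 1 / real q) / (1 - 1 / real q)"
  have W: "\<bar>W Y - c'\<bar> \<le> M * (inv_loss q)\<^sup>2 * inv_log Y" if "0 < Y" "Y \<le> X0" for Y
    using nearly_unshift2 [OF q zero near] that by (auto simp: nearly_def c'_def)
  have Xq: "X / real q \<le> X0" "X / real q / real q \<le> X0" "0 < X / real q" "0 < X / real q / real q"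
  proof -
    have "X / real q \<le> X" using X q by (simp add: divide_le_eq)
    moreover have "X / real q / real q \<le> X / real q" using X q by (simp add: divide_le_eq)
    ultimately show "X / real q \<le> X0" "X / real q / real q \<le> X0" using X by auto
  qed (use X q in auto)
  have M': "M * (inv_loss q)\<^sup>2 \<ge> 0" using M by simp
  have e1: "inv_log (X / real q) \<le> (1 + ln (real q)) * inv_log X" using q X by (intro inv_log_div) auto
  have e2: "inv_log (X / real q / real q) \<le> (1 + 2 * ln (real q)) * inv_log X"
    using q X inv_log_div [of "real q * real q" X] mult_mono [of 1 "real q" 1 "real q"] by (simp add: ln_mult)
  (* The constant c' is inserted twice with opposite signs. *)
  have "subshift (rho q) q W X - c = (subshift (1 / real q) q (subshift (1 / real q) q W) X - c) + (1 / (real q)\<^sup>2) * ((W (X / real q) - c') - (W (X / real q / real q) - c'))"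
    using q by (simp add: subshift_def rho_def power2_eq_square field_simps)
  also have "\<bar>\<dots>\<bar> \<le> \<bar>subshift (1 / real q) q (subshift (1 / real q) q W) X - c\<bar> + (1 / (real q)\<^sup>2) * \<bar>(W (X / real q) - c') - (W (X / real q / real q) - c')\<bar>"
    by (rule order_trans [OF abs_triangle_ineq]) (simp add: abs_mult)
  also have "\<dots> \<le> M * inv_log X + (1 / (real q)\<^sup>2) * (M * (inv_loss q)\<^sup>2 * ((2 + 3 * ln (real q)) * inv_log X))"
  proof (intro add_mono mult_left_mono)
    show "\<bar>subshift (1 / real q) q (subshift (1 / real q) q W) X - c\<bar> \<le> M * inv_log X" using near X by (auto simp: nearly_def)
    have "\<bar>(W (X / real q) - c') - (W (X / real q / real q) - c')\<bar> \<le> M * (inv_loss q)\<^sup>2 * inv_log (X / real q) + M * (inv_loss q)\<^sup>2 * inv_log (X / real q / real q)"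
      using W [OF Xq(3,1)] W [OF Xq(4,2)] by linarith
    also have "\<dots> \<le> M * (inv_loss q)\<^sup>2 * ((1 + ln (real q)) * inv_log X) + M * (inv_loss q)\<^sup>2 * ((1 + 2 * ln (real q)) * inv_log X)"
      by (intro add_mono mult_left_mono e1 e2 M')
    finally show "\<bar>(W (X / real q) - c') - (W (X / real q / real q) - c')\<bar> \<le> M * (inv_loss q)\<^sup>2 * ((2 + 3 * ln (real q)) * inv_log X)"
      by (simp add: algebra_simps)
  qed auto
  also have "\<dots> = M * (1 + swap_loss q) * inv_log X" by (simp add: swap_loss_def field_simps)
  finally show "\<bar>subshift (rho q) q W X - c\<bar> \<le> M * (1 + swap_loss q) * inv_log X" .
qed

text \<open>Induction over the primes treated so far: a prime outside \<open>C\<close> has its factor \<open>(1 - T\<^sub>q/q)\<^sup>2\<close> exchanged for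
\<open>1 - \<rho>(q) T\<^sub>q\<close>, and a prime of \<open>C\<close> has it removed.\<close>

lemma sieve_sum_nearly:
  assumes base: "nearly X0 (sieve2 N) c0 M" and S: "S \<subseteq> primes_upto N" and C: "C \<subseteq> primes_upto N"
  shows "\<exists>c. nearly X0 (subshifts (S - C) rho (subshifts (primes_upto N - S) (\<lambda>q. 1 / real q) (subshifts (primes_upto N - S) (\<lambda>q. 1 / real q) log_sq))) c
           (M * (\<Prod>q\<in>S \<inter> C. (inv_loss q)\<^sup>2) * (\<Prod>q\<in>S - C. 1 + swap_loss q))"
  using finite_subset [OF S finite_primes_upto] S
proof (induction S rule: finite_induct)
  case empty
  thus ?case using base by (auto simp: sieve2_def)
next
  case (insert q S)
  define Q where "Q = primes_upto N - insert q S"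
  define k where "k = (\<lambda>q::nat. 1 / real q)"
  define W where "W = subshifts (S - C) rho (subshifts Q k (subshifts Q k log_sq))"
  have q: "q \<in> primes_upto N" "q \<ge> 2" using insert.prems by (auto simp: primes_upto_def prime_ge_2_nat)
  have PS: "primes_upto N - S = insert q Q" "q \<notin> Q" "finite Q" using q insert.hyps by (auto simp: Q_def)
  have "subshifts (insert q Q) k (subshifts (insert q Q) k log_sq) = subshift (k q) q (subshift (k q) q (subshifts Q k (subshifts Q k log_sq)))"
    using PS by (simp add: subshifts_insert subshifts_subshift)
  hence eq: "subshifts (S - C) rho (subshifts (primes_upto N - S) k (subshifts (primes_upto N - S) k log_sq)) = subshift (1 / real q) q (subshift (1 / real q) q W)"
    unfolding PS W_def by (simp add: subshifts_subshift k_def)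
  obtain c where c: "nearly X0 (subshift (1 / real q) q (subshift (1 / real q) q W)) c
           (M * (\<Prod>q\<in>S \<inter> C. (inv_loss q)\<^sup>2) * (\<Prod>q\<in>S - C. 1 + swap_loss q))"
    using insert.IH insert.prems eq unfolding k_def by auto
  have zero: "W Y = 0" if Y: "0 < Y" "Y \<le> 1" for Y
    unfolding W_def
    by (intro subshifts_zero Y log_sq_zero) (use insert.prems primes_upto_prime in \<open>auto simp: Q_def\<close>)
  show ?case
  proof (cases "q \<in> C")
    case True
    have "insert q S - C = S - C" "insert q S \<inter> C = insert q (S \<inter> C)" using True by auto
    moreover have "(\<Prod>q\<in>insert q (S \<inter> C). (inv_loss q)\<^sup>2) = (inv_loss q)\<^sup>2 * (\<Prod>q\<in>S \<inter> C. (inv_loss q)\<^sup>2)"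
      using insert.hyps by (intro prod.insert) auto
    ultimately show ?thesis using nearly_unshift2 [OF q(2) zero c] unfolding W_def k_def Q_def by (auto simp: mult_ac)
  next
    case False
    have "insert q S - C = insert q (S - C)" "insert q S \<inter> C = S \<inter> C" using False by auto
    moreover have "(\<Prod>q\<in>insert q (S - C). 1 + swap_loss q) = (1 + swap_loss q) * (\<Prod>q\<in>S - C. 1 + swap_loss q)"
      using insert.hyps by (intro prod.insert) auto
    moreover have "subshifts (insert q (S - C)) rho u = subshift (rho q) q (subshifts (S - C) rho u)" for u
      using insert.hyps by (intro subshifts_insert) auto
    ultimately show ?thesis using nearly_exchange [OF q(2) zero c] unfolding W_def k_def Q_def by (auto simp: mult_ac)
  qed
qed

lemma summable_ln_over_square: "summable (\<lambda>n. (1 + ln (real (Suc n))) / (real (Suc n))\<^sup>2)"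
proof (rule summable_comparison_test_bigo)
  show "summable (\<lambda>n. norm (real (Suc n) powr (- (3/2))))"
    using summable_zeta_powr [of "3/2"] by simp
  show "(\<lambda>n. (1 + ln (real (Suc n))) / (real (Suc n))\<^sup>2) \<in> O(\<lambda>n. real (Suc n) powr (- (3/2)))"
    by real_asymp
qed

definition ln_square_sum :: real where "ln_square_sum = (\<Sum>n. (1 + ln (real (Suc n))) / (real (Suc n))\<^sup>2)"

text \<open>Bounds a product over primes by a convergent sum over all integers, uniformly in \<open>N\<close>.\<close>

lemma prod_one_plus_le:
  assumes "A \<subseteq> primes_upto N" "\<And>q. q \<in> primes_upto N \<Longrightarrow> 0 \<le> f q" "\<And>q. q \<in> primes_upto N \<Longrightarrow> f q \<le> K * ((1 + ln (real q)) / (real q)\<^sup>2)" "K \<ge> 0"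
  shows "(\<Prod>q\<in>A. 1 + f q) \<le> exp (K * ln_square_sum)"
proof -
  have finA: "finite A" by (rule finite_subset [OF assms(1) finite_primes_upto])
  have "(\<Prod>q\<in>A. 1 + f q) \<le> (\<Prod>q\<in>A. exp (f q))"
    using assms by (intro prod_mono) (auto intro!: add_nonneg_nonneg exp_ge_add_one_self)
  also have "\<dots> = exp (\<Sum>q\<in>A. f q)" using finA by (simp add: exp_sum)
  also have "(\<Sum>q\<in>A. f q) \<le> (\<Sum>q\<in>A. K * ((1 + ln (real q)) / (real q)\<^sup>2))"
    using assms by (intro sum_mono) auto
  also have "\<dots> \<le> (\<Sum>q\<in>Suc ` {..N}. K * ((1 + ln (real q)) / (real q)\<^sup>2))"
  proof (rule sum_mono2)
    show "A \<subseteq> Suc ` {..N}"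
    proof
      fix q assume q: "q \<in> A"
      hence "q \<in> primes_upto N" using assms(1) by auto
      hence "q = Suc (q - 1)" "q - 1 \<le> N" using primes_upto_pos [of q N] by (auto simp: primes_upto_def)
      thus "q \<in> Suc ` {..N}" by blast
    qed
  qed (use assms(4) in auto)
  also have "\<dots> = K * (\<Sum>n\<le>N. (1 + ln (real (Suc n))) / (real (Suc n))\<^sup>2)" by (simp add: sum.reindex sum_distrib_left)
  also have "\<dots> \<le> K * ln_square_sum" unfolding ln_square_sum_def
    by (intro mult_left_mono sum_le_suminf [OF summable_ln_over_square]) (use assms(4) in auto)
  finally show ?thesis by simp
qed

text \<open>The exchanges cost a convergent product in total, while the removed primes contribute the factor that
depends on \<open>C\<close>. The constant \<open>c\<close> cancels in the differences of two values that occur in the quadratic form.\<close>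

lemma coprime_sieve_sum_nearly:
  "\<exists>K\<ge>0. \<forall>N C. C \<subseteq> primes_upto N \<longrightarrow> (\<exists>c. nearly (real (Suc N)) (subshifts (primes_upto N - C) rho log_sq) c (K * (\<Prod>q\<in>C. (inv_loss q)\<^sup>2)))"
proof -
  obtain K where K: "K \<ge> 2" "\<And>N X. 0 < X \<Longrightarrow> X \<le> real (Suc N) \<Longrightarrow> \<bar>sieve2 N X - 2\<bar> \<le> K * inv_log X"
    using sieve2_asymptotic by auto
  show ?thesis
  proof (rule exI [of _ "K * exp (147 * ln_square_sum)"], intro conjI allI impI)
    fix N C assume C: "C \<subseteq> primes_upto N"
    have base: "nearly (real (Suc N)) (sieve2 N) 2 K" using K by (auto simp: nearly_def)
    obtain c where c: "nearly (real (Suc N)) (subshifts (primes_upto N - C) rho log_sq) c (K * (\<Prod>q\<in>C. (inv_loss q)\<^sup>2) * (\<Prod>q\<in>primes_upto N - C. 1 + swap_loss q))"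
      using sieve_sum_nearly [OF base order_refl C] C by (auto simp: Int_absorb1)
    have E: "(\<Prod>q\<in>primes_upto N - C. 1 + swap_loss q) \<le> exp (147 * ln_square_sum)"
    proof (rule prod_one_plus_le [where f = swap_loss and N = N])
      fix q assume "q \<in> primes_upto N"
      hence q: "q \<ge> 2" by (auto simp: primes_upto_def prime_ge_2_nat)
      have "(inv_loss q)\<^sup>2 * (2 + 3 * ln (real q)) \<le> 7\<^sup>2 * (3 * (1 + ln (real q)))"
        using inv_loss_bounds [OF q] q by (intro mult_mono power_mono) auto
      thus "swap_loss q \<le> 147 * ((1 + ln (real q)) / (real q)\<^sup>2)"
        unfolding swap_loss_def times_divide_eq_right by (intro divide_right_mono) auto
      show "0 \<le> swap_loss q" using q by (auto simp: swap_loss_def)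
    qed auto
    have le: "K * (\<Prod>q\<in>C. (inv_loss q)\<^sup>2) * (\<Prod>q\<in>primes_upto N - C. 1 + swap_loss q) \<le> K * exp (147 * ln_square_sum) * (\<Prod>q\<in>C. (inv_loss q)\<^sup>2)"
      using mult_left_mono [OF E, of "K * (\<Prod>q\<in>C. (inv_loss q)\<^sup>2)"] K(1) by (simp add: mult_ac prod_nonneg)
    hence "nearly (real (Suc N)) (subshifts (primes_upto N - C) rho log_sq) c (K * exp (147 * ln_square_sum) * (\<Prod>q\<in>C. (inv_loss q)\<^sup>2))"
      using c inv_log_pos unfolding nearly_def by (meson less_imp_le mult_right_mono order_trans)
    thus "\<exists>c. nearly (real (Suc N)) (subshifts (primes_upto N - C) rho log_sq) c (K * exp (147 * ln_square_sum) * (\<Prod>q\<in>C. (inv_loss q)\<^sup>2))" by blast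
  qed (use K in auto)
qed

section \<open>The divisor function on multiples of primes\<close>

definition tau :: "nat \<Rightarrow> nat" where "tau n = card {d. d dvd n}"

lemma tau_prime_mult:
  assumes "prime q" "m > 0"
  shows "tau (q * m) + (if q dvd m then tau (m div q) else 0) = 2 * tau m"
proof -
  have q: "q > 0" using assms(1) prime_gt_0_nat by auto
  define A where "A = (\<lambda>e. q * e) ` {e. e dvd m}"
  define B where "B = {d. d dvd m}"
  have fin: "finite A" "finite B" using assms(2) by (auto simp: A_def B_def)
  have un: "{d. d dvd q * m} = A \<union> B"
  proof (intro equalityI subsetI)
    fix d assume "d \<in> {d. d dvd q * m}"
    hence d: "d dvd q * m" by simp
    show "d \<in> A \<union> B"
    proof (cases "q dvd d")
      case True
      then obtain e where "d = q * e" by auto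
      thus ?thesis using d q by (auto simp: A_def)
    next
      case False
      hence "coprime q d" by (rule prime_imp_coprime [OF assms(1)])
      hence "coprime d q" by (rule coprime_imp_coprime) auto
      hence "d dvd m" using d by (simp add: coprime_dvd_mult_right_iff)
      thus ?thesis by (simp add: B_def)
    qed
  qed (auto simp: A_def B_def)
  have inter: "card (A \<inter> B) = (if q dvd m then tau (m div q) else 0)"
  proof (cases "q dvd m")
    case True
    then obtain k where k: "m = q * k" by auto
    have "A \<inter> B = (\<lambda>e. q * e) ` {e. e dvd k}" using q by (auto simp: A_def B_def k)
    moreover have "inj_on (\<lambda>e. q * e) {e. e dvd k}" using q by (auto simp: inj_on_def)
    ultimately show ?thesis using k q by (simp add: card_image tau_def)
  next
    case False
    hence "A \<inter> B = {}" by (auto simp: A_def B_def dest: dvd_mult_left)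
    thus ?thesis using False by simp
  qed
  have "card A = tau m" "card B = tau m"
    using q by (auto simp: A_def B_def tau_def card_image inj_on_def)
  thus ?thesis using card_Un_Int [OF fin] inter unfolding un [symmetric] tau_def by simp
qed

definition multiples :: "nat set \<Rightarrow> real \<Rightarrow> nat set" where
  "multiples A x = {n. n \<ge> 1 \<and> real n \<le> x \<and> (\<forall>a\<in>A. a dvd n)}"

definition tau_sum :: "nat set \<Rightarrow> real \<Rightarrow> real" where
  "tau_sum A x = (\<Sum>n\<in>multiples A x. real (tau n))"

lemma finite_multiples [simp]: "finite (multiples A x)"
proof (rule finite_subset)
  show "multiples A x \<subseteq> {..nat \<lfloor>x\<rfloor>}" by (auto simp: multiples_def le_nat_floor)
qed auto

lemma multiples_insert:
  assumes "prime q" "q \<notin> A" "\<And>a. a \<in> A \<Longrightarrow> prime a"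
  shows "multiples (insert q A) x = (\<lambda>m. q * m) ` multiples A (x / real q)"
proof (intro equalityI subsetI)
  have q: "q > 0" using assms(1) prime_gt_0_nat by auto
  have dv: "a dvd m" if "a \<in> A" "a dvd q * m" for a m
    using that assms by (metis prime_dvd_mult_iff primes_dvd_imp_eq)
  fix n
  {
    assume n: "n \<in> multiples (insert q A) x"
    then obtain m where m: "n = q * m" by (auto simp: multiples_def)
    have "m \<ge> 1" using n by (cases m) (auto simp: multiples_def m)
    moreover have "real m \<le> x / real q" using n q by (simp add: multiples_def m field_simps)
    moreover have "\<forall>a\<in>A. a dvd m"
    proof
      fix a assume a: "a \<in> A"
      hence "a dvd q * m" using n by (simp add: multiples_def m)
      thus "a dvd m" by (rule dv [OF a])
    qed
    ultimately have "m \<in> multiples A (x / real q)" by (simp add: multiples_def)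
    thus "n \<in> (\<lambda>m. q * m) ` multiples A (x / real q)" using m by auto
  next
    assume "n \<in> (\<lambda>m. q * m) ` multiples A (x / real q)"
    thus "n \<in> multiples (insert q A) x" using q by (auto simp: multiples_def field_simps Suc_le_eq)
  }
qed

text \<open>This recursion yields the asymptotics for multiples of a squarefree number from those for all integers.\<close>

lemma tau_sum_insert:
  assumes "prime q" "q \<notin> A" "\<And>a. a \<in> A \<Longrightarrow> prime a"
  shows "tau_sum (insert q A) x = 2 * tau_sum A (x / real q) - tau_sum A (x / real q / real q)"
proof -
  have q: "q > 0" using assms(1) prime_gt_0_nat by auto
  define D where "D = multiples A (x / real q)"
  have N: "multiples (insert q A) y = (\<lambda>m. q * m) ` multiples A (y / real q)" for y
    by (rule multiples_insert) (use assms in auto)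
  have inj: "inj_on (\<lambda>m. q * m) S" for S using q by (auto simp: inj_on_def)
  have "tau_sum (insert q A) x = (\<Sum>m\<in>D. real (tau (q * m)))"
    unfolding tau_sum_def N D_def by (subst sum.reindex [OF inj]) simp
  also have "\<dots> = (\<Sum>m\<in>D. 2 * real (tau m) - (if q dvd m then real (tau (m div q)) else 0))"
  proof (rule sum.cong [OF refl])
    fix m assume "m \<in> D"
    hence "m > 0" by (auto simp: D_def multiples_def)
    from arg_cong [OF tau_prime_mult [OF assms(1) this], of real]
    have "real (tau (q * m)) + (if q dvd m then real (tau (m div q)) else 0) = 2 * real (tau m)"
      by (cases "q dvd m") simp_all
    thus "real (tau (q * m)) = 2 * real (tau m) - (if q dvd m then real (tau (m div q)) else 0)" by simp
  qed
  also have "\<dots> = 2 * tau_sum A (x / real q) - (\<Sum>m\<in>D. if q dvd m then real (tau (m div q)) else 0)"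
    by (simp add: sum_subtractf tau_sum_def D_def sum_distrib_left)
  also have "(\<Sum>m\<in>D. if q dvd m then real (tau (m div q)) else 0) = (\<Sum>m\<in>{m\<in>D. q dvd m}. real (tau (m div q)))"
    by (rule sum.inter_filter [symmetric]) (simp add: D_def)
  also have "{m\<in>D. q dvd m} = multiples (insert q A) (x / real q)" by (auto simp: D_def multiples_def)
  also have "(\<Sum>m\<in>multiples (insert q A) (x / real q). real (tau (m div q))) = tau_sum A (x / real q / real q)"
    unfolding N tau_sum_def using q by (subst sum.reindex [OF inj]) simp
  finally show ?thesis .
qed

lemma harm_bound:
  assumes "n > 0"
  shows "\<bar>harm n - ln (real n) - euler_mascheroni\<bar> \<le> 1 / real n"
proof -
  obtain k where k: "n = Suc k" using assms by (cases n) auto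
  have "ln (real (Suc n) / real n) \<le> real (Suc n) / real n - 1" by (intro ln_le_minus_one) (use assms in auto)
  hence u: "ln (real (Suc n)) - ln (real n) \<le> 1 / real n" using assms by (simp add: ln_div field_simps)
  have l: "ln (real n) \<le> ln (real (Suc n))" using assms by simp
  have r: "1 / real (2 * n) \<le> 1 / real n" "0 \<le> 1 / real (2 * (k + 2))" using assms by (auto simp: field_simps)
  have 1: "euler_mascheroni \<ge> harm n - ln (real (Suc n)) + 1 / real (2 * (k + 2))"
    using euler_mascheroni_lower [of k] by (simp add: k add_ac)
  have 2: "euler_mascheroni \<le> harm n - ln (real (Suc n)) + 1 / real (2 * n)"
    using euler_mascheroni_upper [of k] by (simp add: k add_ac)
  show ?thesis using 1 2 u l r by linarith
qed

definition tau_const :: real where "tau_const = 16 + \<bar>2 * euler_mascheroni - 1\<bar>"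

lemma tau_sum_pairs:
  "(\<Sum>n\<in>multiples {} x. tau n) = card {(a, b). a \<ge> 1 \<and> b \<ge> 1 \<and> real (a * b) \<le> x}"
proof -
  have "(\<Sum>n\<in>multiples {} x. tau n) = card (Sigma (multiples {} x) (\<lambda>n. {d. d dvd n}))"
    unfolding tau_def
  proof (rule card_SigmaI [symmetric])
    show "\<forall>n\<in>multiples {} x. finite {d. d dvd n}" by (auto simp: multiples_def)
  qed simp
  also have "\<dots> = card {(a, b). a \<ge> 1 \<and> b \<ge> 1 \<and> real (a * b) \<le> x}"
  proof (rule bij_betw_same_card [of "\<lambda>(n, d). (d, n div d)"], rule bij_betwI [where g = "\<lambda>(a, b). (a * b, a)"])
    show "(\<lambda>(n, d). (d, n div d)) \<in> Sigma (multiples {} x) (\<lambda>n. {d. d dvd n}) \<rightarrow> {(a, b). a \<ge> 1 \<and> b \<ge> 1 \<and> real (a * b) \<le> x}"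
      by (auto simp: multiples_def Suc_le_eq intro: Nat.gr0I elim!: dvdE)
    show "(\<lambda>(a, b). (a * b, a)) \<in> {(a, b). a \<ge> 1 \<and> b \<ge> 1 \<and> real (a * b) \<le> x} \<rightarrow> Sigma (multiples {} x) (\<lambda>n. {d. d dvd n})"
      by (auto simp: multiples_def Suc_le_eq)
  qed (auto simp: multiples_def)
  finally show ?thesis .
qed

text \<open>Pairs \<open>(a, b)\<close> with \<open>ab \<le> x\<close> have \<open>a \<le> sqrt x\<close> or \<open>b \<le> sqrt x\<close>; the square counts those with both.\<close>

lemma hyperbola_card:
  assumes x: "x \<ge> 1" and s: "s = nat \<lfloor>sqrt x\<rfloor>"
  shows "tau_sum {} x = 2 * (\<Sum>a=1..s. real (nat \<lfloor>x / real a\<rfloor>)) - (real s)\<^sup>2"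
proof -
  have s1: "real s \<le> sqrt x" "sqrt x < real s + 1" using x by (auto simp: s)
  have sq: "sqrt x * sqrt x = x" using x by simp
  define D where "D = {(a, b). a \<ge> 1 \<and> b \<ge> 1 \<and> real (a * b) \<le> x}"
  define Da where "Da = Sigma {1..s} (\<lambda>a. {1..nat \<lfloor>x / real a\<rfloor>})"
  define Db where "Db = (\<lambda>(a, b). (b, a)) ` Da"
  have mem: "(b \<le> nat \<lfloor>x / real a\<rfloor>) = (real (a * b) \<le> x)" if "a \<ge> 1" for a b
  proof -
    have "(b \<le> nat \<lfloor>x / real a\<rfloor>) = (real b \<le> x / real a)"
      using x that by (simp add: le_nat_floor le_nat_iff le_floor_iff)
    also have "\<dots> = (real (a * b) \<le> x)" using that by (simp add: field_simps)
    finally show ?thesis .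
  qed
  have Da: "Da = {(a, b). 1 \<le> a \<and> a \<le> s \<and> 1 \<le> b \<and> real (a * b) \<le> x}"
    unfolding Da_def using mem by auto
  have Db: "Db = {(a, b). 1 \<le> b \<and> b \<le> s \<and> 1 \<le> a \<and> real (a * b) \<le> x}"
    unfolding Db_def Da by (auto simp: mult.commute image_iff)
  have un: "D = Da \<union> Db"
  proof (intro equalityI subsetI)
    fix p assume p: "p \<in> D"
    obtain a b where ab: "p = (a, b)" by (cases p)
    show "p \<in> Da \<union> Db"
    proof (rule ccontr)
      assume "p \<notin> Da \<union> Db"
      hence "a > s" "b > s" using p ab by (auto simp: D_def Da Db)
      hence "sqrt x < real a" "sqrt x < real b" using s1 by linarith+
      hence "sqrt x * sqrt x < real a * real b" using x by (intro mult_strict_mono') auto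
      thus False using p ab sq by (simp add: D_def)
    qed
  qed (auto simp: D_def Da Db)
  have inter: "Da \<inter> Db = {1..s} \<times> {1..s}"
  proof (intro equalityI subsetI)
    fix p assume "p \<in> {1..s} \<times> {1..s}"
    then obtain a b where ab: "p = (a, b)" "1 \<le> a" "a \<le> s" "1 \<le> b" "b \<le> s" by auto
    have "real a * real b \<le> sqrt x * sqrt x" using ab s1 x by (intro mult_mono) auto
    thus "p \<in> Da \<inter> Db" using ab sq by (auto simp: Da Db)
  qed (auto simp: Da Db)
  have fin: "finite Da" "finite Db" by (auto simp: Da_def Db_def)
  have cDa: "card Da = (\<Sum>a=1..s. nat \<lfloor>x / real a\<rfloor>)" unfolding Da_def by (subst card_SigmaI) auto
  have cDb: "card Db = card Da" unfolding Db_def by (rule card_image) (auto simp: inj_on_def)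
  have "card D + card (Da \<inter> Db) = card Da + card Db" unfolding un by (rule card_Un_Int [OF fin, symmetric])
  hence "real (card D) + real s * real s = 2 * real (card Da)"
    unfolding inter cDb by (simp add: card_cartesian_product) (metis mult_2 of_nat_add of_nat_mult)
  moreover have "tau_sum {} x = real (card D)" unfolding tau_sum_def D_def tau_sum_pairs [symmetric] by simp
  ultimately show ?thesis by (simp add: cDa power2_eq_square)
qed

text \<open>Dirichlet's divisor problem by the hyperbola method, in a form valid for all \<open>x > 0\<close>.\<close>

lemma tau_sum_empty:
  assumes "x > 0"
  shows "\<bar>tau_sum {} x - x * (1 * ln x + (2 * euler_mascheroni - 1))\<bar> \<le> tau_const * sqrt x"
proof (cases "x < 1")
  case True
  have "multiples {} x = {}" using True by (auto simp: multiples_def)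
  hence "tau_sum {} x = 0" by (simp add: tau_sum_def)
  moreover have "\<bar>x * ln x\<bar> \<le> 2 * sqrt x"
  proof -
    have "ln (1 / sqrt x) \<le> 1 / sqrt x - 1" by (rule ln_le_minus_one) (use assms in simp)
    moreover have "ln (1 / sqrt x) = - (ln x / 2)" using assms by (simp add: ln_div ln_sqrt)
    moreover have "ln x < 0" using True assms by simp
    ultimately have "\<bar>ln x\<bar> \<le> 2 / sqrt x" by simp
    hence "x * \<bar>ln x\<bar> \<le> x * (2 / sqrt x)" using assms by (intro mult_left_mono) auto
    also have "\<dots> = 2 * sqrt x" using assms by (simp add: real_div_sqrt field_simps)
    finally show ?thesis using assms by (simp add: abs_mult)
  qed
  moreover have "\<bar>x * (2 * euler_mascheroni - 1)\<bar> \<le> \<bar>2 * euler_mascheroni - 1\<bar> * sqrt x"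
  proof -
    have "x \<le> sqrt x" using True assms by (simp add: real_le_rsqrt power2_eq_square mult_left_le)
    hence "x * \<bar>2 * euler_mascheroni - 1 :: real\<bar> \<le> sqrt x * \<bar>2 * euler_mascheroni - 1\<bar>" by (intro mult_right_mono) auto
    thus ?thesis using assms by (simp add: abs_mult mult.commute)
  qed
  ultimately show ?thesis using assms by (simp add: tau_const_def distrib_left distrib_right) 
next
  case False
  define s where "s = nat \<lfloor>sqrt x\<rfloor>"
  have x: "x \<ge> 1" using False by simp
  have s: "real s \<le> sqrt x" "sqrt x < real s + 1" using x by (auto simp: s_def)
  have sx1: "sqrt x \<ge> 1" using x by simp
  have s0: "s > 0" using s sx1 by (cases s) auto
  have sq: "sqrt x * sqrt x = x" using x by simp
  have half: "sqrt x \<le> 2 * real s" using s s0 by linarith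
  define S1 where "S1 = (\<Sum>a=1..s. real (nat \<lfloor>x / real a\<rfloor>))"
  have S1: "\<bar>S1 - x * harm s\<bar> \<le> sqrt x"
  proof -
    have "S1 - x * harm s = (\<Sum>a=1..s. real (nat \<lfloor>x / real a\<rfloor>) - x / real a)"
      by (simp add: S1_def harm_def sum_distrib_left sum_subtractf divide_inverse)
    also have "\<bar>\<dots>\<bar> \<le> (\<Sum>a=1..s. \<bar>real (nat \<lfloor>x / real a\<rfloor>) - x / real a\<bar>)" by (rule sum_abs)
    also have "\<dots> \<le> (\<Sum>a=1..s. 1)"
    proof (rule sum_mono)
      fix a assume "a \<in> {1..s}"
      have "x / real a \<ge> 0" using x by simp
      hence "real (nat \<lfloor>x / real a\<rfloor>) = real_of_int \<lfloor>x / real a\<rfloor>" by simp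
      thus "\<bar>real (nat \<lfloor>x / real a\<rfloor>) - x / real a\<bar> \<le> 1"
        using floor_correct [of "x / real a"] by linarith
    qed
    also have "\<dots> = real s" by simp
    finally show ?thesis using s by simp
  qed
  have lns: "\<bar>ln (real s) - ln x / 2\<bar> \<le> 1 / real s"
  proof -
    have "ln x / 2 = ln (sqrt x)" using x by (simp add: ln_sqrt)
    moreover have "ln (real s) \<le> ln (sqrt x)" 
    proof (rule iffD2 [OF ln_le_cancel_iff])
      show "0 < real s" using s0 by simp
    qed (use s sx1 in linarith)+
    moreover have "ln (sqrt x) - ln (real s) \<le> 1 / real s"
    proof -
      have "ln (sqrt x / real s) \<le> sqrt x / real s - 1" using sx1 s0 by (intro ln_le_minus_one) auto
      also have "\<dots> \<le> (real s + 1) / real s - 1" using s s0 by (intro diff_right_mono divide_right_mono) auto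
      also have "\<dots> = 1 / real s" using s0 by (simp add: field_simps)
      finally show ?thesis using s0 sx1 x by (simp add: ln_div)
    qed
    ultimately show ?thesis by linarith
  qed
  have hs: "\<bar>harm s - (ln x / 2 + euler_mascheroni)\<bar> \<le> 2 / real s"
    using harm_bound [OF s0] lns by (simp add: field_simps) 
  have "\<bar>x * harm s - x * (ln x / 2 + euler_mascheroni)\<bar> \<le> 4 * sqrt x"
  proof -
    have "\<bar>x * harm s - x * (ln x / 2 + euler_mascheroni)\<bar> = x * \<bar>harm s - (ln x / 2 + euler_mascheroni)\<bar>"
      using x by (simp add: abs_mult right_diff_distrib [symmetric])
    also have "\<dots> \<le> x * (2 / real s)" using hs x by (intro mult_left_mono) auto
    also have "\<dots> \<le> x * (4 / sqrt x)"
    proof -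
      have "4 / (2 * real s) \<le> 4 / sqrt x"
        by (rule divide_left_mono [OF half]) (use sx1 s0 in \<open>auto intro!: mult_pos_pos\<close>)
      hence "2 / real s \<le> 4 / sqrt x" by simp
      thus ?thesis using x by (intro mult_left_mono) auto
    qed
    also have "\<dots> = 4 * sqrt x" using x by (simp add: real_div_sqrt field_simps)
    finally show ?thesis .
  qed
  moreover have "\<bar>(real s)\<^sup>2 - x\<bar> \<le> 3 * sqrt x"
  proof -
    have "(real s)\<^sup>2 \<le> (sqrt x)\<^sup>2" using s by (intro power_mono) auto
    moreover have "(sqrt x)\<^sup>2 \<le> (real s + 1)\<^sup>2" using s sx1 by (intro power_mono) auto
    moreover have "(real s + 1)\<^sup>2 = (real s)\<^sup>2 + 2 * real s + 1" by (simp add: power2_eq_square algebra_simps)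
    moreover have "(sqrt x)\<^sup>2 = x" using x by simp
    ultimately show ?thesis using s sx1 by linarith
  qed
  moreover have "tau_sum {} x = 2 * S1 - (real s)\<^sup>2" unfolding S1_def by (rule hyperbola_card [OF x s_def])
  moreover have "x * (1 * ln x + (2 * euler_mascheroni - 1)) = 2 * (x * (ln x / 2 + euler_mascheroni)) - x"
    by (simp add: algebra_simps)
  ultimately have "\<bar>tau_sum {} x - x * (1 * ln x + (2 * euler_mascheroni - 1))\<bar> \<le> 13 * sqrt x"
    using S1 by linarith
  also have "\<dots> \<le> tau_const * sqrt x" using sx1 by (intro mult_right_mono) (auto simp: tau_const_def)
  finally show ?thesis .
qed

text \<open>The coefficients \<open>a\<close> and \<open>b\<close> depend on \<open>A\<close> but are left unspecified, which keeps the induction short; \<open>linear_average\<close> applies to every main term of this shape.\<close>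

lemma tau_sum_asymptotic:
  assumes "finite A" "\<And>q. q \<in> A \<Longrightarrow> prime q"
  shows "\<exists>a b. \<forall>x>0. \<bar>tau_sum A x - x * (a * ln x + b)\<bar> \<le> tau_const * (\<Prod>q\<in>A. 3 / sqrt (real q)) * sqrt x"
  using assms
proof (induction A rule: finite_induct)
  case empty
  show ?case by (intro exI [of _ 1] exI [of _ "2 * euler_mascheroni - 1"] allI impI) (use tau_sum_empty in simp)
next
  case (insert q A)
  define E where "E = tau_const * (\<Prod>q\<in>A. 3 / sqrt (real q))"
  obtain a b where ab: "\<bar>tau_sum A x - x * (a * ln x + b)\<bar> \<le> E * sqrt x" if "x > 0" for x
    using insert unfolding E_def by auto
  have E0: "E \<ge> 0" by (auto simp: E_def tau_const_def intro!: mult_nonneg_nonneg prod_nonneg)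
  have q: "prime q" using insert by auto
  have q1: "real q \<ge> 1" using prime_ge_1_nat [OF q] by simp
  have rq: "sqrt (real q) \<ge> 1" using q1 by simp
  define L where "L = ln (real q)"
  define a' where "a' = 2 * a / real q - a / (real q * real q)"
  define b' where "b' = 2 * (b - a * L) / real q - (b - 2 * a * L) / (real q * real q)"
  have "\<bar>tau_sum (insert q A) x - x * (a' * ln x + b')\<bar> \<le> tau_const * (\<Prod>q\<in>insert q A. 3 / sqrt (real q)) * sqrt x" if x: "x > 0" for x
  proof -
    have T: "tau_sum (insert q A) x = 2 * tau_sum A (x / real q) - tau_sum A (x / real q / real q)"
      by (rule tau_sum_insert) (use insert in auto)
    have l1: "ln (x / real q) = ln x - L" "ln (x / real q / real q) = ln x - 2 * L"
      using x q1 by (auto simp: L_def ln_div ln_mult)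
    have 1: "\<bar>tau_sum A (x / real q) - x / real q * (a * (ln x - L) + b)\<bar> \<le> E * (sqrt x / sqrt (real q))"
      using ab [of "x / real q"] x q1 by (simp add: l1 real_sqrt_divide)
    have 2: "\<bar>tau_sum A (x / real q / real q) - x / real q / real q * (a * (ln x - 2 * L) + b)\<bar> \<le> E * (sqrt x / real q)"
      using ab [of "x / real q / real q"] x q1 unfolding l1 by (simp add: real_sqrt_divide real_sqrt_mult)
    have eq: "x * (a' * ln x + b') = 2 * (x / real q * (a * (ln x - L) + b)) - x / real q / real q * (a * (ln x - 2 * L) + b)"
      using q1 by (simp add: a'_def b'_def field_simps)
    have "\<bar>tau_sum (insert q A) x - x * (a' * ln x + b')\<bar> \<le> 2 * (E * (sqrt x / sqrt (real q))) + E * (sqrt x / real q)"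
    proof -
      have "\<bar>2 * A - B - (2 * p - r)\<bar> \<le> 2 * e1 + e2" if "\<bar>A - p\<bar> \<le> e1" "\<bar>B - r\<bar> \<le> e2" for A B p r e1 e2 :: real
        using that by linarith
      from this [OF 1 2] show ?thesis unfolding T eq .
    qed
    also have "\<dots> \<le> 2 * (E * (sqrt x / sqrt (real q))) + E * (sqrt x / sqrt (real q))"
    proof -
      have "sqrt (real q) \<le> real q" using mult_left_mono [OF rq, of "sqrt (real q)"] q1 by simp
      thus ?thesis using E0 x rq by (intro add_left_mono mult_left_mono divide_left_mono) auto
    qed
    also have "\<dots> = tau_const * (\<Prod>q\<in>insert q A. 3 / sqrt (real q)) * sqrt x"
      using insert by (simp add: E_def)
    finally show ?thesis .
  qed
  thus ?case by blast
qed

section \<open>Sums over sets of primes\<close>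

lemma sum_Pow_insert:
  assumes "finite A" "q \<notin> A"
  shows "(\<Sum>S\<in>Pow (insert q A). f S) = (\<Sum>S\<in>Pow A. f S + f (insert q S))"
proof -
  have nq: "q \<notin> B" if "B \<in> Pow A" for B using that assms(2) by auto
  have inj: "inj_on (insert q) (Pow A)" by (rule inj_onI) (metis Diff_insert_absorb nq)
  have "(\<Sum>S\<in>Pow (insert q A). f S) = (\<Sum>S\<in>Pow A. f S) + (\<Sum>S\<in>insert q ` Pow A. f S)"
    unfolding Pow_insert by (rule sum.union_disjoint) (use assms in auto)
  also have "(\<Sum>S\<in>insert q ` Pow A. f S) = (\<Sum>S\<in>Pow A. f (insert q S))"
    by (simp only: sum.reindex [OF inj] o_def)
  finally show ?thesis by (simp only: sum.distrib)
qed

lemma prod_insert_Pow: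
  assumes "finite A" "q \<notin> A" "S \<in> Pow A"
  shows "(\<Prod>x\<in>insert q S. g x) = g q * (\<Prod>x\<in>S. g x :: real)"
  by (rule prod.insert) (use assms in \<open>auto intro: finite_subset\<close>)

lemma prod_one_plus_Pow:
  assumes "finite A"
  shows "(\<Prod>q\<in>A. 1 + g q) = (\<Sum>S\<in>Pow A. (\<Prod>q\<in>S. g q :: real))"
  using assms
proof (induction A rule: finite_induct)
  case (insert q A)
  have "(\<Sum>S\<in>Pow (insert q A). (\<Prod>q\<in>S. g q)) = (\<Sum>S\<in>Pow A. (\<Prod>q\<in>S. g q) + g q * (\<Prod>q\<in>S. g q))"
    unfolding sum_Pow_insert [OF insert(1,2)] by (intro sum.cong refl) (simp add: prod_insert_Pow [OF insert(1,2)])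
  also have "\<dots> = (1 + g q) * (\<Sum>S\<in>Pow A. (\<Prod>q\<in>S. g q))"
    by (simp add: sum.distrib sum_distrib_left distrib_right)
  finally show ?case using insert by simp
qed auto

lemma sum_supersets:
  assumes "finite P" "E \<subseteq> P"
  shows "(\<Sum>S | E \<subseteq> S \<and> S \<subseteq> P. f S) = (\<Sum>B\<in>Pow (P - E). f (E \<union> B))"
proof (rule sum.reindex_bij_witness [of _ "\<lambda>B. E \<union> B" "\<lambda>S. S - E"])
qed (use assms in \<open>auto simp: Un_absorb1\<close>)

lemma prod_Un_disjoint':
  assumes "finite P" "E \<subseteq> P" "B \<in> Pow (P - E)"
  shows "(\<Prod>q\<in>E \<union> B. g q) = (\<Prod>q\<in>E. g q) * (\<Prod>q\<in>B. g q :: real)"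
  by (rule prod.union_disjoint) (use assms in \<open>auto intro: finite_subset\<close>)

lemma sum_prod_supersets:
  assumes "finite P" "E \<subseteq> P"
  shows "(\<Sum>S | E \<subseteq> S \<and> S \<subseteq> P. (\<Prod>q\<in>S. g q :: real)) = (\<Prod>q\<in>E. g q) * (\<Prod>q\<in>P - E. 1 + g q)"
proof -
  have fin: "finite (P - E)" using assms by auto
  show ?thesis unfolding sum_supersets [OF assms] prod_one_plus_Pow [OF fin] sum_distrib_left
    by (intro sum.cong refl prod_Un_disjoint' [OF assms])
qed

text \<open>A prime of \<open>P\<close> lies in \<open>A\<close> only, in \<open>B\<close> only, in both, or in neither: three of the four cases
contribute \<open>g q\<close>.\<close>

lemma sum_prod_union:
  assumes "finite P"
  shows "(\<Sum>A\<in>Pow P. \<Sum>B\<in>Pow P. (\<Prod>q\<in>A \<union> B. g q :: real)) = (\<Prod>q\<in>P. 1 + 3 * g q)"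
  using assms
proof (induction P rule: finite_induct)
  case (insert q P)
  have ins: "(\<Prod>x\<in>insert q (A \<union> B). g x) = g q * (\<Prod>x\<in>A \<union> B. g x)" if "A \<in> Pow P" "B \<in> Pow P" for A B
    by (rule prod_insert_Pow [OF insert(1,2)]) (use that in auto)
  have "(\<Sum>A\<in>Pow (insert q P). \<Sum>B\<in>Pow (insert q P). (\<Prod>q\<in>A \<union> B. g q))
     = (\<Sum>A\<in>Pow P. (\<Sum>B\<in>Pow P. (\<Prod>q\<in>A \<union> B. g q) + (\<Prod>q\<in>A \<union> insert q B. g q)) +
         (\<Sum>B\<in>Pow P. (\<Prod>q\<in>insert q A \<union> B. g q) + (\<Prod>q\<in>insert q A \<union> insert q B. g q)))"
    unfolding sum_Pow_insert [OF insert(1,2)] ..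
  also have "\<dots> = (\<Sum>A\<in>Pow P. \<Sum>B\<in>Pow P. (1 + 3 * g q) * (\<Prod>q\<in>A \<union> B. g q))"
    unfolding sum.distrib [symmetric]
  proof (intro sum.cong refl)
    fix A B assume AB: "A \<in> Pow P" "B \<in> Pow P"
    have "A \<union> insert q B = insert q (A \<union> B)" "insert q A \<union> B = insert q (A \<union> B)" "insert q A \<union> insert q B = insert q (A \<union> B)" by auto
    thus "(\<Prod>q\<in>A \<union> B. g q) + (\<Prod>q\<in>A \<union> insert q B. g q) + ((\<Prod>q\<in>insert q A \<union> B. g q) + (\<Prod>q\<in>insert q A \<union> insert q B. g q)) = (1 + 3 * g q) * (\<Prod>q\<in>A \<union> B. g q)"
      by (simp only: ins [OF AB]) (simp add: algebra_simps)
  qed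
  also have "\<dots> = (1 + 3 * g q) * (\<Sum>A\<in>Pow P. \<Sum>B\<in>Pow P. (\<Prod>q\<in>A \<union> B. g q))" by (simp add: sum_distrib_left)
  finally show ?case using insert by simp
qed auto

section \<open>Selberg diagonalisation\<close>

lemma sum_rotate:
  "(\<Sum>S\<in>X. \<Sum>A\<in>Y. \<Sum>B\<in>Z. f S A B) = (\<Sum>A\<in>Y. \<Sum>B\<in>Z. \<Sum>S\<in>X. f S A B)"
proof -
  have "(\<Sum>S\<in>X. \<Sum>A\<in>Y. \<Sum>B\<in>Z. f S A B) = (\<Sum>A\<in>Y. \<Sum>S\<in>X. \<Sum>B\<in>Z. f S A B)" by (rule sum.swap)
  also have "\<dots> = (\<Sum>A\<in>Y. \<Sum>B\<in>Z. \<Sum>S\<in>X. f S A B)" by (rule sum.cong [OF refl], rule sum.swap)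
  finally show ?thesis .
qed

lemma square_sum_if:
  "(\<Sum>A\<in>Pow P. if Q A then w A else 0)\<^sup>2 = (\<Sum>A\<in>Pow P. \<Sum>B\<in>Pow P. if Q A \<and> Q B then w A * w B else (0::real))"
  unfolding power2_eq_square sum_product by (intro sum.cong refl) auto

text \<open>The sum over \<open>S\<close> that contain a given union \<open>A \<union> B\<close> factorises.\<close>

lemma selberg_weights_sum:
  fixes k :: "nat \<Rightarrow> real"
  assumes P: "finite P" and k: "\<And>q. q \<in> P \<Longrightarrow> k q > 0"
  shows "(\<Sum>S\<in>Pow P. (\<Prod>q\<in>S. k q) * (\<Sum>A\<in>Pow P. if A \<subseteq> S then w A else 0)\<^sup>2)
    = (\<Prod>q\<in>P. 1 + k q) * (\<Sum>A\<in>Pow P. \<Sum>B\<in>Pow P. w A * w B * (\<Prod>q\<in>A \<union> B. k q / (1 + k q)))"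
proof -
  have "(\<Sum>S\<in>Pow P. (\<Prod>q\<in>S. k q) * (\<Sum>A\<in>Pow P. if A \<subseteq> S then w A else 0)\<^sup>2)
     = (\<Sum>S\<in>Pow P. \<Sum>A\<in>Pow P. \<Sum>B\<in>Pow P. (if A \<union> B \<subseteq> S then w A * w B * (\<Prod>q\<in>S. k q) else 0))"
    unfolding square_sum_if sum_distrib_left by (intro sum.cong refl) auto
  also have "\<dots> = (\<Sum>A\<in>Pow P. \<Sum>B\<in>Pow P. \<Sum>S\<in>Pow P. (if A \<union> B \<subseteq> S then w A * w B * (\<Prod>q\<in>S. k q) else 0))"
    by (rule sum_rotate)
  also have "\<dots> = (\<Sum>A\<in>Pow P. \<Sum>B\<in>Pow P. w A * w B * ((\<Prod>q\<in>P. 1 + k q) * (\<Prod>q\<in>A \<union> B. k q / (1 + k q))))"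
  proof (intro sum.cong refl)
    fix A B assume AB: "A \<in> Pow P" "B \<in> Pow P"
    define E where "E = A \<union> B"
    have E: "E \<subseteq> P" using AB by (auto simp: E_def)
    have "(\<Sum>S\<in>Pow P. (if E \<subseteq> S then w A * w B * (\<Prod>q\<in>S. k q) else 0)) = (\<Sum>S\<in>{S\<in>Pow P. E \<subseteq> S}. w A * w B * (\<Prod>q\<in>S. k q))"
      by (rule sum.inter_filter [symmetric]) (use P in simp)
    also have "{S\<in>Pow P. E \<subseteq> S} = {S. E \<subseteq> S \<and> S \<subseteq> P}" by auto
    also have "(\<Sum>S | E \<subseteq> S \<and> S \<subseteq> P. w A * w B * (\<Prod>q\<in>S. k q)) = w A * w B * ((\<Prod>q\<in>E. k q) * (\<Prod>q\<in>P - E. 1 + k q))"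
      unfolding sum_distrib_left [symmetric] sum_prod_supersets [OF P E] ..
    also have "(\<Prod>q\<in>E. k q) * (\<Prod>q\<in>P - E. 1 + k q) = (\<Prod>q\<in>P. 1 + k q) * (\<Prod>q\<in>E. k q / (1 + k q))"
    proof -
      have "(\<Prod>q\<in>P. 1 + k q) = (\<Prod>q\<in>P - E. 1 + k q) * (\<Prod>q\<in>E. 1 + k q)"
        by (rule prod.subset_diff [OF E P])
      moreover have "(\<Prod>q\<in>E. 1 + k q) \<noteq> 0"
      proof -
        have "(\<Prod>q\<in>E. 1 + k q) > 0" by (intro prod_pos ballI add_pos_pos zero_less_one k) (use E in auto)
        thus ?thesis by simp
      qed
      ultimately show ?thesis by (simp add: prod_dividef)
    qed
    finally show "(\<Sum>S\<in>Pow P. (if A \<union> B \<subseteq> S then w A * w B * (\<Prod>q\<in>S. k q) else 0)) = w A * w B * ((\<Prod>q\<in>P. 1 + k q) * (\<Prod>q\<in>A \<union> B. k q / (1 + k q)))"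
      by (simp add: E_def)
  qed
  also have "\<dots> = (\<Prod>q\<in>P. 1 + k q) * (\<Sum>A\<in>Pow P. \<Sum>B\<in>Pow P. w A * w B * (\<Prod>q\<in>A \<union> B. k q / (1 + k q)))"
    unfolding sum_distrib_left by (intro sum.cong refl) (simp add: mult_ac)
  finally show ?thesis .
qed

text \<open>For \<open>q \<in> A \<inter> B\<close> the factor \<open>r q\<close> is written as \<open>r q * r q * (1 + (1 - r q) / r q)\<close>; expanding the last
factor over \<open>A \<inter> B\<close> produces the sum over common subsets \<open>C\<close>.\<close>

lemma selberg_diagonalisation:
  fixes r :: "nat \<Rightarrow> real"
  assumes P: "finite P" and r: "\<And>q. q \<in> P \<Longrightarrow> r q > 0"
  shows "(\<Sum>A\<in>Pow P. \<Sum>B\<in>Pow P. w A * w B * (\<Prod>q\<in>A \<union> B. r q))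
     = (\<Sum>C\<in>Pow P. (\<Prod>q\<in>C. (1 - r q) / r q) * (\<Sum>A\<in>Pow P. if C \<subseteq> A then w A * (\<Prod>q\<in>A. r q) else 0)\<^sup>2)"
proof -
  define h where "h = (\<lambda>q. (1 - r q) / r q)"
  define v where "v = (\<lambda>A. w A * (\<Prod>q\<in>A. r q))"
  have "(\<Sum>C\<in>Pow P. (\<Prod>q\<in>C. h q) * (\<Sum>A\<in>Pow P. if C \<subseteq> A then v A else 0)\<^sup>2)
     = (\<Sum>C\<in>Pow P. \<Sum>A\<in>Pow P. \<Sum>B\<in>Pow P. (if C \<subseteq> A \<inter> B then v A * v B * (\<Prod>q\<in>C. h q) else 0))"
    unfolding square_sum_if sum_distrib_left by (intro sum.cong refl) auto
  also have "\<dots> = (\<Sum>A\<in>Pow P. \<Sum>B\<in>Pow P. \<Sum>C\<in>Pow P. (if C \<subseteq> A \<inter> B then v A * v B * (\<Prod>q\<in>C. h q) else 0))"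
    by (rule sum_rotate)
  also have "\<dots> = (\<Sum>A\<in>Pow P. \<Sum>B\<in>Pow P. w A * w B * (\<Prod>q\<in>A \<union> B. r q))"
  proof (intro sum.cong refl)
    fix A B assume AB: "A \<in> Pow P" "B \<in> Pow P"
    have fin: "finite A" "finite B" using AB P by (auto intro: finite_subset)
    have fin': "finite (A \<inter> B)" using fin by auto
    have "(\<Sum>C\<in>Pow P. (if C \<subseteq> A \<inter> B then v A * v B * (\<Prod>q\<in>C. h q) else 0)) = (\<Sum>C\<in>{C\<in>Pow P. C \<subseteq> A \<inter> B}. v A * v B * (\<Prod>q\<in>C. h q))"
      by (rule sum.inter_filter [symmetric]) (use P in simp)
    also have "{C\<in>Pow P. C \<subseteq> A \<inter> B} = Pow (A \<inter> B)" using AB by auto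
    also have "(\<Sum>C\<in>Pow (A \<inter> B). v A * v B * (\<Prod>q\<in>C. h q)) = v A * v B * (\<Prod>q\<in>A \<inter> B. 1 + h q)"
      unfolding sum_distrib_left [symmetric] prod_one_plus_Pow [OF fin', symmetric] ..
    also have "(\<Prod>q\<in>A \<inter> B. 1 + h q) = (\<Prod>q\<in>A \<inter> B. 1 / r q)"
      using r AB by (intro prod.cong refl) (fastforce simp: h_def field_simps)
    also have "v A * v B * (\<Prod>q\<in>A \<inter> B. 1 / r q) = w A * w B * (\<Prod>q\<in>A \<union> B. r q)"
    proof -
      have "(\<Prod>q\<in>A \<inter> B. r q) > 0" using r AB by (intro prod_pos) auto
      moreover have "(\<Prod>q\<in>A \<union> B. r q) * (\<Prod>q\<in>A \<inter> B. r q) = (\<Prod>q\<in>A. r q) * (\<Prod>q\<in>B. r q)"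
        by (rule prod.union_inter [OF fin])
      ultimately show ?thesis unfolding v_def by (simp add: prod_dividef field_simps)
    qed
    finally show "(\<Sum>C\<in>Pow P. (if C \<subseteq> A \<inter> B then v A * v B * (\<Prod>q\<in>C. h q) else 0)) = w A * w B * (\<Prod>q\<in>A \<union> B. r q)" .
  qed
  finally show ?thesis unfolding h_def v_def by (rule sym)
qed

section \<open>Numbers with a given set of prime factors\<close>

lemma tau_prime_power:
  assumes "prime q" "\<not> q dvd m" "m > 0"
  shows "tau (q ^ v * m) = (v + 1) * tau m"
proof (induction v rule: less_induct)
  case (less v)
  have q: "q > 0" using assms(1) prime_gt_0_nat by auto
  consider "v = 0" | "v = 1" | k where "v = Suc (Suc k)" by (metis One_nat_def not0_implies_Suc)
  thus ?case
  proof cases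
    case 2 thus ?thesis using tau_prime_mult [OF assms(1,3)] assms(2) by simp
  next
    case 3
    have "tau (q * (q ^ Suc k * m)) + tau (q ^ k * m) = 2 * tau (q ^ Suc k * m)"
      using tau_prime_mult [OF assms(1), of "q ^ Suc k * m"] q assms(3) by (simp add: mult.assoc)
    thus ?thesis using less [of "Suc k"] less [of k] 3 by (simp add: algebra_simps)
  qed simp
qed

text \<open>The sum of \<open>\<tau>(q\<^sup>v) / q\<^sup>v\<close> over \<open>v \<ge> 1\<close>.\<close>

definition kappa :: "nat \<Rightarrow> real" where "kappa q = 1 / (1 - 1 / real q)\<^sup>2 - 1"

lemma kappa_partial:
  assumes "q \<ge> 2"
  shows "(\<Sum>v=1..V. real (v + 1) / real q ^ v) \<le> kappa q"
proof -
  have s: "(\<lambda>n. of_nat (Suc n) * (1 / real q) ^ n) sums (1 / (1 - 1 / real q)\<^sup>2)"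
    by (rule geometric_deriv_sums) (use assms in simp)
  have "(\<Sum>v<Suc V. real (Suc v) * (1 / real q) ^ v) \<le> 1 / (1 - 1 / real q)\<^sup>2"
    using sum_le_suminf [OF sums_summable [OF s], of "{..<Suc V}"] sums_unique [OF s] by simp
  moreover have "{..<Suc V} = insert 0 {1..V}" by auto
  ultimately show ?thesis by (simp add: kappa_def divide_inverse power_inverse)
qed

lemma kappa_pos: "q \<ge> 2 \<Longrightarrow> kappa q > 0"
  using kappa_partial [of q 1] by (intro less_le_trans [OF _ kappa_partial [of q 1]]) auto

text \<open>The integers with set of prime factors \<open>S\<close> form an Euler product over \<open>S\<close>, which bounds every finite
subsum; induction on \<open>S\<close> splits off one prime power at a time.\<close>

lemma sum_tau_over_n_prime_set:
  assumes "finite S" "\<And>q. q \<in> S \<Longrightarrow> prime q" "finite X" "\<And>n. n \<in> X \<Longrightarrow> n > 0 \<and> prime_factors n = S"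
  shows "(\<Sum>n\<in>X. real (tau n) / real n) \<le> (\<Prod>q\<in>S. kappa q)"
  using assms
proof (induction S arbitrary: X rule: finite_induct)
  case empty
  have "X \<subseteq> {1}"
  proof
    fix n assume "n \<in> X"
    hence "n > 0" "prime_factors n = {}" using empty by auto
    thus "n \<in> {1}" by (simp add: prime_factorization_empty_iff)
  qed
  hence "(\<Sum>n\<in>X. real (tau n) / real n) \<le> (\<Sum>n\<in>{1}. real (tau n) / real n)" by (intro sum_mono2) auto
  thus ?case by (simp add: tau_def)
next
  case (insert q S)
  have q: "prime q" using insert by auto
  have q2: "q \<ge> 2" using q by (rule prime_ge_2_nat)
  define v where "v = (\<lambda>n. multiplicity q n)"
  define m where "m = (\<lambda>n. n div q ^ v n)"
  have dec: "n = q ^ v n * m n" "\<not> q dvd m n" "m n > 0" "v n \<ge> 1" "prime_factors (m n) = S" if n: "n \<in> X" for n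
  proof -
    have n0: "n > 0" "prime_factors n = insert q S" using insert n by auto
    show e: "n = q ^ v n * m n" by (simp add: m_def v_def multiplicity_dvd)
    show m0: "m n > 0" using e n0 by (metis gr0I mult_0_right)
    show nd: "\<not> q dvd m n"
      unfolding m_def v_def using n0 q by (intro multiplicity_decompose) auto
    have "q dvd n" using n0 by (metis in_prime_factors_iff insertI1)
    thus "v n \<ge> 1" unfolding v_def using n0 q by (simp add: prime_elem_multiplicity_eq_zero_iff Suc_le_eq prime_multiplicity_gt_zero_iff)
    show "prime_factors (m n) = S"
    proof (intro equalityI subsetI)
      fix p assume "p \<in> prime_factors (m n)"
      hence p: "prime p" "p dvd m n" by (auto simp: in_prime_factors_iff)
      hence "p dvd n" by (subst e) simp
      hence "p \<in> insert q S" using p n0 by (metis in_prime_factors_iff neq0_conv)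
      thus "p \<in> S" using p nd by auto
    next
      fix p assume pS: "p \<in> S"
      hence "p \<in> prime_factors n" using n0 by simp
      hence p: "prime p" "p dvd q ^ v n * m n" using e by (auto simp: in_prime_factors_iff)
      have "\<not> p dvd q ^ v n"
        using pS insert.hyps(2) p(1) q by (metis prime_dvd_power primes_dvd_imp_eq)
      hence "p dvd m n" using p by (simp add: prime_dvd_mult_iff)
      thus "p \<in> prime_factors (m n)" using p m0 by (simp add: in_prime_factors_iff)
    qed
  qed
  define V where "V = Max (insert 1 (v ` X))"
  have fX: "finite X" using insert by auto
  have inj: "inj_on (\<lambda>n. (v n, m n)) X" using dec(1) by (intro inj_onI) (metis prod.inject)
  define g where "g = (\<lambda>(k, l). (real (k + 1) / real q ^ k) * (real (tau l) / real l))"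
  have "(\<Sum>n\<in>X. real (tau n) / real n) = (\<Sum>n\<in>X. g (v n, m n))"
  proof (rule sum.cong [OF refl])
    fix n assume n: "n \<in> X"
    have "tau n = (v n + 1) * tau (m n)" using tau_prime_power [OF q dec(2,3) [OF n], of "v n"] dec(1) [OF n] by simp
    moreover have "real n = real q ^ v n * real (m n)" using dec(1) [OF n] by (metis of_nat_mult of_nat_power)
    ultimately show "real (tau n) / real n = g (v n, m n)" by (simp add: g_def distrib_right)
  qed
  also have "\<dots> = (\<Sum>p\<in>(\<lambda>n. (v n, m n)) ` X. g p)" by (simp only: sum.reindex [OF inj] o_def)
  also have "\<dots> \<le> (\<Sum>p\<in>{1..V} \<times> (m ` X). g p)"
  proof (rule sum_mono2)
    show "(\<lambda>n. (v n, m n)) ` X \<subseteq> {1..V} \<times> (m ` X)"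
      using dec(4) fX by (auto simp: V_def)
  qed (use fX in \<open>auto simp: g_def\<close>)
  also have "\<dots> = (\<Sum>k=1..V. real (k + 1) / real q ^ k) * (\<Sum>l\<in>m ` X. real (tau l) / real l)"
    by (simp add: g_def sum_product sum.cartesian_product)
  also have "\<dots> \<le> kappa q * (\<Prod>q\<in>S. kappa q)"
  proof (intro mult_mono kappa_partial q2)
    show "(\<Sum>l\<in>m ` X. real (tau l) / real l) \<le> (\<Prod>q\<in>S. kappa q)"
    proof (rule insert.IH)
      show "prime r" if "r \<in> S" for r using insert.prems(1) that by simp
      show "finite (m ` X)" using fX by simp
      show "l > 0 \<and> prime_factors l = S" if "l \<in> m ` X" for l using that dec(3,5) by auto
    qed
    show "0 \<le> kappa q" using kappa_pos [OF q2] by simp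
  qed (auto intro!: sum_nonneg)
  finally show ?case using insert by simp
qed

section \<open>Weighted divisor sums and their averages\<close>

definition sieve_val :: "nat set \<Rightarrow> (nat set \<Rightarrow> real) \<Rightarrow> nat \<Rightarrow> real" where
  "sieve_val P w n = (\<Sum>A\<in>Pow P. if \<forall>a\<in>A. a dvd n then w A else 0)"

definition sieve_sum :: "nat set \<Rightarrow> (nat set \<Rightarrow> real) \<Rightarrow> real \<Rightarrow> real" where
  "sieve_sum P w x = (\<Sum>n\<in>multiples {} x. real (tau n) * (sieve_val P w n)\<^sup>2)"

lemma sieve_sum_expand:
  "sieve_sum P w x = (\<Sum>A\<in>Pow P. \<Sum>B\<in>Pow P. w A * w B * tau_sum (A \<union> B) x)"
proof -
  have "sieve_sum P w x = (\<Sum>n\<in>multiples {} x. \<Sum>A\<in>Pow P. \<Sum>B\<in>Pow P. if \<forall>a\<in>A \<union> B. a dvd n then w A * w B * real (tau n) else 0)"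
    unfolding sieve_sum_def sieve_val_def square_sum_if sum_distrib_left by (intro sum.cong refl) auto
  also have "\<dots> = (\<Sum>A\<in>Pow P. \<Sum>B\<in>Pow P. \<Sum>n\<in>multiples {} x. if \<forall>a\<in>A \<union> B. a dvd n then w A * w B * real (tau n) else 0)"
    by (rule sum_rotate)
  also have "\<dots> = (\<Sum>A\<in>Pow P. \<Sum>B\<in>Pow P. w A * w B * tau_sum (A \<union> B) x)"
  proof (intro sum.cong refl)
    fix A B
    have "(\<Sum>n\<in>multiples {} x. if \<forall>a\<in>A \<union> B. a dvd n then w A * w B * real (tau n) else 0)
        = (\<Sum>n\<in>{n\<in>multiples {} x. \<forall>a\<in>A \<union> B. a dvd n}. w A * w B * real (tau n))"
      by (rule sum.inter_filter [symmetric]) simp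
    also have "{n\<in>multiples {} x. \<forall>a\<in>A \<union> B. a dvd n} = multiples (A \<union> B) x" by (auto simp: multiples_def)
    finally show "(\<Sum>n\<in>multiples {} x. if \<forall>a\<in>A \<union> B. a dvd n then w A * w B * real (tau n) else 0) = w A * w B * tau_sum (A \<union> B) x"
      by (simp add: tau_sum_def sum_distrib_left)
  qed
  finally show ?thesis .
qed

text \<open>Each product of two weights meets the sum of \<open>\<tau>\<close> over the multiples of one squarefree number. The blocks
\<open>(x, 4x]\<close> are disjoint for \<open>x = X, 4X, 16X, ...\<close>, so that their averages add up to a logarithmic sum
in \<open>sum_blocks_le\<close>.\<close>

lemma sieve_sum_asymptotic:
  assumes P: "finite P" "\<And>q. q \<in> P \<Longrightarrow> prime q"
  shows "\<exists>a b. \<forall>x>0. \<bar>(sieve_sum P w (4 * x) - sieve_sum P w x) - x * (a * ln x + b)\<bar> \<le>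
     3 * tau_const * (\<Sum>A\<in>Pow P. \<Sum>B\<in>Pow P. \<bar>w A\<bar> * \<bar>w B\<bar> * (\<Prod>q\<in>A \<union> B. 3 / sqrt (real q))) * sqrt x"
proof -
  have "\<forall>E\<in>Pow P. \<exists>a b. \<forall>x>0. \<bar>tau_sum E x - x * (a * ln x + b)\<bar> \<le> tau_const * (\<Prod>q\<in>E. 3 / sqrt (real q)) * sqrt x"
    using P by (auto intro!: tau_sum_asymptotic intro: finite_subset)
  then obtain a b where ab: "\<And>E x. E \<in> Pow P \<Longrightarrow> x > 0 \<Longrightarrow> \<bar>tau_sum E x - x * (a E * ln x + b E)\<bar> \<le> tau_const * (\<Prod>q\<in>E. 3 / sqrt (real q)) * sqrt x"
    by metis
  define W where "W = (\<lambda>A B. \<bar>w A\<bar> * \<bar>w B\<bar> * (\<Prod>q\<in>A \<union> B. 3 / sqrt (real q)))"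
  define a' where "a' = (\<Sum>A\<in>Pow P. \<Sum>B\<in>Pow P. w A * w B * (3 * a (A \<union> B)))"
  define b' where "b' = (\<Sum>A\<in>Pow P. \<Sum>B\<in>Pow P. w A * w B * (4 * (a (A \<union> B) * ln 4 + b (A \<union> B)) - b (A \<union> B)))"
  have "\<bar>(sieve_sum P w (4 * x) - sieve_sum P w x) - x * (a' * ln x + b')\<bar> \<le> 3 * tau_const * (\<Sum>A\<in>Pow P. \<Sum>B\<in>Pow P. W A B) * sqrt x" if x: "x > 0" for x
  proof -
    have eq: "(sieve_sum P w (4 * x) - sieve_sum P w x) - x * (a' * ln x + b') = (\<Sum>A\<in>Pow P. \<Sum>B\<in>Pow P. w A * w B *
      ((tau_sum (A \<union> B) (4 * x) - tau_sum (A \<union> B) x) - x * (3 * a (A \<union> B) * ln x + (4 * (a (A \<union> B) * ln 4 + b (A \<union> B)) - b (A \<union> B)))))"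
      unfolding sieve_sum_expand a'_def b'_def sum_distrib_left sum_distrib_right sum.distrib [symmetric] sum_subtractf [symmetric]
      by (intro sum.cong refl) (simp add: algebra_simps)
    have "\<bar>(sieve_sum P w (4 * x) - sieve_sum P w x) - x * (a' * ln x + b')\<bar> \<le> (\<Sum>A\<in>Pow P. \<Sum>B\<in>Pow P. \<bar>w A * w B *
      ((tau_sum (A \<union> B) (4 * x) - tau_sum (A \<union> B) x) - x * (3 * a (A \<union> B) * ln x + (4 * (a (A \<union> B) * ln 4 + b (A \<union> B)) - b (A \<union> B))))\<bar>)"
      unfolding eq by (rule order_trans [OF sum_abs sum_mono [OF sum_abs]])
    also have "\<dots> \<le> (\<Sum>A\<in>Pow P. \<Sum>B\<in>Pow P. W A B * (3 * tau_const * sqrt x))"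
    proof (rule sum_mono, rule sum_mono)
      fix A B assume AB: "A \<in> Pow P" "B \<in> Pow P"
      define E where "E = A \<union> B"
      have E: "E \<in> Pow P" using AB unfolding E_def by blast
      define t where "t = tau_const * (\<Prod>q\<in>E. 3 / sqrt (real q)) * sqrt x"
      have l4: "ln (4 * x) = ln 4 + ln x" using x by (simp add: ln_mult)
      have "\<bar>tau_sum E (4 * x) - (4 * x) * (a E * (ln 4 + ln x) + b E)\<bar> \<le> 2 * t"
        using ab [OF E, of "4 * x"] x unfolding l4 by (simp add: t_def real_sqrt_mult)
      moreover have "\<bar>tau_sum E x - x * (a E * ln x + b E)\<bar> \<le> t" using ab [OF E x] by (simp add: t_def)
      moreover have "x * (3 * a E * ln x + (4 * (a E * ln 4 + b E) - b E)) = (4 * x) * (a E * (ln 4 + ln x) + b E) - x * (a E * ln x + b E)"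
        by (simp add: algebra_simps)
      ultimately have "\<bar>(tau_sum E (4 * x) - tau_sum E x) - x * (3 * a E * ln x + (4 * (a E * ln 4 + b E) - b E))\<bar> \<le> 3 * t" by linarith
      hence "\<bar>w A * w B\<bar> * \<bar>(tau_sum E (4 * x) - tau_sum E x) - x * (3 * a E * ln x + (4 * (a E * ln 4 + b E) - b E))\<bar> \<le> \<bar>w A * w B\<bar> * (3 * t)"
        by (intro mult_left_mono) auto
      thus "\<bar>w A * w B * ((tau_sum (A \<union> B) (4 * x) - tau_sum (A \<union> B) x) - x * (3 * a (A \<union> B) * ln x + (4 * (a (A \<union> B) * ln 4 + b (A \<union> B)) - b (A \<union> B))))\<bar> \<le> W A B * (3 * tau_const * sqrt x)"
        unfolding E_def [symmetric] abs_mult [of "w A * w B"] by (simp add: W_def t_def E_def abs_mult mult_ac)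
    qed
    also have "\<dots> = 3 * tau_const * (\<Sum>A\<in>Pow P. \<Sum>B\<in>Pow P. W A B) * sqrt x"
      by (simp add: sum_distrib_left sum_distrib_right mult_ac)
    finally show ?thesis .
  qed
  thus ?thesis unfolding W_def by blast
qed

text \<open>\<open>G(4^j X) / (4^j X)\<close> is within \<open>K / sqrt X\<close> of a linear function of \<open>j\<close>. The average of a linear function is the
mean of its end values, and the last value is not much below \<open>0\<close>. Hence the first is at most twice the
average, up to error terms, whatever \<open>a\<close> and \<open>b\<close> are.\<close>

lemma linear_average:
  fixes G :: "real \<Rightarrow> real"
  assumes nonneg: "\<And>x. x > 0 \<Longrightarrow> G x \<ge> 0"
    and lin: "\<And>x. x > 0 \<Longrightarrow> \<bar>G x - x * (a * ln x + b)\<bar> \<le> K * sqrt x" and X: "X > 0"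
  shows "G X / X \<le> 2 / real (J + 1) * (\<Sum>j\<le>J. G (4 ^ j * X) / (4 ^ j * X)) + 4 * K / sqrt X"
proof -
  define \<phi> where "\<phi> = (\<lambda>j::nat. G (4 ^ j * X) / (4 ^ j * X))"
  define l where "l = (\<lambda>j::nat. (a * ln X + b) + real j * (a * ln 4))"
  define e where "e = K / sqrt X"
  have K: "K \<ge> 0" using order_trans [OF abs_ge_zero lin [OF X]] X by (simp add: zero_le_mult_iff)
  have near: "\<bar>\<phi> j - l j\<bar> \<le> e" for j
  proof -
    define y where "y = 4 ^ j * X"
    have y: "y > 0" "y \<ge> X" using X by (auto simp: y_def)
    have ly: "a * ln y + b = l j" using X by (simp add: y_def l_def ln_mult ln_realpow algebra_simps)
    have "\<phi> j - l j = (G y - y * l j) / y" 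
    proof -
      have "\<phi> j = G y / y" by (simp add: \<phi>_def y_def)
      thus ?thesis using y by (simp add: diff_divide_distrib)
    qed
    hence "\<bar>\<phi> j - l j\<bar> = \<bar>G y - y * l j\<bar> / y" using y by simp
    also have "\<dots> \<le> (K * sqrt y) / y" using lin [OF y(1)] y unfolding ly by (intro divide_right_mono) auto
    also have "\<dots> = K / sqrt y"
    proof -
      have "sqrt y / y = inverse (sqrt y)" using y by (simp add: sqrt_divide_self_eq)
      hence "K * (sqrt y / y) = K / sqrt y" by (simp add: divide_inverse)
      thus ?thesis by simp
    qed
    also have "\<dots> \<le> e" unfolding e_def using K X y by (intro divide_left_mono) auto
    finally show ?thesis .
  qed
  have pos: "\<phi> j \<ge> 0" for j using nonneg [of "4 ^ j * X"] X by (simp add: \<phi>_def)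
  have "(\<Sum>j\<le>J. l j) = real (J + 1) * (l 0 + l J) / 2"
    by (induction J) (auto simp: l_def algebra_simps add_divide_distrib)
  moreover have "(\<Sum>j\<le>J. l j) \<le> (\<Sum>j\<le>J. \<phi> j + e)" using near by (intro sum_mono) (auto simp: abs_le_iff algebra_simps)
  ultimately have "real (J + 1) * (l 0 + l J) / 2 \<le> (\<Sum>j\<le>J. \<phi> j) + real (J + 1) * e"
    by (simp add: sum.distrib)
  moreover have "\<phi> 0 - 2 * e \<le> l 0 + l J" using near [of 0] near [of J] pos [of J] by linarith
  hence "real (J + 1) * (\<phi> 0 - 2 * e) / 2 \<le> real (J + 1) * (l 0 + l J) / 2"
    by (intro divide_right_mono mult_left_mono) auto
  ultimately have "real (J + 1) * (\<phi> 0 - 4 * e) \<le> 2 * (\<Sum>j\<le>J. \<phi> j)" by (simp add: algebra_simps)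
  hence "\<phi> 0 - 4 * e \<le> 2 * (\<Sum>j\<le>J. \<phi> j) / real (J + 1)" by (simp add: le_divide_eq mult.commute)
  thus ?thesis by (simp add: \<phi>_def e_def)
qed

section \<open>Logarithmic averages\<close>

definition sieve_logsum :: "nat set \<Rightarrow> (nat set \<Rightarrow> real) \<Rightarrow> real \<Rightarrow> real" where
  "sieve_logsum P w x = (\<Sum>n\<in>multiples {} x. real (tau n) * (sieve_val P w n)\<^sup>2 / real n)"

lemma sieve_sum_mono: 
  assumes "x \<le> y" shows "sieve_sum P w x \<le> sieve_sum P w y"
  unfolding sieve_sum_def by (rule sum_mono2 [OF finite_multiples]) (use assms in \<open>auto simp: multiples_def\<close>)

lemma sieve_sum_block_le:
  assumes y: "y > 0"
  shows "(sieve_sum P w (4 * y) - sieve_sum P w y) / y \<le> 4 * (sieve_logsum P w (4 * y) - sieve_logsum P w y)"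
proof -
  define D where "D = multiples {} (4 * y) - multiples {} y"
  have sub: "multiples {} y \<subseteq> multiples {} (4 * y)" using y by (auto simp: multiples_def)
  have F: "sieve_sum P w (4 * y) - sieve_sum P w y = (\<Sum>n\<in>D. real (tau n) * (sieve_val P w n)\<^sup>2)"
    unfolding sieve_sum_def D_def by (rule sum_diff [OF finite_multiples sub, symmetric])
  have H: "sieve_logsum P w (4 * y) - sieve_logsum P w y = (\<Sum>n\<in>D. real (tau n) * (sieve_val P w n)\<^sup>2 / real n)"
    unfolding sieve_logsum_def D_def by (rule sum_diff [OF finite_multiples sub, symmetric])
  show ?thesis unfolding F H sum_divide_distrib sum_distrib_left
  proof (rule sum_mono)
    fix n assume "n \<in> D"
    hence n: "real n \<le> 4 * y" "real n > 0" by (auto simp: D_def multiples_def)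
    have "1 / y \<le> 4 / real n" using n y by (simp add: field_simps)
    hence "real (tau n) * (sieve_val P w n)\<^sup>2 * (1 / y) \<le> real (tau n) * (sieve_val P w n)\<^sup>2 * (4 / real n)"
      by (intro mult_left_mono) auto
    thus "real (tau n) * (sieve_val P w n)\<^sup>2 / y \<le> 4 * (real (tau n) * (sieve_val P w n)\<^sup>2 / real n)" by (simp add: mult_ac)
  qed
qed

lemma sieve_logsum_nonneg: "sieve_logsum P w x \<ge> 0"
  unfolding sieve_logsum_def by (rule sum_nonneg) auto

text \<open>On each block \<open>1/y\<close> is at most \<open>4/n\<close>, and consecutive blocks are adjacent, so that the sum telescopes.\<close>

lemma sum_blocks_le:
  assumes X: "X > 0"
  shows "(\<Sum>j\<le>J. (sieve_sum P w (4 * (4 ^ j * X)) - sieve_sum P w (4 ^ j * X)) / (4 ^ j * X)) \<le> 4 * sieve_logsum P w (4 ^ (J + 1) * X)"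
proof -
  have "(\<Sum>j\<le>J. (sieve_sum P w (4 * (4 ^ j * X)) - sieve_sum P w (4 ^ j * X)) / (4 ^ j * X)) \<le> 4 * (sieve_logsum P w (4 ^ (J + 1) * X) - sieve_logsum P w X)"
  proof (induction J)
    case 0 thus ?case using sieve_sum_block_le [OF X, of P w] by simp
  next
    case (Suc J)
    have "(sieve_sum P w (4 * (4 ^ Suc J * X)) - sieve_sum P w (4 ^ Suc J * X)) / (4 ^ Suc J * X) \<le> 4 * (sieve_logsum P w (4 * (4 ^ Suc J * X)) - sieve_logsum P w (4 ^ Suc J * X))"
      by (rule sieve_sum_block_le) (use X in simp)
    thus ?case using Suc by (simp add: mult.assoc)
  qed
  thus ?thesis using sieve_logsum_nonneg [of P w X] by simp
qed

lemma sieve_val_prime_factors: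
  assumes "n > 0" "\<And>q. q \<in> P \<Longrightarrow> prime q"
  shows "sieve_val P w n = (\<Sum>A\<in>Pow P. if A \<subseteq> prime_factors n then w A else 0)"
  unfolding sieve_val_def
proof (rule sum.cong [OF refl])
  fix A assume "A \<in> Pow P"
  hence "(\<forall>a\<in>A. a dvd n) = (A \<subseteq> prime_factors n)" using assms by (auto simp: in_prime_factors_iff)
  thus "(if \<forall>a\<in>A. a dvd n then w A else 0) = (if A \<subseteq> prime_factors n then w A else 0)" by simp
qed

lemma rho_kappa: "q \<ge> 2 \<Longrightarrow> kappa q / (1 + kappa q) = rho q"
proof -
  assume q: "q \<ge> 2"
  define u where "u = 1 - 1 / real q"
  have u: "u \<noteq> 0" "rho q = 1 - u\<^sup>2" using q by (simp_all add: u_def rho_def power2_eq_square field_simps)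
  have "kappa q / (1 + kappa q) = (1 / u\<^sup>2 - 1) / (1 / u\<^sup>2)" by (simp add: kappa_def u_def)
  also have "\<dots> = 1 - u\<^sup>2" using u by (simp add: field_simps)
  finally show ?thesis using u by simp
qed

lemma rho_bounds: "q \<ge> 2 \<Longrightarrow> 0 < rho q \<and> rho q < 1 \<and> rho q \<le> 2 / real q"
proof -
  assume q: "q \<ge> 2"
  have "1 - rho q = (1 - 1 / real q)\<^sup>2" using q by (simp add: rho_def power2_eq_square field_simps)
  moreover have "(1 - 1 / real q)\<^sup>2 > 0" using q by simp
  moreover have "(1 - 1 / real q)\<^sup>2 < 1"
  proof -
    have "(1 - 1 / real q) * (1 - 1 / real q) < 1 * 1" using q by (intro mult_strict_mono) auto
    thus ?thesis by (simp add: power2_eq_square)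
  qed
  moreover have "rho q \<le> 2 / real q" by (simp add: rho_def)
  ultimately show ?thesis by (intro conjI) linarith+
qed

text \<open>\<open>sieve_val\<close> depends only on the set of prime factors of \<open>n\<close>. The sum of \<open>\<tau>(n)/n\<close> over all \<open>n\<close> with that set is
at most a product of \<open>kappa\<close>, and \<open>kappa / (1 + kappa) = \<rho>\<close>.\<close>

lemma sieve_logsum_le_selberg:
  assumes "x \<le> real N"
  shows "sieve_logsum (primes_upto N) w x \<le> (\<Prod>q\<in>primes_upto N. 1 + kappa q) * (\<Sum>A\<in>Pow (primes_upto N). \<Sum>B\<in>Pow (primes_upto N). w A * w B * (\<Prod>q\<in>A \<union> B. rho q))"
proof -
  define P where "P = primes_upto N"
  have P: "finite P" "\<And>q. q \<in> P \<Longrightarrow> prime q" "\<And>q. q \<in> P \<Longrightarrow> q \<ge> 2" by (auto simp: P_def primes_upto_def prime_ge_2_nat)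
  have pf: "prime_factors n \<in> Pow P" "n > 0" if n: "n \<in> multiples {} x" for n
  proof -
    show n0: "n > 0" using n by (auto simp: multiples_def)
    have "n \<le> N" using n assms by (auto simp: multiples_def)
    show "prime_factors n \<in> Pow P"
    proof
      show "prime_factors n \<subseteq> P"
      proof
        fix p assume "p \<in> prime_factors n"
        hence p: "prime p" "p dvd n" by (auto simp: in_prime_factors_iff)
        have "p \<le> N" using dvd_imp_le [OF p(2) n0] \<open>n \<le> N\<close> by simp
        thus "p \<in> P" using p by (simp add: P_def primes_upto_def)
      qed
    qed
  qed
  define l where "l = (\<lambda>S. \<Sum>A\<in>Pow P. if A \<subseteq> S then w A else 0)"
  have "sieve_logsum P w x = (\<Sum>S\<in>Pow P. \<Sum>n\<in>{n \<in> multiples {} x. prime_factors n = S}. real (tau n) * (sieve_val P w n)\<^sup>2 / real n)"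
    unfolding sieve_logsum_def by (rule sum.group [symmetric]) (use P pf in auto)
  also have "\<dots> = (\<Sum>S\<in>Pow P. (\<Sum>n\<in>{n \<in> multiples {} x. prime_factors n = S}. real (tau n) / real n) * (l S)\<^sup>2)"
    unfolding sum_distrib_right
    by (intro sum.cong refl) (use pf P in \<open>auto simp: sieve_val_prime_factors l_def\<close>)
  also have "\<dots> \<le> (\<Sum>S\<in>Pow P. (\<Prod>q\<in>S. kappa q) * (l S)\<^sup>2)"
  proof (rule sum_mono, rule mult_right_mono)
    fix S assume S: "S \<in> Pow P"
    show "(\<Sum>n\<in>{n \<in> multiples {} x. prime_factors n = S}. real (tau n) / real n) \<le> (\<Prod>q\<in>S. kappa q)"
    proof (rule sum_tau_over_n_prime_set)
      show "finite S" using S P(1) finite_subset by auto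
      show "prime q" if "q \<in> S" for q using S P(2) that by auto
      show "n > 0 \<and> prime_factors n = S" if "n \<in> {n \<in> multiples {} x. prime_factors n = S}" for n using that pf(2) by auto
    qed simp
  qed auto
  also have "\<dots> = (\<Prod>q\<in>P. 1 + kappa q) * (\<Sum>A\<in>Pow P. \<Sum>B\<in>Pow P. w A * w B * (\<Prod>q\<in>A \<union> B. kappa q / (1 + kappa q)))"
    unfolding l_def by (rule selberg_weights_sum) (use P kappa_pos in auto)
  also have "(\<Sum>A\<in>Pow P. \<Sum>B\<in>Pow P. w A * w B * (\<Prod>q\<in>A \<union> B. kappa q / (1 + kappa q))) = (\<Sum>A\<in>Pow P. \<Sum>B\<in>Pow P. w A * w B * (\<Prod>q\<in>A \<union> B. rho q))"
  proof (intro sum.cong refl)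
    fix A B assume AB: "A \<in> Pow P" "B \<in> Pow P"
    have "(\<Prod>q\<in>A \<union> B. kappa q / (1 + kappa q)) = (\<Prod>q\<in>A \<union> B. rho q)"
      by (rule prod.cong [OF refl], rule rho_kappa, rule P(3)) (use AB in auto)
    thus "w A * w B * (\<Prod>q\<in>A \<union> B. kappa q / (1 + kappa q)) = w A * w B * (\<Prod>q\<in>A \<union> B. rho q)" by simp
  qed
  finally show ?thesis by (simp add: P_def)
qed

section \<open>An upper bound of Mertens type\<close>

definition euler_real :: "nat \<Rightarrow> real \<Rightarrow> real" where "euler_real N s = (\<Prod>q\<in>primes_upto N. 1 - real q powr (- s))"

lemma euler_real_factor:
  assumes "s \<ge> 1" "q \<ge> 2" shows "0 < 1 - real q powr (- s)" "1 - real q powr (- s) \<le> 1"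
  using assms powr_less_one [of "real q" "- s"] by auto

lemma primes_upto_ge_2: "q \<in> primes_upto N \<Longrightarrow> q \<ge> 2" by (simp add: primes_upto_def prime_ge_2_nat)

lemma euler_real_pos: "s \<ge> 1 \<Longrightarrow> euler_real N s > 0"
  unfolding euler_real_def by (rule prod_pos) (use euler_real_factor primes_upto_ge_2 in blast)

lemma euler_prod_of_real: "euler_prod N (of_real s) = of_real (euler_real N s)"
  unfolding euler_prod_def euler_real_def primes_upto_def [symmetric] of_real_prod
proof (rule prod.cong [OF refl])
  fix q assume "q \<in> primes_upto N"
  hence "real q > 0" using primes_upto_pos by simp
  thus "1 - npow (real q) (of_real s) = of_real (1 - real q powr (- s))"
    by (simp add: npow_def powr_def flip: exp_of_real)
qed

lemma euler_real_tendsto: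
  assumes "s > 1" shows "(\<lambda>N. euler_real N s) \<longlonglongrightarrow> 1 / norm (zeta (of_real s))"
proof -
  have "(\<lambda>N. norm (euler_prod N (of_real s))) \<longlonglongrightarrow> norm (1 / zeta (of_real s))"
    by (intro tendsto_norm euler_prod_tendsto) (use assms in simp)
  moreover have "norm (euler_prod N (of_real s)) = euler_real N s" for N
    unfolding euler_prod_of_real using euler_real_pos [of s N] assms by simp
  ultimately show ?thesis by (simp add: norm_divide)
qed

lemma prod_primes_incseq:
  assumes f: "\<And>q. q \<ge> 2 \<Longrightarrow> f q \<ge> (1::real)"
  shows "incseq (\<lambda>N. \<Prod>q\<in>primes_upto N. f q)"
  unfolding incseq_def
proof (intro allI impI)
  fix M N :: nat assume "M \<le> N"
  hence sub: "primes_upto M \<subseteq> primes_upto N" by (auto simp: primes_upto_def)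
  have "(\<Prod>q\<in>primes_upto N. f q) = (\<Prod>q\<in>primes_upto N - primes_upto M. f q) * (\<Prod>q\<in>primes_upto M. f q)" by (rule prod.subset_diff [OF sub finite_primes_upto])
  moreover have "(\<Prod>q\<in>primes_upto N - primes_upto M. f q) \<ge> 1" by (rule prod_ge_1) (use f primes_upto_ge_2 in blast)
  moreover have "(\<Prod>q\<in>primes_upto M. f q) \<ge> 0" by (rule prod_nonneg) (meson primes_upto_ge_2 f order_trans zero_le_one)
  ultimately show "(\<Prod>q\<in>primes_upto M. f q) \<le> (\<Prod>q\<in>primes_upto N. f q)" using mult_right_mono [of 1 "\<Prod>q\<in>primes_upto N - primes_upto M. f q" "\<Prod>q\<in>primes_upto M. f q"] by simp
qed

lemma zeta_real_bounds:
  assumes "0 < s" "s \<le> 1/8"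
  shows "norm (zeta (of_real (1 + s))) \<le> 5 / s" "norm (zeta (of_real (1 + s))) \<ge> 1 / (2 * s)"
proof -
  have "zeta (of_real (1 + s)) = of_real (1 / s) + zeta_reg (of_real (1 + s))"
    using zeta_eq [of "of_real (1 + s)"] assms by simp
  moreover have "norm (zeta_reg (of_real (1 + s))) \<le> 2 * norm (of_real (1 + s) :: complex)"
    by (rule norm_zeta_reg_le_linear) (use assms in \<open>auto simp: complex_eq_iff\<close>)
  moreover have "norm (of_real (1 + s) :: complex) = 1 + s" "norm (of_real (1 / s) :: complex) = 1 / s"
    using assms by (simp_all only: norm_of_real abs_of_pos zero_less_divide_1_iff add_pos_pos zero_less_one)
  ultimately have "norm (zeta (of_real (1 + s))) \<le> 1 / s + (2 + 2 * s) \<and> norm (zeta (of_real (1 + s))) \<ge> 1 / s - (2 + 2 * s)"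
    using norm_triangle_ineq [of "of_real (1 / s)" "zeta_reg (of_real (1 + s))"] norm_diff_ineq [of "of_real (1 / s)" "zeta_reg (of_real (1 + s))"] by auto
  hence b: "norm (zeta (of_real (1 + s))) \<le> i + (2 + 2 * s)" "i - (2 + 2 * s) \<le> norm (zeta (of_real (1 + s)))" if "i = 1 / s" for i
    using that by simp_all
  define i where "i = 1 / s"
  have "8 \<le> i" using assms by (simp add: i_def field_simps)
  hence "n \<le> 5 * i \<and> i / 2 \<le> n" if "n \<le> i + (2 + 2 * s)" "i - (2 + 2 * s) \<le> n" for n :: real
    using that assms(2) by (intro conjI) linarith+
  from this [OF b [OF i_def]] show "norm (zeta (of_real (1 + s))) \<le> 5 / s" "norm (zeta (of_real (1 + s))) \<ge> 1 / (2 * s)"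
    by (simp_all add: i_def)
qed

text \<open>With \<open>s\<close> of size \<open>1 / log N\<close>, the product over \<open>q \<le> N\<close> is compared with \<open>\<zeta>(1 + s) = O(log N)\<close>. The quotient
of the two Euler products is bounded by a power of \<open>\<zeta>(1 + s) / \<zeta>(1 + 2s)\<close>, which is \<open>O(1)\<close>
and whose factor at \<open>q\<close> is about \<open>1 + q\<^sup>-\<^sup>1\<^sup>-\<^sup>s (1 - q\<^sup>-\<^sup>s)\<close>.\<close>

lemma mertens_upper:
  assumes N: "N \<ge> 3"
  shows "(\<Prod>q\<in>primes_upto N. 1 / (1 - 1 / real q)) \<le> 20 ^ 4 * 80 * ln (real N)"
proof -
  have lN: "ln (real N) \<ge> 1"
  proof -
    have "exp 1 \<le> real N" using exp_le N by linarith
    thus ?thesis using N by (subst ln_ge_iff) auto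
  qed
  define s where "s = 1 / (16 * ln (real N))"
  have s: "0 < s" "s \<le> 1/16" using lN by (auto simp: s_def field_simps)
  (* x q is the excess over 1 of the factor at q of the ratio f, to first order. *)
  define x where "x = (\<lambda>q::nat. real q powr (- (1 + s)) * (1 - real q powr (- s)))"
  have x0: "x q \<ge> 0" if "q \<ge> 2" for q
    using that s powr_le_one_le [of "real q"] powr_less_one [of "real q" "- s"] by (auto simp: x_def)
  define f where "f = (\<lambda>q::nat. (1 - real q powr (- (1 + 2 * s))) / (1 - real q powr (- (1 + s))))"
  have fx: "1 + x q \<le> f q" if q: "q \<ge> 2" for q
  proof -
    define y where "y = 1 - real q powr (- (1 + s))"
    have y: "0 < y" "y \<le> 1" using euler_real_factor [of "1 + s" q] q s by (auto simp: y_def)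
    have "real q powr (- (1 + 2 * s)) = real q powr (- (1 + s)) * real q powr (- s)"
      using q by (simp add: powr_add [symmetric] algebra_simps)
    hence "f q = (y + x q) / y" by (simp add: f_def y_def x_def algebra_simps)
    hence "f q = 1 + x q / y" using y by (simp add: field_simps)
    moreover have "x q \<le> x q / y" using y x0 [OF q] by (simp add: le_divide_eq mult_left_le)
    ultimately show ?thesis by simp
  qed
  have fratio: "(\<Prod>q\<in>primes_upto M. f q) = euler_real M (1 + 2 * s) / euler_real M (1 + s)" for M
    by (simp add: f_def euler_real_def prod_dividef)
  have "(\<Prod>q\<in>primes_upto N. f q) \<le> (1 / norm (zeta (of_real (1 + 2 * s)))) / (1 / norm (zeta (of_real (1 + s))))"
  proof (rule incseq_le)
    show "incseq (\<lambda>M. \<Prod>q\<in>primes_upto M. f q)"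
    proof (rule prod_primes_incseq)
      show "f q \<ge> 1" if "q \<ge> 2" for q using fx [OF that] x0 [OF that] by linarith
    qed
    show "(\<lambda>M. \<Prod>q\<in>primes_upto M. f q) \<longlonglongrightarrow> (1 / norm (zeta (of_real (1 + 2 * s)))) / (1 / norm (zeta (of_real (1 + s))))"
      unfolding fratio by (intro tendsto_divide euler_real_tendsto) (use s zeta_nonzero [of "of_real (1 + s)"] in auto)
  qed
  also have "\<dots> = norm (zeta (of_real (1 + s))) * (1 / norm (zeta (of_real (1 + 2 * s))))" by simp
  also have "\<dots> \<le> (5 / s) * (1 / (1 / (2 * (2 * s))))"
    using zeta_real_bounds [of s] zeta_real_bounds [of "2 * s"] s by (intro mult_mono frac_le) auto
  also have "\<dots> = 20" using s by simp
  finally have f20: "(\<Prod>q\<in>primes_upto N. f q) \<le> 20" .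
  have "(\<Prod>q\<in>primes_upto N. (1 + x q)) \<le> (\<Prod>q\<in>primes_upto N. f q)"
  proof (rule prod_mono)
    fix q assume "q \<in> primes_upto N"
    hence q: "q \<ge> 2" by (rule primes_upto_ge_2)
    show "0 \<le> 1 + x q \<and> 1 + x q \<le> f q" using fx [OF q] x0 [OF q] by linarith
  qed
  hence x20: "(\<Prod>q\<in>primes_upto N. (1 + x q)) \<le> 20" using f20 by linarith
  have xp: "(\<Prod>q\<in>primes_upto N. (1 + x q)) \<ge> 0"
    by (rule prod_nonneg) (intro add_nonneg_nonneg zero_le_one x0 primes_upto_ge_2)
  (* The change of exponent from 1 to 1 + s costs at most the fourth power of 1 + x q, as q powr s is at most 2. *)
  have key: "1 / (1 - 1 / real q) \<le> (1 + x q) ^ 4 * (1 / (1 - real q powr (- (1 + s))))" if q: "q \<in> primes_upto N" for q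
  proof -
    have q2: "q \<ge> 2" "q \<le> N" using q primes_upto_ge_2 by (auto simp: primes_upto_def)
    define y where "y = 1 - real q powr (- (1 + s))"
    have y: "0 < y" "y \<le> 1" using euler_real_factor [of "1 + s" q] q2 s by (auto simp: y_def)
    have iq: "1 - 1 / real q \<ge> 1/2" using q2 by (simp add: field_simps)
    have "real q powr s \<le> real N powr s" using q2 s by (intro powr_mono2) auto
    also have "\<dots> = exp (1/16)" using N lN by (simp add: powr_def s_def)
    also have "\<dots> \<le> exp (ln 2)" using ln2_ge_two_thirds by (subst exp_le_cancel_iff) linarith
    finally have qs: "real q powr s \<le> 2" by simp
    have "y - (1 - 1 / real q) = real q powr s * x q"
    proof -
      have "real q powr s * (real q powr (- (1 + s)) * (1 - real q powr (- s))) = real q powr (s - (1 + s)) - real q powr (s - (1 + s) - s)"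
        by (simp add: right_diff_distrib powr_add [symmetric] powr_diff mult.assoc [symmetric])
      also have "s - (1 + s) = -1" by simp
      also have "-1 - s = - (1 + s)" by simp
      finally show ?thesis using q2 by (simp add: x_def y_def powr_minus_divide)
    qed
    also have "\<dots> \<le> 2 * x q" using qs x0 [OF q2(1)] by (intro mult_right_mono)
    also have "\<dots> \<le> (4 * x q) * (1 - 1 / real q)" using iq x0 [OF q2(1)] mult_left_mono [OF iq, of "4 * x q"] by simp
    finally have "y \<le> (1 + 4 * x q) * (1 - 1 / real q)" by (simp add: algebra_simps)
    also have "\<dots> \<le> (1 + x q) ^ 4 * (1 - 1 / real q)"
      using Bernoulli_inequality [of "x q" 4] x0 [OF q2(1)] iq by (intro mult_right_mono) auto
    finally show ?thesis using y iq unfolding y_def [symmetric] by (simp add: field_simps)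
  qed
  have "(\<Prod>q\<in>primes_upto N. 1 / (1 - 1 / real q)) \<le> (\<Prod>q\<in>primes_upto N. (1 + x q) ^ 4 * (1 / (1 - real q powr (- (1 + s)))))"
  proof (rule prod_mono)
    fix q assume q: "q \<in> primes_upto N"
    have "1 / real q \<le> 1" using primes_upto_ge_2 [OF q] by simp
    thus "0 \<le> 1 / (1 - 1 / real q) \<and> 1 / (1 - 1 / real q) \<le> (1 + x q) ^ 4 * (1 / (1 - real q powr (- (1 + s))))"
      using key [OF q] by simp
  qed
  also have "\<dots> = (\<Prod>q\<in>primes_upto N. (1 + x q)) ^ 4 * (1 / euler_real N (1 + s))"
    by (simp add: prod.distrib prod_power_distrib prod_dividef euler_real_def)
  also have "\<dots> \<le> 20 ^ 4 * (5 / s)"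
  proof (intro mult_mono power_mono x20 xp)
    have "1 / euler_real N (1 + s) \<le> norm (zeta (of_real (1 + s)))"
    proof (rule LIMSEQ_le_const)
      show "(\<lambda>M. 1 / euler_real M (1 + s)) \<longlonglongrightarrow> norm (zeta (of_real (1 + s)))"
        using tendsto_divide [OF tendsto_const [of 1] euler_real_tendsto [of "1 + s"]] s zeta_nonzero [of "of_real (1 + s)"] by simp
      show "\<exists>M. \<forall>n\<ge>M. 1 / euler_real N (1 + s) \<le> 1 / euler_real n (1 + s)"
      proof (intro exI allI impI)
        fix n assume "n \<ge> N"
        have "incseq (\<lambda>M. \<Prod>q\<in>primes_upto M. 1 / (1 - real q powr (- (1 + s))))"
          by (rule prod_primes_incseq) (use euler_real_factor [of "1 + s"] s in \<open>simp add: le_divide_eq\<close>)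
        from incseqD [OF this \<open>n \<ge> N\<close>] show "1 / euler_real N (1 + s) \<le> 1 / euler_real n (1 + s)"
          by (simp add: prod_dividef euler_real_def)
      qed
    qed
    also have "\<dots> \<le> 5 / s" using zeta_real_bounds [of s] s by simp
    finally show "1 / euler_real N (1 + s) \<le> 5 / s" .
  qed (use euler_real_pos [of "1 + s" N] s in auto)
  also have "\<dots> = 20 ^ 4 * 80 * ln (real N)" using lN by (simp add: s_def)
  finally show ?thesis .
qed

lemma kappa_prod_mertens:
  assumes N: "N \<ge> 3"
  shows "(\<Prod>q\<in>primes_upto N. 1 + kappa q) \<le> (20 ^ 4 * 80 * ln (real N))\<^sup>2"
proof -
  have "(\<Prod>q\<in>primes_upto N. 1 + kappa q) = (\<Prod>q\<in>primes_upto N. 1 / (1 - 1 / real q))\<^sup>2"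
    unfolding prod_power_distrib by (simp add: kappa_def power_one_over)
  also have "\<dots> \<le> (20 ^ 4 * 80 * ln (real N))\<^sup>2"
  proof (rule power_mono [OF mertens_upper [OF N]], rule prod_nonneg)
    fix q assume q: "q \<in> primes_upto N"
    have "1 / real q \<le> 1" using primes_upto_ge_2 [OF q] by simp
    thus "0 \<le> 1 / (1 - 1 / real q)" by simp
  qed
  finally show ?thesis .
qed

text \<open>Rankin's trick: the product of \<open>A \<union> B\<close> is at most \<open>R\<^sup>2\<close> whenever the weights do not vanish, so that its power
\<open>5/8\<close> can be exchanged for \<open>R^(5/4)\<close>, leaving exponent \<open>9/8 > 1\<close> in a convergent product. The exponent is
chosen so that \<open>R^(5/4)\<close> stays below \<open>sqrt Y\<close> by a power of \<open>Y\<close> for \<open>R \<le> Y^(1/3)\<close>.\<close>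

lemma error_sum_bound:
  assumes P: "finite P" "P \<subseteq> primes_upto N" and R: "R > 0"
    and w: "\<And>A. A \<in> Pow P \<Longrightarrow> \<bar>w A\<bar> \<le> 1" "\<And>A. A \<in> Pow P \<Longrightarrow> real (\<Prod>A) > R \<Longrightarrow> w A = 0"
  shows "(\<Sum>A\<in>Pow P. \<Sum>B\<in>Pow P. \<bar>w A\<bar> * \<bar>w B\<bar> * (\<Prod>q\<in>A \<union> B. 3 / sqrt (real q)))
    \<le> exp (9 * (\<Sum>n. real (Suc n) powr (- (9/8)))) * R powr (5/4)"
proof -
  (* The exponents add up: 1/2 = 9/8 - 5/8. *)
  define g where "g = (\<lambda>q::nat. 3 * real q powr (- (9/8)))"
  have pr: "prime q" "real q \<ge> 1" if "q \<in> A" "A \<in> Pow P" for q A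
  proof -
    have "q \<in> primes_upto N" using that P by auto
    thus "prime q" "real q \<ge> 1" using primes_upto_prime primes_upto_pos [of q N] by auto
  qed
  have "(\<Sum>A\<in>Pow P. \<Sum>B\<in>Pow P. \<bar>w A\<bar> * \<bar>w B\<bar> * (\<Prod>q\<in>A \<union> B. 3 / sqrt (real q)))
     \<le> (\<Sum>A\<in>Pow P. \<Sum>B\<in>Pow P. R powr (5/4) * (\<Prod>q\<in>A \<union> B. g q))"
  proof (rule sum_mono, rule sum_mono)
    fix A B assume AB: "A \<in> Pow P" "B \<in> Pow P"
    define E where "E = A \<union> B"
    have E: "E \<in> Pow P" using AB unfolding E_def by blast
    have gpos: "(\<Prod>q\<in>E. g q) \<ge> 0" by (rule prod_nonneg) (auto simp: g_def)
    show "\<bar>w A\<bar> * \<bar>w B\<bar> * (\<Prod>q\<in>A \<union> B. 3 / sqrt (real q)) \<le> R powr (5/4) * (\<Prod>q\<in>A \<union> B. g q)"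
    proof (cases "real (\<Prod>A) > R \<or> real (\<Prod>B) > R")
      case True
      hence "w A = 0 \<or> w B = 0" using w AB by auto
      thus ?thesis using gpos by (auto simp: E_def)
    next
      case False
      have fin: "finite A" "finite B" using AB P by (auto intro: finite_subset)
      have "real (\<Prod>(A \<inter> B)) \<ge> 1" by (rule prod_primes_ge_1) (use pr AB in blast)
      hence "real (\<Prod>E) * 1 \<le> real (\<Prod>E) * real (\<Prod>(A \<inter> B))" by (intro mult_left_mono of_nat_0_le_iff)
      also have "\<dots> = real (\<Prod>A) * real (\<Prod>B)"
        unfolding E_def of_nat_mult [symmetric] prod.union_inter [OF fin] ..
      also have "\<dots> \<le> R * R" using False R by (intro mult_mono of_nat_0_le_iff) linarith+
      finally have ER: "real (\<Prod>E) \<le> R * R" by simp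
      have "(\<Prod>q\<in>E. 3 / sqrt (real q)) = (\<Prod>q\<in>E. g q * real q powr (5/8))"
      proof (rule prod.cong [OF refl])
        fix q assume "q \<in> E"
        hence q: "real q \<ge> 1" using pr E by blast
        have "g q * real q powr (5/8) = 3 * real q powr (- (1/2))" unfolding g_def by (simp add: powr_add [symmetric] mult.assoc)
        also have "\<dots> = 3 / sqrt (real q)" using q by (simp add: powr_minus_divide powr_half_sqrt)
        finally show "3 / sqrt (real q) = g q * real q powr (5/8)" ..
      qed
      also have "\<dots> = (\<Prod>q\<in>E. g q) * (real (\<Prod>E)) powr (5/8)"
        by (simp add: prod.distrib prod_powr_distrib)
      also have "\<dots> \<le> (\<Prod>q\<in>E. g q) * (R * R) powr (5/8)"
        using ER gpos by (intro mult_left_mono powr_mono2 of_nat_0_le_iff) auto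
      also have "(R * R) powr (5/8) = R powr (5/4)" using R by (simp add: powr_mult powr_add [symmetric])
      finally have Eb: "(\<Prod>q\<in>E. 3 / sqrt (real q)) \<le> R powr (5/4) * (\<Prod>q\<in>E. g q)" by (simp add: mult.commute)
      have "\<bar>w A\<bar> * \<bar>w B\<bar> * (\<Prod>q\<in>E. 3 / sqrt (real q)) \<le> (1 * 1) * (\<Prod>q\<in>E. 3 / sqrt (real q))"
        using w(1) AB by (intro mult_right_mono mult_mono prod_nonneg) auto
      thus ?thesis using Eb by (simp add: E_def)
    qed
  qed
  also have "\<dots> = R powr (5/4) * (\<Prod>q\<in>P. 1 + 3 * g q)"
    unfolding sum_distrib_left [symmetric] sum_prod_union [OF P(1)] ..
  also have "(\<Prod>q\<in>P. 1 + 3 * g q) \<le> (\<Prod>q\<in>P. exp (3 * g q))"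
    by (intro prod_mono) (auto simp: g_def intro!: exp_ge_add_one_self add_nonneg_nonneg)
  also have "\<dots> = exp (\<Sum>q\<in>P. 3 * g q)" using P(1) by (simp add: exp_sum)
  also have "(\<Sum>q\<in>P. 3 * g q) \<le> (\<Sum>q\<in>Suc ` {..N}. 3 * g q)"
  proof (rule sum_mono2)
    show "P \<subseteq> Suc ` {..N}"
    proof
      fix q assume "q \<in> P"
      hence "q \<in> primes_upto N" using P(2) by auto
      hence "q = Suc (q - 1)" "q - 1 \<le> N" using primes_upto_pos [of q N] by (auto simp: primes_upto_def)
      thus "q \<in> Suc ` {..N}" by blast
    qed
  qed (auto simp: g_def)
  also have "\<dots> = 9 * (\<Sum>n\<le>N. real (Suc n) powr (- (9/8)))" by (simp add: sum.reindex g_def sum_distrib_left)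
  also have "\<dots> \<le> 9 * (\<Sum>n. real (Suc n) powr (- (9/8)))"
    by (intro mult_left_mono sum_le_suminf [OF summable_zeta_powr]) auto
  finally show ?thesis using R by (simp add: mult.commute)
qed

section \<open>Counting products of primes with weights\<close>

lemma prime_dvd_prod_primes:
  assumes "finite A" "\<And>a. a \<in> A \<Longrightarrow> prime a" "prime q" "q dvd \<Prod>A"
  shows "q \<in> A"
proof -
  obtain a where "a \<in> A" "q dvd a" using assms(1,3,4) by (auto simp: prime_dvd_prod_iff)
  thus ?thesis using assms(2,3) primes_dvd_imp_eq by blast
qed

lemma prod_primes_pos:
  assumes "\<And>a. a \<in> A \<Longrightarrow> prime (a::nat)"
  shows "\<Prod>A > 0"
  by (rule prod_pos) (use assms prime_gt_0_nat in blast)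

lemma inj_on_prod_primes:
  assumes "finite P" "\<And>q. q \<in> P \<Longrightarrow> prime (q::nat)"
  shows "inj_on (\<lambda>A. \<Prod>A) (Pow P)"
proof (rule inj_onI)
  fix A B assume AB: "A \<in> Pow P" "B \<in> Pow P" "\<Prod>A = \<Prod>B"
  have fin: "finite A" "finite B" using AB assms(1) finite_subset by auto
  show "A = B"
  proof (intro equalityI subsetI)
    fix q assume q: "q \<in> A"
    have "q dvd \<Prod>B" using q fin AB(3) by (metis dvd_prod_eqI dvd_refl)
    thus "q \<in> B" using prime_dvd_prod_primes [OF fin(2), of q] assms(2) AB q by blast
  next
    fix q assume q: "q \<in> B"
    have "q dvd \<Prod>A" using q fin AB(3) by (metis dvd_prod_eqI dvd_refl)
    thus "q \<in> A" using prime_dvd_prod_primes [OF fin(1), of q] assms(2) AB q by blast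
  qed
qed

lemma tau_prod_primes:
  assumes "finite A" "\<And>a. a \<in> A \<Longrightarrow> prime a"
  shows "tau (\<Prod>A) = 2 ^ card A"
  using assms
proof (induction A rule: finite_induct)
  case (insert q A)
  have nd: "\<not> q dvd \<Prod>A" using prime_dvd_prod_primes [of A q] insert by auto
  have "\<Prod>A > 0" by (rule prod_primes_pos) (use insert in auto)
  hence "tau (q ^ 1 * \<Prod>A) = (1 + 1) * tau (\<Prod>A)" by (intro tau_prime_power) (use insert nd in auto)
  thus ?case using insert by simp
qed (simp add: tau_def)

lemma tau_sum_empty_le:
  assumes z: "z > 0"
  shows "tau_sum {} z \<le> (if z \<ge> 1 then 2 * tau_const * (z * (1 + ln z)) else 0)"
proof (cases "z \<ge> 1")
  case True
  have l: "ln z \<ge> 0" using True by simp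
  have sz: "sqrt z \<le> z" using True by (simp add: real_le_lsqrt power2_eq_square)
  have "tau_sum {} z \<le> z * (1 * ln z + (2 * euler_mascheroni - 1)) + tau_const * sqrt z"
    using abs_le_D1 [OF tau_sum_empty [OF z]] by (simp only: diff_le_eq add.commute)
  also have "\<dots> \<le> z * (tau_const * ln z + tau_const) + tau_const * (z * (1 + ln z))"
  proof (intro add_mono mult_left_mono)
    show "1 * ln z \<le> tau_const * ln z" using l by (intro mult_right_mono) (auto simp: tau_const_def)
    show "2 * euler_mascheroni - 1 \<le> tau_const" by (auto simp: tau_const_def)
    have "z * 1 \<le> z * (1 + ln z)" using l z by (intro mult_left_mono) auto
    thus "sqrt z \<le> z * (1 + ln z)" using sz by simp
  qed (use z in \<open>auto simp: tau_const_def\<close>)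
  also have "\<dots> = 2 * tau_const * (z * (1 + ln z))" by (simp add: algebra_simps)
  finally show ?thesis using True by simp
next
  case False
  have "multiples {} z = {}" using False by (auto simp: multiples_def)
  thus ?thesis using False by (simp add: tau_sum_def)
qed

text \<open>The summand is \<open>\<tau>\<close> at the product of the primes in \<open>D\<close>.\<close>

lemma sum_two_power_le:
  assumes P: "finite P" "\<And>q. q \<in> P \<Longrightarrow> prime q"
  shows "(\<Sum>D\<in>{D\<in>Pow P. real (\<Prod>D) \<le> z}. 2 ^ card D) \<le> tau_sum {} z"
proof -
  define X where "X = {D\<in>Pow P. real (\<Prod>D) \<le> z}"
  have inj: "inj_on (\<lambda>D. \<Prod>D) X"
    by (rule inj_on_subset [OF inj_on_prod_primes [OF P]]) (auto simp: X_def)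
  have "(\<Sum>D\<in>X. 2 ^ card D) = (\<Sum>D\<in>X. real (tau (\<Prod>D)))"
  proof (rule sum.cong [OF refl])
    fix D assume "D \<in> X"
    hence "D \<subseteq> P" by (simp add: X_def)
    hence "tau (\<Prod>D) = 2 ^ card D" by (intro tau_prod_primes) (use P finite_subset in auto)
    thus "2 ^ card D = real (tau (\<Prod>D))" by simp
  qed
  also have "\<dots> = (\<Sum>n\<in>(\<lambda>D. \<Prod>D) ` X. real (tau n))" by (simp only: sum.reindex [OF inj] o_def)
  also have "\<dots> \<le> tau_sum {} z" unfolding tau_sum_def
  proof (rule sum_mono2 [OF finite_multiples])
    show "(\<lambda>D. \<Prod>D) ` X \<subseteq> multiples {} z"
    proof
      fix n assume "n \<in> (\<lambda>D. \<Prod>D) ` X"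
      then obtain D where D: "D \<in> X" "n = \<Prod>D" by blast
      have "n > 0" unfolding D(2) by (rule prod_primes_pos) (use P(2) D(1) in \<open>auto simp: X_def\<close>)
      thus "n \<in> multiples {} z" using D by (auto simp: X_def multiples_def)
    qed
  qed auto
  finally show ?thesis by (simp add: X_def)
qed

lemma prod_add_Pow:
  assumes "finite A"
  shows "(\<Prod>q\<in>A. f q + g q) = (\<Sum>S\<in>Pow A. (\<Prod>q\<in>S. f q) * (\<Prod>q\<in>A - S. g q :: real))"
  using assms
proof (induction A rule: finite_induct)
  case (insert q A)
  have "(\<Sum>S\<in>Pow (insert q A). (\<Prod>q\<in>S. f q) * (\<Prod>q\<in>insert q A - S. g q))
     = (\<Sum>S\<in>Pow A. g q * ((\<Prod>q\<in>S. f q) * (\<Prod>q\<in>A - S. g q)) + f q * ((\<Prod>q\<in>S. f q) * (\<Prod>q\<in>A - S. g q)))"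
    unfolding sum_Pow_insert [OF insert(1,2)]
  proof (rule sum.cong [OF refl])
    fix S assume S: "S \<in> Pow A"
    have "insert q A - S = insert q (A - S)" "insert q A - insert q S = A - S" using S insert(2) by auto
    moreover have "(\<Prod>x\<in>insert q (A - S). g x) = g q * (\<Prod>x\<in>A - S. g x)" by (rule prod_insert_Pow [OF insert(1,2)]) auto
    moreover have "(\<Prod>x\<in>insert q S. f x) = f q * (\<Prod>x\<in>S. f x)" by (rule prod_insert_Pow [OF insert(1,2) S])
    ultimately show "(\<Prod>q\<in>S. f q) * (\<Prod>q\<in>insert q A - S. g q) + (\<Prod>q\<in>insert q S. f q) * (\<Prod>q\<in>insert q A - insert q S. g q)
       = g q * ((\<Prod>q\<in>S. f q) * (\<Prod>q\<in>A - S. g q)) + f q * ((\<Prod>q\<in>S. f q) * (\<Prod>q\<in>A - S. g q))"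
      by (simp add: mult_ac)
  qed
  also have "\<dots> = (f q + g q) * (\<Sum>S\<in>Pow A. (\<Prod>q\<in>S. f q) * (\<Prod>q\<in>A - S. g q))"
    by (simp add: sum.distrib distrib_right sum_distrib_left)
  finally show ?case using insert by simp
qed auto

definition count_const :: real where "count_const = 2 * tau_const * exp (5600 * ln_square_sum)"

lemma inv_loss_power4:
  assumes q: "q \<ge> 2"
  shows "1 \<le> inv_loss q ^ 4" "inv_loss q ^ 4 - 1 \<le> 2800 * ((1 + ln (real q)) / real q)"
proof -
  note B = inv_loss_bounds [OF q]
  show "1 \<le> inv_loss q ^ 4" using B by (simp add: one_le_power)
  have t: "(1 + ln (real q)) / real q \<ge> 0" using q by simp
  have "inv_loss q ^ 4 - 1 = (inv_loss q - 1) * ((1 + inv_loss q) * (1 + (inv_loss q)\<^sup>2))"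
    by (simp add: power2_eq_square algebra_simps eval_nat_numeral)
  also have "inv_loss q - 1 = inv_loss q * ((1 + ln (real q)) / real q)" using B(3) by simp
  also have "inv_loss q * ((1 + ln (real q)) / real q) * ((1 + inv_loss q) * (1 + (inv_loss q)\<^sup>2)) \<le> 7 * ((1 + ln (real q)) / real q) * ((1 + 7) * (1 + 7\<^sup>2))"
  proof -
    have "b * r * ((1 + b) * (1 + b\<^sup>2)) \<le> 7 * r * ((1 + 7) * (1 + 7\<^sup>2))" if "1 \<le> b" "b \<le> 7" "0 \<le> r" for b r :: real
      using that by (intro mult_mono add_mono power_mono) auto
    from this [OF B(1,2) t] show ?thesis .
  qed
  finally show "inv_loss q ^ 4 - 1 \<le> 2800 * ((1 + ln (real q)) / real q)" by simp
qed

text \<open>The weight at a prime is \<open>2\<close> plus \<open>O((1 + log q)/q)\<close>. Expanding the second part as a convolution reduces the sum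
to divisor sums at \<open>y/e\<close>, and the sum over \<open>e\<close> converges. A bound of the shape \<open>y log y\<close>, sharp up to constants,
is essential; a further logarithm would destroy the final estimate.\<close>

lemma weighted_count:
  assumes y: "y \<ge> 1" and P: "P = primes_upto N"
  shows "(\<Sum>C\<in>{C\<in>Pow P. real (\<Prod>C) \<le> y}. \<Prod>q\<in>C. 2 * inv_loss q ^ 4) \<le> count_const * (y * (1 + ln y))"
proof -
  have fP: "finite P" and prP: "\<And>q. q \<in> P \<Longrightarrow> prime q" and P2: "\<And>q. q \<in> P \<Longrightarrow> q \<ge> 2"
    using P primes_upto_prime primes_upto_ge_2 by auto
  have ly: "ln y \<ge> 0" using y by simp
  define g where "g = (\<lambda>q. 2 * (inv_loss q ^ 4 - 1))"
  have g0: "g q \<ge> 0" if "q \<in> P" for q using inv_loss_power4(1) [OF P2 [OF that]] by (simp add: g_def)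
  have gp: "(\<Prod>q\<in>E. g q) \<ge> 0" if "E \<in> Pow P" for E by (rule prod_nonneg) (use g0 that in auto)
  have "(\<Sum>C\<in>{C\<in>Pow P. real (\<Prod>C) \<le> y}. \<Prod>q\<in>C. 2 * inv_loss q ^ 4)
      = (\<Sum>C\<in>Pow P. if real (\<Prod>C) \<le> y then (\<Sum>E\<in>Pow C. (\<Prod>q\<in>E. g q) * 2 ^ card (C - E)) else 0)"
  proof (subst sum.inter_filter)
    show "(\<Sum>C\<in>Pow P. if real (\<Prod>C) \<le> y then \<Prod>q\<in>C. 2 * inv_loss q ^ 4 else 0) = (\<Sum>C\<in>Pow P. if real (\<Prod>C) \<le> y then (\<Sum>E\<in>Pow C. (\<Prod>q\<in>E. g q) * 2 ^ card (C - E)) else 0)"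
    proof (rule sum.cong [OF refl])
      fix C assume C: "C \<in> Pow P"
      hence fC: "finite C" using fP finite_subset by auto
      have "(\<Prod>q\<in>C. 2 * inv_loss q ^ 4) = (\<Prod>q\<in>C. g q + 2)" by (simp add: g_def)
      also have "\<dots> = (\<Sum>E\<in>Pow C. (\<Prod>q\<in>E. g q) * 2 ^ card (C - E))" unfolding prod_add_Pow [OF fC] by simp
      finally show "(if real (\<Prod>C) \<le> y then \<Prod>q\<in>C. 2 * inv_loss q ^ 4 else 0) = (if real (\<Prod>C) \<le> y then (\<Sum>E\<in>Pow C. (\<Prod>q\<in>E. g q) * 2 ^ card (C - E)) else 0)" by simp
    qed
  qed (use fP in simp)
  also have "\<dots> = (\<Sum>C\<in>Pow P. \<Sum>E\<in>Pow P. if E \<subseteq> C \<and> real (\<Prod>C) \<le> y then (\<Prod>q\<in>E. g q) * 2 ^ card (C - E) else 0)"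
  proof (rule sum.cong [OF refl])
    fix C assume C: "C \<in> Pow P"
    have "{E\<in>Pow P. E \<subseteq> C} = Pow C" using C by auto
    hence "(\<Sum>E\<in>Pow C. (\<Prod>q\<in>E. g q) * 2 ^ card (C - E)) = (\<Sum>E\<in>Pow P. if E \<subseteq> C then (\<Prod>q\<in>E. g q) * 2 ^ card (C - E) else 0)"
      using sum.inter_filter [of "Pow P" "\<lambda>E. (\<Prod>q\<in>E. g q) * 2 ^ card (C - E)" "\<lambda>E. E \<subseteq> C"] fP by simp
    thus "(if real (\<Prod>C) \<le> y then (\<Sum>E\<in>Pow C. (\<Prod>q\<in>E. g q) * 2 ^ card (C - E)) else 0)
       = (\<Sum>E\<in>Pow P. if E \<subseteq> C \<and> real (\<Prod>C) \<le> y then (\<Prod>q\<in>E. g q) * 2 ^ card (C - E) else 0)"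
      by (cases "real (\<Prod>C) \<le> y") (simp_all only: if_True if_False simp_thms sum.neutral_const)
  qed
  also have "\<dots> = (\<Sum>E\<in>Pow P. \<Sum>C\<in>Pow P. if E \<subseteq> C \<and> real (\<Prod>C) \<le> y then (\<Prod>q\<in>E. g q) * 2 ^ card (C - E) else 0)"
    by (rule sum.swap)
  also have "\<dots> \<le> (\<Sum>E\<in>Pow P. (\<Prod>q\<in>E. g q / real q) * (2 * tau_const * (y * (1 + ln y))))"
  proof (rule sum_mono)
    fix E assume E: "E \<in> Pow P"
    hence fE: "finite E" using fP finite_subset by auto
    define e where "e = real (\<Prod>E)"
    have e1: "e \<ge> 1" unfolding e_def by (rule prod_primes_ge_1) (use prP E in auto)
    have "(\<Sum>C\<in>Pow P. if E \<subseteq> C \<and> real (\<Prod>C) \<le> y then (\<Prod>q\<in>E. g q) * 2 ^ card (C - E) else 0)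
       = (\<Sum>C\<in>{C\<in>Pow P. E \<subseteq> C \<and> real (\<Prod>C) \<le> y}. (\<Prod>q\<in>E. g q) * 2 ^ card (C - E))"
      by (rule sum.inter_filter [symmetric]) (use fP in simp)
    also have "\<dots> = (\<Sum>D\<in>{D\<in>Pow (P - E). real (\<Prod>D) \<le> y / e}. (\<Prod>q\<in>E. g q) * 2 ^ card D)"
    proof (rule sum.reindex_bij_witness [of _ "\<lambda>D. E \<union> D" "\<lambda>C. C - E"])
      fix C assume C: "C \<in> {C\<in>Pow P. E \<subseteq> C \<and> real (\<Prod>C) \<le> y}"
      show "E \<union> (C - E) = C" using C by auto
      have fC: "finite C" using C fP finite_subset by auto
      have "\<Prod>C = \<Prod>(C - E) * \<Prod>E" by (rule prod.subset_diff) (use C fC in auto)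
      hence "real (\<Prod>(C - E)) * e \<le> y" using C unfolding e_def by (metis (no_types, lifting) mem_Collect_eq of_nat_mult)
      thus "C - E \<in> {D\<in>Pow (P - E). real (\<Prod>D) \<le> y / e}" using C e1 by (auto simp: le_divide_eq simp del: of_nat_prod)
    next
      fix D assume D: "D \<in> {D\<in>Pow (P - E). real (\<Prod>D) \<le> y / e}"
      show "E \<union> D - E = D" using D by auto
      have fD: "finite D" using D fP finite_subset by auto
      have "\<Prod>(E \<union> D) = \<Prod>E * \<Prod>D" by (rule prod.union_disjoint) (use D fE fD in auto)
      moreover have "real (\<Prod>D) * e \<le> y" using D e1 by (simp add: le_divide_eq del: of_nat_prod)
      ultimately have "real (\<Prod>(E \<union> D)) \<le> y" unfolding e_def by (metis mult.commute of_nat_mult)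
      thus "E \<union> D \<in> {C\<in>Pow P. E \<subseteq> C \<and> real (\<Prod>C) \<le> y}" using D E by auto
    qed auto
    also have "\<dots> = (\<Prod>q\<in>E. g q) * (\<Sum>D\<in>{D\<in>Pow (P - E). real (\<Prod>D) \<le> y / e}. 2 ^ card D)" by (simp add: sum_distrib_left)
    also have "\<dots> \<le> (\<Prod>q\<in>E. g q) * tau_sum {} (y / e)"
      by (intro mult_left_mono sum_two_power_le gp E) (use fP prP in auto)
    also have "\<dots> \<le> (\<Prod>q\<in>E. g q) * (2 * tau_const * (y / e * (1 + ln y)))"
    proof (rule mult_left_mono [OF _ gp [OF E]])
      have ye: "y / e > 0" using y e1 by simp
      have TC0: "tau_const \<ge> 0" by (simp add: tau_const_def)
      show "tau_sum {} (y / e) \<le> 2 * tau_const * (y / e * (1 + ln y))"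
      proof (cases "y / e \<ge> 1")
        case True
        have "y / e \<le> y" using e1 y by (simp add: divide_le_eq mult_left_mono [of 1 e y, simplified])
        hence "ln (y / e) \<le> ln y" using ye y by simp
        hence "2 * tau_const * (y / e * (1 + ln (y / e))) \<le> 2 * tau_const * (y / e * (1 + ln y))"
          using TC0 ye by (intro mult_left_mono) auto
        thus ?thesis using tau_sum_empty_le [OF ye] True by simp
      next
        case False
        hence "tau_sum {} (y / e) \<le> 0" using tau_sum_empty_le [OF ye] by simp
        also have "0 \<le> 2 * tau_const * (y / e * (1 + ln y))"
          by (intro mult_nonneg_nonneg add_nonneg_nonneg TC0 ly less_imp_le [OF ye]) auto
        finally show ?thesis .
      qed
    qed
    also have "\<dots> = (\<Prod>q\<in>E. g q / real q) * (2 * tau_const * (y * (1 + ln y)))"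
      by (simp add: prod_dividef e_def)
    finally show "(\<Sum>C\<in>Pow P. if E \<subseteq> C \<and> real (\<Prod>C) \<le> y then (\<Prod>q\<in>E. g q) * 2 ^ card (C - E) else 0) \<le> (\<Prod>q\<in>E. g q / real q) * (2 * tau_const * (y * (1 + ln y)))" .
  qed
  also have "\<dots> = (\<Prod>q\<in>P. 1 + g q / real q) * (2 * tau_const * (y * (1 + ln y)))"
    unfolding sum_distrib_right [symmetric] prod_one_plus_Pow [OF fP] ..
  also have "\<dots> \<le> exp (5600 * ln_square_sum) * (2 * tau_const * (y * (1 + ln y)))"
  proof (rule mult_right_mono)
    show "(\<Prod>q\<in>P. 1 + g q / real q) \<le> exp (5600 * ln_square_sum)"
    proof (rule prod_one_plus_le [where f = "\<lambda>q. g q / real q" and N = N])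
      fix q assume "q \<in> primes_upto N"
      hence q: "q \<in> P" "q \<ge> 2" using P P2 by auto
      show "0 \<le> g q / real q" using g0 [OF q(1)] by simp
      have "g q \<le> 2 * (2800 * ((1 + ln (real q)) / real q))"
        unfolding g_def by (intro mult_left_mono inv_loss_power4(2) [OF q(2)]) auto
      hence "g q / real q \<le> 2 * (2800 * ((1 + ln (real q)) / real q)) / real q"
        by (intro divide_right_mono) auto
      thus "g q / real q \<le> 5600 * ((1 + ln (real q)) / (real q)\<^sup>2)" by (simp add: power2_eq_square)
    qed (use P in auto)
    show "0 \<le> 2 * tau_const * (y * (1 + ln y))" using y ly by (simp add: tau_const_def)
  qed
  also have "\<dots> = count_const * (y * (1 + ln y))" by (simp only: count_const_def mult_ac)
  finally show ?thesis .
qed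

section \<open>The quadratic form of the weights\<close>

lemma inv_log_antimono:
  assumes "0 < X" "X \<le> Y" shows "inv_log Y \<le> inv_log X"
proof -
  have "ln X \<le> ln Y" using assms by simp
  thus ?thesis unfolding inv_log_def by (intro divide_left_mono) (auto intro!: mult_pos_pos)
qed

text \<open>The contributions to \<open>\<Lambda>(pn)\<close> of the divisors \<open>m\<close> and \<open>pm\<close> of \<open>pn\<close>, where \<open>m\<close> is the product of the set \<open>A\<close>.\<close>

definition sieve_wt :: "real \<Rightarrow> nat \<Rightarrow> nat set \<Rightarrow> real" where
  "sieve_wt R p A = (\<Prod>q\<in>A. -1) * ((log_sq (R / real (\<Prod>A)) - log_sq (R / real p / real (\<Prod>A))) / (ln R)\<^sup>2)"

text \<open>The linear form in the square at \<open>C\<close> is a difference of two values of one sieve sum over integers prime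
to \<open>C\<close>.\<close>

lemma sieve_wt_row:
  assumes P: "finite P" and C: "C \<subseteq> P"
  shows "(\<Sum>A\<in>Pow P. if C \<subseteq> A then sieve_wt R p A * (\<Prod>q\<in>A. rho q) else 0)
    = (\<Prod>q\<in>C. - rho q) * ((subshifts (P - C) rho log_sq (R / real (\<Prod>C)) - subshifts (P - C) rho log_sq (R / real p / real (\<Prod>C))) / (ln R)\<^sup>2)"
proof -
  have "(\<Sum>A\<in>Pow P. if C \<subseteq> A then sieve_wt R p A * (\<Prod>q\<in>A. rho q) else 0) = (\<Sum>A\<in>{A\<in>Pow P. C \<subseteq> A}. sieve_wt R p A * (\<Prod>q\<in>A. rho q))"
    by (rule sum.inter_filter [symmetric]) (use P in simp)
  also have "{A\<in>Pow P. C \<subseteq> A} = {A. C \<subseteq> A \<and> A \<subseteq> P}" by auto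
  also have "(\<Sum>A | C \<subseteq> A \<and> A \<subseteq> P. sieve_wt R p A * (\<Prod>q\<in>A. rho q)) = (\<Sum>B\<in>Pow (P - C). sieve_wt R p (C \<union> B) * (\<Prod>q\<in>C \<union> B. rho q))"
    by (rule sum_supersets [OF P C])
  also have "\<dots> = (\<Sum>B\<in>Pow (P - C). (\<Prod>q\<in>C. - rho q) * ((\<Prod>q\<in>B. - rho q) * log_sq (R / real (\<Prod>C) / real (\<Prod>B)) - (\<Prod>q\<in>B. - rho q) * log_sq (R / real p / real (\<Prod>C) / real (\<Prod>B))) / (ln R)\<^sup>2)"
  proof (rule sum.cong [OF refl])
    fix B assume B: "B \<in> Pow (P - C)"
    have fin: "finite C" "finite B" using B C P by (auto intro: finite_subset)
    have dis: "C \<inter> B = {}" using B by auto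
    have "real (\<Prod>(C \<union> B)) = real (\<Prod>C) * real (\<Prod>B)" unfolding of_nat_mult [symmetric] by (subst prod.union_disjoint [OF fin dis]) simp
    moreover have "(\<Prod>q\<in>C \<union> B. -1) * (\<Prod>q\<in>C \<union> B. rho q) = (\<Prod>q\<in>C. - rho q) * (\<Prod>q\<in>B. - rho q)"
      unfolding prod.distrib [symmetric] by (subst prod.union_disjoint [OF fin dis]) simp
    moreover have "sieve_wt R p (C \<union> B) * (\<Prod>q\<in>C \<union> B. rho q) = ((\<Prod>q\<in>C \<union> B. -1) * (\<Prod>q\<in>C \<union> B. rho q)) *
        ((log_sq (R / real (\<Prod>(C \<union> B))) - log_sq (R / real p / real (\<Prod>(C \<union> B)))) / (ln R)\<^sup>2)"
      by (simp add: sieve_wt_def del: of_nat_prod)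
    ultimately show "sieve_wt R p (C \<union> B) * (\<Prod>q\<in>C \<union> B. rho q) = (\<Prod>q\<in>C. - rho q) * ((\<Prod>q\<in>B. - rho q) * log_sq (R / real (\<Prod>C) / real (\<Prod>B)) - (\<Prod>q\<in>B. - rho q) * log_sq (R / real p / real (\<Prod>C) / real (\<Prod>B))) / (ln R)\<^sup>2"
      by (simp only: divide_divide_eq_left mult.assoc right_diff_distrib times_divide_eq_right)
  qed
  also have "\<dots> = (\<Prod>q\<in>C. - rho q) * ((subshifts (P - C) rho log_sq (R / real (\<Prod>C)) - subshifts (P - C) rho log_sq (R / real p / real (\<Prod>C))) / (ln R)\<^sup>2)"
    unfolding subshifts_def sum_subtractf [symmetric] sum_divide_distrib sum_distrib_left
    by (rule sum.cong [OF refl]) (simp only: times_divide_eq_right)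
  finally show ?thesis .
qed

lemma power_two_bracket:
  assumes "x \<ge> (1::real)"
  shows "\<exists>i. 2 ^ i \<le> x \<and> x < 2 ^ Suc i"
proof -
  have "\<exists>n. x < 2 ^ n" using real_arch_pow [of 2 x] by simp
  define n where "n = (LEAST n. x < 2 ^ n)"
  have n: "x < 2 ^ n" unfolding n_def by (rule LeastI_ex) fact
  have "n \<noteq> 0" using n assms by (cases n) auto
  then obtain i where i: "n = Suc i" by (cases n) auto
  have "\<not> x < 2 ^ i" unfolding i [symmetric] using not_less_Least [of i "\<lambda>n. x < 2 ^ n"] i by (simp add: n_def)
  thus ?thesis using n i by (intro exI [of _ i]) auto
qed

lemma sum_inverse_squares_le: "(\<Sum>j\<le>J. 1 / (real (Suc j))\<^sup>2) \<le> 2 - 1 / real (Suc J)"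
proof (induction J)
  case (Suc J)
  have "1 / (real (Suc (Suc J)))\<^sup>2 \<le> 1 / real (Suc J) - 1 / real (Suc (Suc J))"
  proof -
    have "1 / real (Suc J) - 1 / real (Suc (Suc J)) = 1 / (real (Suc J) * real (Suc (Suc J)))" by (simp add: field_simps)
    moreover have "1 / (real (Suc (Suc J)))\<^sup>2 \<le> 1 / (real (Suc J) * real (Suc (Suc J)))"
      unfolding power2_eq_square by (intro divide_left_mono mult_right_mono) auto
    ultimately show ?thesis by simp
  qed
  thus ?case using Suc by simp
qed simp

text \<open>The terms with \<open>2^i \<le> p\<close>, about \<open>log p\<close> in number, are bounded by \<open>1\<close>; afterwards the terms decay
like \<open>1/j\<^sup>2\<close>. This is where \<open>log p\<close> enters the theorem.\<close>

lemma sum_inv_log_powers: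
  assumes p: "p \<ge> 2"
  shows "(\<Sum>i\<le>I. (inv_log (2 ^ i / real p))\<^sup>2) \<le> 2 * ln (real p) + 9"
proof -
  define m where "m = nat \<lceil>ln (real p) / ln 2\<rceil>"
  have lp: "ln (real p) \<ge> 0" using p by simp
  have l2: "ln (2::real) \<ge> 1/2" using ln2_ge_two_thirds by linarith
  have l2p: "ln (2::real) > 0" by simp
  have m: "ln (real p) / ln 2 \<le> real m" "real m \<le> ln (real p) / ln 2 + 1"
    using lp l2p by (auto simp: m_def ceiling_correct intro: less_imp_le)
  have "ln (real p) / ln 2 \<le> ln (real p) / (1/2)" using l2 lp by (intro divide_left_mono) auto
  hence m2: "real m \<le> 2 * ln (real p) + 1" using m by simp
  have e1: "(inv_log X)\<^sup>2 \<le> 1" for X using inv_log_pos [of X] inv_log_le_1 [of X] by (simp add: power_le_one)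
  have e2: "(inv_log (2 ^ (m + j) / real p))\<^sup>2 \<le> 4 * (1 / (real (Suc j))\<^sup>2)" for j
  proof -
    have "ln (2 ^ (m + j) / real p) = real (m + j) * ln 2 - ln (real p)" using p by (simp add: ln_div ln_realpow)
    also have "\<dots> = (real m * ln 2 - ln (real p)) + real j * ln 2" by (simp add: algebra_simps)
    also have "\<dots> \<ge> 0 + real j * (1/2)"
      using m(1) l2 l2p by (intro add_mono mult_left_mono) (auto simp: divide_le_eq)
    finally have "1 + real j / 2 \<le> 1 + max 0 (ln (2 ^ (m + j) / real p))" by simp
    hence "inv_log (2 ^ (m + j) / real p) \<le> 1 / (real (Suc j) / 2)"
      unfolding inv_log_def by (intro divide_left_mono) (auto intro!: mult_pos_pos)
    hence "(inv_log (2 ^ (m + j) / real p))\<^sup>2 \<le> (1 / (real (Suc j) / 2))\<^sup>2" using inv_log_pos by (intro power_mono) (auto intro: less_imp_le)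
    also have "\<dots> = 4 * (1 / (real (Suc j))\<^sup>2)" by (simp add: power_divide)
    finally show ?thesis .
  qed
  have "(\<Sum>i\<le>I. (inv_log (2 ^ i / real p))\<^sup>2) \<le> (\<Sum>i\<in>{..<m} \<union> (\<lambda>j. m + j) ` {..I}. (inv_log (2 ^ i / real p))\<^sup>2)"
  proof (rule sum_mono2)
    show "{..I} \<subseteq> {..<m} \<union> (\<lambda>j. m + j) ` {..I}"
    proof
      fix i assume i: "i \<in> {..I}"
      show "i \<in> {..<m} \<union> (\<lambda>j. m + j) ` {..I}"
      proof (cases "i < m")
        case False
        hence "i = m + (i - m)" "i - m \<in> {..I}" using i by auto
        thus ?thesis by blast
      qed simp
    qed
  qed auto
  also have "\<dots> = (\<Sum>i<m. (inv_log (2 ^ i / real p))\<^sup>2) + (\<Sum>i\<in>(\<lambda>j. m + j) ` {..I}. (inv_log (2 ^ i / real p))\<^sup>2)"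
    by (rule sum.union_disjoint) auto
  also have "(\<Sum>i\<in>(\<lambda>j. m + j) ` {..I}. (inv_log (2 ^ i / real p))\<^sup>2) = (\<Sum>j\<le>I. (inv_log (2 ^ (m + j) / real p))\<^sup>2)"
    by (subst sum.reindex) (auto simp: inj_on_def)
  also have "\<dots> \<le> (\<Sum>j\<le>I. 4 * (1 / (real (Suc j))\<^sup>2))" by (intro sum_mono e2)
  also have "\<dots> = 4 * (\<Sum>j\<le>I. 1 / (real (Suc j))\<^sup>2)" by (simp add: sum_distrib_left)
  also have "\<dots> \<le> 4 * 2"
    using sum_inverse_squares_le [of I] by (intro mult_left_mono) (auto intro: order_trans)
  also have "(\<Sum>i<m. (inv_log (2 ^ i / real p))\<^sup>2) \<le> (\<Sum>i<m. 1)" by (intro sum_mono e1)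
  finally have "(\<Sum>i\<le>I. (inv_log (2 ^ i / real p))\<^sup>2) \<le> real m + 8" by simp
  thus ?thesis using m2 by simp
qed

lemma log_sq_mono: "0 < X \<Longrightarrow> X \<le> Y \<Longrightarrow> log_sq X \<le> log_sq Y"
  unfolding log_sq_def by (intro power_mono max.mono) auto

lemma log_sq_nonneg: "log_sq X \<ge> 0" by (simp add: log_sq_def)

lemma sieve_wt_bounds:
  assumes R: "R > 1" and p: "p > 0" and A: "\<And>a. a \<in> A \<Longrightarrow> prime a"
  shows "\<bar>sieve_wt R p A\<bar> \<le> 1" "real (\<Prod>A) > R \<Longrightarrow> sieve_wt R p A = 0"
proof -
  define d where "d = real (\<Prod>A)"
  have d1: "d \<ge> 1" unfolding d_def by (rule prod_primes_ge_1 [OF A])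
  have lR: "ln R > 0" using R by simp
  have p1: "real p \<ge> 1" using p by simp
  have le: "R / real p / d \<le> R / d"
  proof -
    have "R / real p \<le> R" using R p1 by (simp add: divide_le_eq mult_left_mono [of 1 "real p" R, simplified])
    thus ?thesis using d1 by (intro divide_right_mono) auto
  qed
  have pos: "0 < R / real p / d" using R p1 d1 by simp
  have "log_sq (R / d) \<le> log_sq R"
  proof (rule log_sq_mono)
    show "R / d \<le> R" using R d1 by (simp add: divide_le_eq mult_left_mono [of 1 d R, simplified])
  qed (use R d1 in simp)
  also have "log_sq R = (ln R)\<^sup>2" using lR by (simp add: log_sq_def)
  finally have u: "log_sq (R / d) \<le> (ln R)\<^sup>2" .
  have l: "log_sq (R / real p / d) \<le> log_sq (R / d)" by (rule log_sq_mono [OF pos le])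
  have "\<bar>\<Prod>q\<in>A. - 1 :: real\<bar> = 1" by (simp add: power_abs)
  hence "\<bar>sieve_wt R p A\<bar> = \<bar>log_sq (R / d) - log_sq (R / real p / d)\<bar> / (ln R)\<^sup>2"
    unfolding sieve_wt_def d_def [symmetric] abs_mult by simp
  also have "\<bar>log_sq (R / d) - log_sq (R / real p / d)\<bar> \<le> (ln R)\<^sup>2"
    using u l log_sq_nonneg [of "R / real p / d"] by (simp add: abs_le_iff)
  hence "\<bar>log_sq (R / d) - log_sq (R / real p / d)\<bar> / (ln R)\<^sup>2 \<le> 1" using lR by (simp add: divide_le_eq)
  finally show "\<bar>sieve_wt R p A\<bar> \<le> 1" .
  assume "real (\<Prod>A) > R"
  hence "d > R" by (simp only: d_def)
  hence "R / d \<le> 1" using d1 by (simp add: divide_le_eq)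
  hence "R / real p / d \<le> 1" using le by (rule order_trans[rotated])
  hence "log_sq (R / d) = 0" "log_sq (R / real p / d) = 0" using pos \<open>R / d \<le> 1\<close> R d1 by (auto simp: log_sq_zero simp del: divide_divide_eq_left)
  thus "sieve_wt R p A = 0" unfolding sieve_wt_def d_def [symmetric] by simp
qed

text \<open>The diagonalised form is a sum over squarefree \<open>c \<le> R\<close> of \<open>1/c\<close> times a bounded weight on average times the
square of \<open>inv_log (R/(pc)) / log\<^sup>2 R\<close>. In each dyadic range of \<open>R/c\<close> the weights contribute \<open>O(log R)\<close>
by \<open>weighted_count\<close>, and the ranges are summed by \<open>sum_inv_log_powers\<close>.\<close>

lemma quadratic_form_bound:
  "\<exists>K\<ge>0. \<forall>N R p. ln R \<ge> 1 \<and> R > 1 \<and> R \<le> real (Suc N) \<and> p \<ge> 2 \<longrightarrow>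
     (\<Sum>A\<in>Pow (primes_upto N). \<Sum>B\<in>Pow (primes_upto N). sieve_wt R p A * sieve_wt R p B * (\<Prod>q\<in>A \<union> B. rho q)) \<le> K * (ln (real p) + 1) / (ln R) ^ 3"
proof -
  obtain K0 where K0: "K0 \<ge> 0" "\<And>N C. C \<subseteq> primes_upto N \<Longrightarrow> (\<exists>c. nearly (real (Suc N)) (subshifts (primes_upto N - C) rho log_sq) c (K0 * (\<Prod>q\<in>C. (inv_loss q)\<^sup>2)))"
    using coprime_sieve_sum_nearly by blast
  have KV0: "count_const \<ge> 0" by (simp add: count_const_def tau_const_def)
  show ?thesis
  proof (rule exI [of _ "144 * K0\<^sup>2 * count_const"], intro conjI allI impI)
    show "0 \<le> 144 * K0\<^sup>2 * count_const" using KV0 by simp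
    fix N p :: nat and R :: real
    assume as: "ln R \<ge> 1 \<and> R > 1 \<and> R \<le> real (Suc N) \<and> p \<ge> 2"
    define P where "P = primes_upto N"
    have fP: "finite P" and prP: "\<And>q. q \<in> P \<Longrightarrow> prime q" and P2: "\<And>q. q \<in> P \<Longrightarrow> q \<ge> 2"
      using primes_upto_prime primes_upto_ge_2 by (auto simp: P_def)
    have R: "R > 0" "R \<ge> 1" and lR: "ln R \<ge> 1" and p: "p \<ge> 2" "real p \<ge> 1" using as by auto
    have lp: "ln (real p) \<ge> 0" using p by simp
    define y where "y = (\<lambda>C. \<Sum>A\<in>Pow P. if C \<subseteq> A then sieve_wt R p A * (\<Prod>q\<in>A. rho q) else 0)"
    define k where "k = (\<lambda>C::nat set. \<Prod>q\<in>C. 2 * inv_loss q ^ 4)"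
    define c where "c = (\<lambda>C::nat set. real (\<Prod>C))"
    have k0: "k C \<ge> 0" for C by (auto simp: k_def intro!: prod_nonneg)
    have c1: "c C \<ge> 1" if "C \<in> Pow P" for C unfolding c_def by (rule prod_primes_ge_1) (use prP that in auto)
    define T where "T = (\<lambda>C. (\<Prod>q\<in>C. (1 - rho q) / rho q) * (y C)\<^sup>2)"
    have Q: "(\<Sum>A\<in>Pow P. \<Sum>B\<in>Pow P. sieve_wt R p A * sieve_wt R p B * (\<Prod>q\<in>A \<union> B. rho q)) = (\<Sum>C\<in>Pow P. T C)"
      unfolding T_def y_def by (rule selberg_diagonalisation [OF fP]) (use rho_bounds P2 in auto)
    (* Each value of the sieve sum is within M * e of the same constant u, hence the difference of two is at most 2 M e. *)
    define D where "D = 4 * K0\<^sup>2 / (ln R) ^ 4"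
    have D0: "D \<ge> 0" by (simp add: D_def)
    have tm: "T C \<le> (if c C \<le> R then D * (k C / c C * (inv_log (R / real p / c C))\<^sup>2) else 0)" if C: "C \<in> Pow P" for C
    proof -
      have CP: "C \<subseteq> P" using C by simp
      define a b where "a = subshifts (P - C) rho log_sq (R / c C)" and "b = subshifts (P - C) rho log_sq (R / real p / c C)"
      have yC: "y C = (\<Prod>q\<in>C. - rho q) * ((a - b) / (ln R)\<^sup>2)"
        unfolding y_def a_def b_def c_def by (rule sieve_wt_row [OF fP CP])
      have cc: "c C > 0" using c1 [OF C] by simp
      have pc: "0 < R / real p / c C" "R / real p / c C \<le> R / c C"
      proof -
        show "0 < R / real p / c C" using R p cc by simp
        have "R / real p \<le> R" using R p by (simp add: divide_le_eq mult_left_mono [of 1 "real p" R, simplified])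
        thus "R / real p / c C \<le> R / c C" using cc by (intro divide_right_mono) auto
      qed
      show ?thesis
      proof (cases "c C \<le> R")
        case False
        hence "R / c C \<le> 1" using cc by (simp add: divide_le_eq)
        hence le1: "R / c C \<le> 1" "R / real p / c C \<le> 1" using pc(2) by (auto intro: order_trans)
        have "0 < R / c C" using R cc by simp
        have "a = 0" unfolding a_def by (rule subshifts_zero [OF _ log_sq_zero]) (use prP le1 \<open>0 < R / c C\<close> in blast)+
        moreover have "b = 0" unfolding b_def by (rule subshifts_zero [OF _ log_sq_zero]) (use prP le1 pc in blast)+
        ultimately        show ?thesis using False yC by (simp add: T_def)
      next
        case True
        define M where "M = K0 * (\<Prod>q\<in>C. (inv_loss q)\<^sup>2)"
        define e where "e = inv_log (R / real p / c C)"
        obtain u where u: "nearly (real (Suc N)) (subshifts (P - C) rho log_sq) u M"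
          using K0(2) [of C N] CP unfolding M_def P_def by auto
        have M0: "M \<ge> 0" using K0(1) by (auto simp: M_def intro!: mult_nonneg_nonneg prod_nonneg)
        have RcN: "R / c C \<le> real (Suc N)"
        proof -
          have "R / c C \<le> R" using R c1 [OF C] by (simp add: divide_le_eq mult_left_mono [of 1 "c C" R, simplified])
          thus ?thesis using as by linarith
        qed
        have "\<bar>a - u\<bar> \<le> M * inv_log (R / c C)" using u RcN R cc unfolding nearly_def a_def by auto
        also have "\<dots> \<le> M * e" unfolding e_def by (rule mult_left_mono [OF inv_log_antimono [OF pc] M0])
        finally have au: "\<bar>a - u\<bar> \<le> M * e" .
        have bu: "\<bar>b - u\<bar> \<le> M * e" using u RcN pc unfolding nearly_def b_def e_def by (metis order_trans)
        have "\<bar>a - b\<bar> \<le> 2 * (M * e)" using au bu by linarith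
        hence ab: "(a - b)\<^sup>2 \<le> (2 * (M * e))\<^sup>2" by (metis abs_ge_zero power2_abs power_mono)
        have "(\<Prod>q\<in>C. (1 - rho q) / rho q) * (\<Prod>q\<in>C. - rho q)\<^sup>2 = (\<Prod>q\<in>C. (1 - rho q) / rho q * (rho q)\<^sup>2)"
          unfolding prod_power_distrib prod.distrib [symmetric] by simp
        also have "\<dots> \<le> (\<Prod>q\<in>C. 2 / real q)"
        proof (rule prod_mono)
          fix q assume "q \<in> C"
          hence "q \<ge> 2" using P2 CP by auto
          note r = rho_bounds [OF this]
          have "(1 - rho q) / rho q * (rho q)\<^sup>2 = (1 - rho q) * rho q" using r by (simp add: power2_eq_square)
          moreover have "(1 - rho q) * rho q \<le> 1 * (2 / real q)" using r by (intro mult_mono) auto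
          ultimately show "0 \<le> (1 - rho q) / rho q * (rho q)\<^sup>2 \<and> (1 - rho q) / rho q * (rho q)\<^sup>2 \<le> 2 / real q"
            using r by simp
        qed
        finally have pr: "(\<Prod>q\<in>C. (1 - rho q) / rho q) * (\<Prod>q\<in>C. - rho q)\<^sup>2 \<le> (\<Prod>q\<in>C. 2 / real q)" .
        have "T C = ((\<Prod>q\<in>C. (1 - rho q) / rho q) * (\<Prod>q\<in>C. - rho q)\<^sup>2) * ((a - b)\<^sup>2 / (ln R) ^ 4)"
          by (simp add: T_def yC power_mult_distrib power_divide flip: power_mult)
        also have "\<dots> \<le> (\<Prod>q\<in>C. 2 / real q) * ((2 * (M * e))\<^sup>2 / (ln R) ^ 4)"
          using pr ab lR by (intro mult_mono divide_right_mono prod_nonneg) auto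
        also have "(2 * (M * e))\<^sup>2 = 4 * K0\<^sup>2 * (\<Prod>q\<in>C. inv_loss q ^ 4) * e\<^sup>2"
          by (simp add: M_def power_mult_distrib prod_power_distrib flip: power_mult)
        also have "(\<Prod>q\<in>C. 2 / real q) * (4 * K0\<^sup>2 * (\<Prod>q\<in>C. inv_loss q ^ 4) * e\<^sup>2 / (ln R) ^ 4) = D * (k C / c C * e\<^sup>2)"
          by (simp add: D_def k_def c_def prod_dividef prod.distrib mult_ac)
        finally show ?thesis using True by (simp add: e_def)
      qed
    qed
    obtain I where I: "2 ^ I \<le> R" "R < 2 ^ Suc I" using power_two_bracket [OF R(2)] by blast
    (* The dyadic pieces 2^i \<le> R/c < 2^(i+1) are replaced by the larger sets c \<le> R/2^i, for which the count is available. *)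
    define f where "f = (\<lambda>i. 2 ^ Suc i / R * (inv_log (2 ^ i / real p))\<^sup>2)"
    have f0: "f i \<ge> 0" for i using R by (simp add: f_def)
    have pw: "1 / c C * (inv_log (R / real p / c C))\<^sup>2 \<le> (\<Sum>i\<le>I. if c C \<le> R / 2 ^ i then f i else 0)"
      if C: "C \<in> Pow P" "c C \<le> R" for C
    proof -
      have cc: "c C \<ge> 1" by (rule c1 [OF C(1)])
      have "R / c C \<ge> 1" using C cc by (simp add: le_divide_eq)
      then obtain i where i: "2 ^ i \<le> R / c C" "R / c C < 2 ^ Suc i" using power_two_bracket by blast
      have "R / c C \<le> R" using R cc by (simp add: divide_le_eq mult_left_mono [of 1 "c C" R, simplified])
      hence "(2::real) ^ i < 2 ^ Suc I" using i(1) I(2) by linarith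
      hence iI: "i \<le> I" by (simp add: power_strict_increasing_iff del: power_Suc)
      have ci: "c C \<le> R / 2 ^ i" using i(1) cc by (simp add: field_simps)
      have "1 / c C \<le> 2 ^ Suc i / R" using i(2) cc R by (simp add: field_simps)
      moreover have "(inv_log (R / real p / c C))\<^sup>2 \<le> (inv_log (2 ^ i / real p))\<^sup>2"
      proof (intro power_mono inv_log_antimono)
        have "2 ^ i / real p \<le> R / c C / real p" using i(1) by (intro divide_right_mono) auto
        thus "2 ^ i / real p \<le> R / real p / c C" by (simp add: mult.commute)
      qed (use p inv_log_pos in \<open>auto intro: less_imp_le\<close>)
      ultimately have "1 / c C * (inv_log (R / real p / c C))\<^sup>2 \<le> f i"
        unfolding f_def using R by (intro mult_mono) auto
      also have "f i = (if c C \<le> R / 2 ^ i then f i else 0)" using ci by simp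
      also have "\<dots> \<le> (\<Sum>i\<le>I. if c C \<le> R / 2 ^ i then f i else 0)"
        by (rule member_le_sum) (use iI f0 in auto)
      finally show ?thesis .
    qed
    have "(\<Sum>C\<in>Pow P. T C) \<le> (\<Sum>C\<in>Pow P. D * (\<Sum>i\<le>I. if c C \<le> R / 2 ^ i then f i * k C else 0))"
    proof (rule sum_mono)
      fix C assume C: "C \<in> Pow P"
      have nn: "(\<Sum>i\<le>I. if c C \<le> R / 2 ^ i then f i * k C else 0) \<ge> 0" by (intro sum_nonneg) (auto simp: f0 k0)
      show "T C \<le> D * (\<Sum>i\<le>I. if c C \<le> R / 2 ^ i then f i * k C else 0)"
      proof (cases "c C \<le> R")
        case True
        have "T C \<le> D * (k C * (1 / c C * (inv_log (R / real p / c C))\<^sup>2))" using tm [OF C] True by simp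
        also have "\<dots> \<le> D * (k C * (\<Sum>i\<le>I. if c C \<le> R / 2 ^ i then f i else 0))"
          by (intro mult_left_mono pw C True k0 D0)
        also have "k C * (\<Sum>i\<le>I. if c C \<le> R / 2 ^ i then f i else 0) = (\<Sum>i\<le>I. if c C \<le> R / 2 ^ i then f i * k C else 0)"
          unfolding sum_distrib_left by (rule sum.cong) auto
        finally show ?thesis .
      next
        case False
        hence "T C \<le> 0" using tm [OF C] by simp
        thus ?thesis using mult_nonneg_nonneg [OF D0 nn] by (rule order_trans)
      qed
    qed
    also have "\<dots> = D * (\<Sum>i\<le>I. f i * (\<Sum>C\<in>{C\<in>Pow P. c C \<le> R / 2 ^ i}. k C))"
    proof -
      have "(\<Sum>C\<in>Pow P. \<Sum>i\<le>I. if c C \<le> R / 2 ^ i then f i * k C else 0) = (\<Sum>i\<le>I. \<Sum>C\<in>Pow P. if c C \<le> R / 2 ^ i then f i * k C else 0)"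
        by (rule sum.swap)
      also have "\<dots> = (\<Sum>i\<le>I. f i * (\<Sum>C\<in>{C\<in>Pow P. c C \<le> R / 2 ^ i}. k C))"
        unfolding sum_distrib_left by (intro sum.cong refl sum.inter_filter [symmetric]) (use fP in simp)
      finally show ?thesis by (simp only: sum_distrib_left [symmetric])
    qed
    also have "\<dots> \<le> D * (\<Sum>i\<le>I. 2 * count_const * (1 + ln R) * (inv_log (2 ^ i / real p))\<^sup>2)"
    proof (rule mult_left_mono [OF _ D0], rule sum_mono)
      fix i assume "i \<in> {..I}"
      hence "(2::real) ^ i \<le> 2 ^ I" by (intro power_increasing) auto
      hence "2 ^ i \<le> R" using I(1) by (rule order_trans)
      hence Ri: "R / 2 ^ i \<ge> 1" by (simp add: le_divide_eq)
      have "(\<Sum>C\<in>{C\<in>Pow P. c C \<le> R / 2 ^ i}. k C) \<le> count_const * (R / 2 ^ i * (1 + ln (R / 2 ^ i)))"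
        unfolding c_def k_def by (rule weighted_count [OF Ri P_def])
      also have "\<dots> \<le> count_const * (R / 2 ^ i * (1 + ln R))"
      proof (intro mult_left_mono add_left_mono)
        have "R / 2 ^ i \<le> R" using R by (simp add: divide_le_eq mult_left_mono [of 1 "2 ^ i" R, simplified])
        moreover have "0 < R / 2 ^ i" using Ri by linarith
        ultimately show "ln (R / 2 ^ i) \<le> ln R" by (metis R(1) ln_le_cancel_iff)
      qed (use KV0 R in auto)
      finally have "f i * (\<Sum>C\<in>{C\<in>Pow P. c C \<le> R / 2 ^ i}. k C) \<le> f i * (count_const * (R / 2 ^ i * (1 + ln R)))"
        by (rule mult_left_mono [OF _ f0])
      also have "\<dots> = 2 * count_const * (1 + ln R) * (inv_log (2 ^ i / real p))\<^sup>2" using R by (simp add: f_def)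
      finally show "f i * (\<Sum>C\<in>{C\<in>Pow P. c C \<le> R / 2 ^ i}. k C) \<le> 2 * count_const * (1 + ln R) * (inv_log (2 ^ i / real p))\<^sup>2" .
    qed
    also have "\<dots> = D * (2 * count_const * (1 + ln R) * (\<Sum>i\<le>I. (inv_log (2 ^ i / real p))\<^sup>2))" by (simp only: sum_distrib_left)
    also have "\<dots> \<le> D * (2 * count_const * (2 * ln R) * (9 * (ln (real p) + 1)))"
    proof (intro mult_left_mono mult_mono D0)
      have "(\<Sum>i\<le>I. (inv_log (2 ^ i / real p))\<^sup>2) \<le> 2 * ln (real p) + 9" by (rule sum_inv_log_powers [OF p(1)])
      also have "\<dots> \<le> 9 * (ln (real p) + 1)" using lp by simp
      finally show "(\<Sum>i\<le>I. (inv_log (2 ^ i / real p))\<^sup>2) \<le> 9 * (ln (real p) + 1)" .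
    qed (use KV0 lR in \<open>auto intro!: sum_nonneg\<close>)
    also have "\<dots> = 144 * K0\<^sup>2 * count_const * (ln (real p) + 1) / (ln R) ^ 3"
      using lR by (simp add: D_def field_simps eval_nat_numeral)
    finally show "(\<Sum>A\<in>Pow (primes_upto N). \<Sum>B\<in>Pow (primes_upto N). sieve_wt R p A * sieve_wt R p B * (\<Prod>q\<in>A \<union> B. rho q)) \<le> 144 * K0\<^sup>2 * count_const * (ln (real p) + 1) / (ln R) ^ 3"
      using Q unfolding P_def by simp
  qed
qed

section \<open>Squarefree numbers as sets of primes\<close>

lemma divisors_prod_primes:
  assumes "finite S" "\<And>q. q \<in> S \<Longrightarrow> prime (q::nat)"
  shows "{d. d dvd \<Prod>S} = (\<lambda>A. \<Prod>A) ` Pow S"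
  using assms
proof (induction S rule: finite_induct)
  case (insert q S)
  have q: "prime q" using insert by auto
  have "{d. d dvd q * \<Prod>S} = {d. d dvd \<Prod>S} \<union> (\<lambda>e. q * e) ` {d. d dvd \<Prod>S}"
  proof (intro equalityI subsetI)
    fix d assume "d \<in> {d. d dvd q * \<Prod>S}"
    hence d: "d dvd q * \<Prod>S" by simp
    show "d \<in> {d. d dvd \<Prod>S} \<union> (\<lambda>e. q * e) ` {d. d dvd \<Prod>S}"
    proof (cases "q dvd d")
      case True
      then obtain e where "d = q * e" by auto
      thus ?thesis using d q prime_gt_0_nat [of q] by auto
    next
      case False
      hence "coprime q d" by (rule prime_imp_coprime [OF q])
      hence "coprime d q" by (rule coprime_imp_coprime) auto
      hence "d dvd \<Prod>S" using d by (simp add: coprime_dvd_mult_right_iff)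
      thus ?thesis by simp
    qed
  qed auto
  also have "\<dots> = (\<lambda>A. \<Prod>A) ` Pow S \<union> (\<lambda>e. q * e) ` ((\<lambda>A. \<Prod>A) ` Pow S)"
    using insert by simp
  also have "(\<lambda>e. q * e) ` ((\<lambda>A. \<Prod>A) ` Pow S) = (\<lambda>A. \<Prod>A) ` (insert q ` Pow S)"
  proof -
    have "q * \<Prod>A = \<Prod>(insert q A)" if "A \<in> Pow S" for A
    proof -
      have "finite A" "q \<notin> A" using that insert.hyps finite_subset by auto
      thus ?thesis by simp
    qed
    thus ?thesis unfolding image_image by (rule image_cong [OF refl])
  qed
  finally show ?case using insert.hyps by (simp add: Pow_insert image_Un)
qed simp

lemma prime_factors_prod_primes:
  assumes "finite A" "\<And>q. q \<in> A \<Longrightarrow> prime (q::nat)"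
  shows "prime_factors (\<Prod>A) = A"
proof (intro equalityI subsetI)
  fix q assume "q \<in> prime_factors (\<Prod>A)"
  thus "q \<in> A" using prime_dvd_prod_primes [OF assms] by (auto simp: in_prime_factors_iff)
next
  fix q assume "q \<in> A"
  moreover have "q dvd \<Prod>A" using calculation assms(1) by (metis dvd_prod_eqI dvd_refl)
  moreover have "\<Prod>A > 0" by (rule prod_primes_pos [OF assms(2)])
  ultimately show "q \<in> prime_factors (\<Prod>A)" using assms(2) by (simp add: in_prime_factors_iff)
qed

lemma squarefree_prod_primes:
  assumes "finite A" "\<And>q. q \<in> A \<Longrightarrow> prime (q::nat)"
  shows "squarefree (\<Prod>A)"
  using assms
proof (induction A rule: finite_induct)
  case (insert q A)
  have "\<not> q dvd \<Prod>A" using prime_dvd_prod_primes [of A q] insert by auto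
  hence "coprime q (\<Prod>A)" using insert by (intro prime_imp_coprime) auto
  moreover have "squarefree q" using insert by (simp add: squarefree_prime)
  ultimately show ?case using insert by (simp add: squarefree_mult_coprime)
qed simp

lemma moebius_prod_primes:
  assumes "finite A" "\<And>q. q \<in> A \<Longrightarrow> prime q"
  shows "moebius_mu (\<Prod>A) = (\<Prod>q\<in>A. -1)"
  using squarefree_prod_primes [OF assms] prime_factors_prod_primes [OF assms] by (simp add: moebius_mu_def omega_def)

lemma squarefree_eq_prod:
  assumes "squarefree (n::nat)"
  shows "n = \<Prod>(prime_factors n)"
proof -
  have n0: "n > 0" using assms by (intro Nat.gr0I) auto
  have "n = (\<Prod>p\<in>prime_factors n. p ^ multiplicity p n)" by (rule prime_factorization_nat [OF n0])
  also have "\<dots> = (\<Prod>p\<in>prime_factors n. p)"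
  proof (rule prod.cong [OF refl])
    fix p assume "p \<in> prime_factors n"
    hence p: "prime p" "p dvd n" by (auto simp: in_prime_factors_iff)
    have "multiplicity p n = 1"
    proof -
      have "multiplicity p n < 2"
      proof (rule ccontr)
        assume "\<not> multiplicity p n < 2"
        hence "p ^ 2 dvd n" by (intro multiplicity_dvd') auto
        hence "p dvd 1" using assms by (auto simp: squarefree_def)
        thus False using p by auto
      qed
      moreover have "multiplicity p n > 0" using p n0 by (simp add: prime_multiplicity_gt_zero_iff)
      ultimately show ?thesis by simp
    qed
    thus "p ^ multiplicity p n = p" by simp
  qed
  finally show ?thesis .
qed

lemma G0_log_sq:
  assumes "R > 1" "d \<ge> 1"
  shows "G0 (ln (R / real d) / ln R) * of_bool (real d \<le> R) = log_sq (R / real d) / (ln R)\<^sup>2"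
proof -
  have lR: "ln R > 0" and d: "real d > 0" using assms by auto
  show ?thesis
  proof (cases "real d \<le> R")
    case True
    hence "ln (R / real d) \<ge> 0" using d by simp
    moreover have "ln (R / real d) / ln R \<ge> 0" using calculation lR by (intro divide_nonneg_pos)
    ultimately show ?thesis using True by (simp add: G0_def log_sq_def max_absorb1 max_absorb2 power_divide)
  next
    case False
    hence "R / real d \<le> 1" "0 < R / real d" using d assms by auto
    thus ?thesis using False by (simp add: log_sq_zero)
  qed
qed

text \<open>The divisors of \<open>pn\<close> are the products of subsets of the prime factors of \<open>pn\<close>; subsets with and without \<open>p\<close> are
paired.\<close>

lemma Lambda0_eq:
  assumes R: "R > 1" and p: "prime p" and n: "squarefree n" "\<not> p dvd n" "n \<le> N"
  shows "Lambda0 R (p * n) = sieve_val (primes_upto N) (sieve_wt R p) n"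
proof -
  define S where "S = prime_factors n"
  have S: "finite S" "\<And>q. q \<in> S \<Longrightarrow> prime q" "n = \<Prod>S" "p \<notin> S"
    using squarefree_eq_prod [OF n(1)] n(2) by (auto simp: S_def in_prime_factors_iff)
  have n0: "n > 0" using n(1) by (intro Nat.gr0I) auto
  define h where "h = (\<lambda>d. moebius_mu d * G0 (ln (R / real d) / ln R) * of_bool (real d \<le> R))"
  define T where "T = insert p S"
  have T: "finite T" "\<And>q. q \<in> T \<Longrightarrow> prime q" "p * n = \<Prod>T" using S p by (auto simp: T_def)
  have hA: "h (\<Prod>A) = (\<Prod>q\<in>A. -1) * (log_sq (R / real (\<Prod>A)) / (ln R)\<^sup>2)" if "A \<in> Pow T" for A
  proof -
    have A: "finite A" "\<And>q. q \<in> A \<Longrightarrow> prime q" using that T finite_subset by auto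
    have "\<Prod>A > 0" by (rule prod_primes_pos) (rule A(2))
    hence "\<Prod>A \<ge> 1" by simp
    thus ?thesis unfolding h_def mult.assoc by (simp only: G0_log_sq [OF R] moebius_prod_primes [OF A])
  qed
  have dv: "{d. d dvd \<Prod>T} = (\<lambda>A. \<Prod>A) ` Pow T" by (rule divisors_prod_primes) (use T in auto)
  have inj: "inj_on (\<lambda>A. \<Prod>A) (Pow T)" by (rule inj_on_prod_primes) (use T in auto)
  have "Lambda0 R (p * n) = (\<Sum>d\<in>(\<lambda>A. \<Prod>A) ` Pow T. h d)"
    unfolding Lambda0_def T(3) dv h_def ..
  also have "\<dots> = (\<Sum>A\<in>Pow T. h (\<Prod>A))" by (simp only: sum.reindex [OF inj] o_def)
  also have "\<dots> = (\<Sum>A\<in>Pow T. (\<Prod>q\<in>A. -1) * (log_sq (R / real (\<Prod>A)) / (ln R)\<^sup>2))" by (intro sum.cong refl hA)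
  also have "\<dots> = (\<Sum>A\<in>Pow S. (\<Prod>q\<in>A. -1) * (log_sq (R / real (\<Prod>A)) / (ln R)\<^sup>2) + (\<Prod>q\<in>insert p A. -1) * (log_sq (R / real (\<Prod>(insert p A))) / (ln R)\<^sup>2))"
    unfolding T_def by (rule sum_Pow_insert [OF S(1,4)])
  also have "\<dots> = (\<Sum>A\<in>Pow S. sieve_wt R p A)"
  proof (rule sum.cong [OF refl])
    fix A assume "A \<in> Pow S"
    hence A: "finite A" "p \<notin> A" using S finite_subset by auto
    have 1: "(\<Prod>q\<in>insert p A. -1) = - (\<Prod>q\<in>A. -1 :: real)" by (subst prod.insert [OF A]) simp
    have 2: "R / real (\<Prod>(insert p A)) = R / real p / real (\<Prod>A)" by (subst prod.insert [OF A]) (simp del: of_nat_prod)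
    show "(\<Prod>q\<in>A. -1) * (log_sq (R / real (\<Prod>A)) / (ln R)\<^sup>2) + (\<Prod>q\<in>insert p A. -1) * (log_sq (R / real (\<Prod>(insert p A))) / (ln R)\<^sup>2) = sieve_wt R p A"
    proof -
      have "e * (x / s) + (- e) * (y / s) = e * ((x - y) / s)" for e x y s :: real
        by (simp add: diff_divide_distrib right_diff_distrib)
      thus ?thesis unfolding 1 2 sieve_wt_def .
    qed
  qed
  also have "\<dots> = (\<Sum>A\<in>Pow (primes_upto N). if A \<subseteq> S then sieve_wt R p A else 0)"
  proof -
    have "q \<le> N" if "q \<in> S" for q
    proof -
      have "q dvd n" using that by (auto simp: S_def in_prime_factors_iff)
      thus ?thesis using dvd_imp_le [OF _ n0] n(3) by (meson order_trans)
    qed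
    hence "{A\<in>Pow (primes_upto N). A \<subseteq> S} = Pow S" using S(2) by (auto simp: primes_upto_def)
    thus ?thesis using sum.inter_filter [of "Pow (primes_upto N)" "sieve_wt R p" "\<lambda>A. A \<subseteq> S"] by simp
  qed
  also have "\<dots> = sieve_val (primes_upto N) (sieve_wt R p) n"
    unfolding S_def by (rule sieve_val_prime_factors [OF n0 primes_upto_prime, symmetric])
  finally show ?thesis .
qed

lemma test_function_bounded:
  assumes "test_function_on {0<..} g" "supp_on {0<..} g \<subseteq> {1..2}"
  shows "\<exists>M\<ge>1. \<forall>x>0. \<bar>g x\<bar> \<le> M" "x > 0 \<Longrightarrow> x \<notin> {1..2} \<Longrightarrow> g x = 0"
proof -
  show z: "g x = 0" if "x > 0" "x \<notin> {1..2}" for x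
  proof (rule ccontr)
    assume "g x \<noteq> 0"
    hence "x \<in> support_on {0<..} g" using that by (simp add: support_on_def)
    hence "x \<in> supp_on {0<..} g" using closure_subset that by (auto simp: supp_on_def)
    thus False using assms(2) that by auto
  qed
  have "(deriv ^^ 0) g differentiable_on {0<..}" using assms(1) unfolding test_function_on_def smooth_on_def by blast
  hence "continuous_on {1..2} g" by (simp, intro continuous_on_subset [OF differentiable_imp_continuous_on]) auto
  hence "compact (g ` {1..2})" by (intro compact_continuous_image) auto
  then obtain B where B: "\<And>y. y \<in> g ` {1..2} \<Longrightarrow> \<bar>y\<bar> \<le> B"
    using compact_imp_bounded bounded_iff by (metis real_norm_def)
  have "\<bar>g x\<bar> \<le> max 1 B" if "x > 0" for x
  proof (cases "x \<in> {1..2}")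
    case True thus ?thesis using B [of "g x"] by auto
  next
    case False thus ?thesis using z that by auto
  qed
  thus "\<exists>M\<ge>1. \<forall>x>0. \<bar>g x\<bar> \<le> M" by (intro exI [of _ "max 1 B"]) auto
qed

text \<open>The support of \<open>g\<close> restricts \<open>n\<close> to \<open>[Y, 2Y]\<close>, which lies in the block \<open>(Y/2, 2Y]\<close>. Dropping the conditions that \<open>n\<close> is
squarefree and prime to \<open>p\<close> only adds nonnegative terms.\<close>

lemma infsum_le_sieve_sum:
  assumes g: "\<And>x. x > 0 \<Longrightarrow> \<bar>g x\<bar> \<le> M" "\<And>x. x > 0 \<Longrightarrow> x \<notin> {1..2} \<Longrightarrow> g x = 0"
    and R: "R > 1" and p: "prime p" and Y: "Y > 0" and N: "2 * Y \<le> real N" and M: "M \<ge> 1"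
  shows "\<bar>\<Sum>\<^sub>\<infinity>n\<in>{n::nat. n \<ge> 1 \<and> \<not> p dvd n}. g (real n / Y) * (moebius_mu n)\<^sup>2 * 2 ^ omega n * (Lambda0 R (p * n))\<^sup>2\<bar>
    \<le> M * (sieve_sum (primes_upto N) (sieve_wt R p) (4 * (Y / 2)) - sieve_sum (primes_upto N) (sieve_wt R p) (Y / 2))"
proof -
  define t where "t = (\<lambda>n. g (real n / Y) * (moebius_mu n)\<^sup>2 * 2 ^ omega n * (Lambda0 R (p * n))\<^sup>2)"
  define D where "D = multiples {} (4 * (Y / 2)) - multiples {} (Y / 2)"
  define E where "E = {n\<in>D. \<not> p dvd n}"
  have fD: "finite D" by (simp add: D_def)
  have "infsum t {n. n \<ge> 1 \<and> \<not> p dvd n} = infsum t E"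
  proof (rule infsum_cong_neutral)
    fix n assume n: "n \<in> {n. n \<ge> 1 \<and> \<not> p dvd n} - E"
    hence "n \<notin> D" "n \<ge> 1" by (auto simp: E_def)
    hence "real n \<le> Y / 2 \<or> real n > 2 * Y" by (auto simp: D_def multiples_def)
    hence "real n / Y \<notin> {1..2}" "real n / Y > 0" using Y \<open>n \<ge> 1\<close> by (auto simp: field_simps)
    thus "t n = 0" using g(2) by (simp add: t_def)
  qed (auto simp: E_def D_def multiples_def)
  also have "\<dots> = (\<Sum>n\<in>E. t n)" by (rule infsum_finite) (use fD in \<open>simp add: E_def\<close>)
  finally have "\<bar>infsum t {n. n \<ge> 1 \<and> \<not> p dvd n}\<bar> \<le> (\<Sum>n\<in>E. \<bar>t n\<bar>)" by (simp add: sum_abs)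
  also have "\<dots> \<le> (\<Sum>n\<in>E. M * (real (tau n) * (sieve_val (primes_upto N) (sieve_wt R p) n)\<^sup>2))"
  proof (rule sum_mono)
    fix n assume "n \<in> E"
    hence n: "n \<ge> 1" "real n \<le> 2 * Y" "\<not> p dvd n" by (auto simp: E_def D_def multiples_def)
    show "\<bar>t n\<bar> \<le> M * (real (tau n) * (sieve_val (primes_upto N) (sieve_wt R p) n)\<^sup>2)"
    proof (cases "squarefree n")
      case True
      define S where "S = prime_factors n"
      have S: "n = \<Prod>S" using squarefree_eq_prod [OF True] by (simp add: S_def)
      have "tau n = 2 ^ omega n"
        unfolding omega_def S_def [symmetric] by (subst S, rule tau_prod_primes) (auto simp: S_def)
      hence tau: "2 ^ omega n = real (tau n)" by simp
      have "n \<le> N" using n(2) N by linarith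
      hence L: "Lambda0 R (p * n) = sieve_val (primes_upto N) (sieve_wt R p) n" by (intro Lambda0_eq R p True n(3))
      have mu: "(moebius_mu n)\<^sup>2 = 1" using True by (simp add: moebius_mu_def flip: power_mult)
      have "\<bar>t n\<bar> = \<bar>g (real n / Y)\<bar> * (real (tau n) * (sieve_val (primes_upto N) (sieve_wt R p) n)\<^sup>2)"
        unfolding t_def mu tau L by (simp add: abs_mult)
      also have "\<dots> \<le> M * (real (tau n) * (sieve_val (primes_upto N) (sieve_wt R p) n)\<^sup>2)"
        using g(1) [of "real n / Y"] n Y by (intro mult_right_mono) auto
      finally show ?thesis .
    next
      case False
      hence "t n = 0" by (simp add: t_def moebius_mu_def)
      thus ?thesis using M by simp
    qed
  qed
  also have "\<dots> \<le> (\<Sum>n\<in>D. M * (real (tau n) * (sieve_val (primes_upto N) (sieve_wt R p) n)\<^sup>2))"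
    by (rule sum_mono2 [OF fD]) (use M in \<open>auto simp: E_def\<close>)
  also have "\<dots> = M * (sieve_sum (primes_upto N) (sieve_wt R p) (4 * (Y / 2)) - sieve_sum (primes_upto N) (sieve_wt R p) (Y / 2))"
  proof -
    have sub: "multiples {} (Y / 2) \<subseteq> multiples {} (4 * (Y / 2))" using Y by (auto simp: multiples_def)
    show ?thesis unfolding sieve_sum_def D_def sum_diff [OF finite_multiples sub, symmetric] sum_distrib_left ..
  qed
  finally show ?thesis by (simp add: t_def)
qed

section \<open>The bound for one dyadic sum\<close>

text \<open>\<open>N\<close> is so large that about \<open>L = log Y\<close> blocks after \<open>Y/2\<close>, which reach at most \<open>2Y\<^sup>3\<close> because \<open>4^L \<le> Y\<^sup>2\<close>, involve only
primes up to \<open>N\<close>; it is still a fixed power of \<open>Y\<close>, so that \<open>log N = O(log Y)\<close>.\<close>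

lemma dyadic_sum_bound:
  assumes Q: "K \<ge> 0" "\<And>N. R \<le> real (Suc N) \<Longrightarrow>
      (\<Sum>A\<in>Pow (primes_upto N). \<Sum>B\<in>Pow (primes_upto N). sieve_wt R p A * sieve_wt R p B * (\<Prod>q\<in>A \<union> B. rho q)) \<le> K * (ln (real p) + 1) / (ln R) ^ 3"
    and Y: "Y > exp 1" and R: "R > 1" "R \<le> Y powr (1/3)" "Y powr (1/5) \<le> R" and p: "prime p"
    and N: "N = nat \<lceil>2 * Y ^ 3\<rceil>"
  shows "(sieve_sum (primes_upto N) (sieve_wt R p) (4 * (Y / 2)) - sieve_sum (primes_upto N) (sieve_wt R p) (Y / 2)) / (Y / 2)
     \<le> (25000 * (20 ^ 4 * 80)\<^sup>2 * K + 13824 * tau_const * exp (9 * (\<Sum>n. real (Suc n) powr (- (9/8))))) * ((ln (real p) + 1) / (ln Y)\<^sup>2)"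
proof -
  define P where "P = primes_upto N"
  define w where "w = sieve_wt R p"
  define L where "L = ln Y"
  define l where "l = ln R"
  define X where "X = Y / 2"
  define Z0 :: real where "Z0 = 20 ^ 4 * 80"
  define EE where "EE = exp (9 * (\<Sum>n. real (Suc n) powr (- (9/8))))"
  have Y0: "Y > 0" using Y exp_gt_zero order_less_trans by blast
  have Y2: "Y \<ge> 2" using Y exp_ge_add_one_self [of 1] by linarith
  have L1: "L \<ge> 1" unfolding L_def using Y Y0 by (subst ln_ge_iff) auto
  have p0: "p > 0" "ln (real p) \<ge> 0" using prime_gt_0_nat [OF p] prime_ge_1_nat [OF p] by auto
  have lL: "L \<le> 5 * l" "l \<le> L"
  proof -
    have "ln (Y powr (1/5)) \<le> ln R" using R Y0 by (subst ln_le_cancel_iff) auto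
    thus "L \<le> 5 * l" using Y0 by (simp add: ln_powr L_def l_def)
    have "ln R \<le> ln (Y powr (1/3))" using R Y0 by (subst ln_le_cancel_iff) auto
    hence "l \<le> L / 3" using Y0 by (simp add: ln_powr L_def l_def)
    thus "l \<le> L" using L1 by simp
  qed
  have l0: "l > 0" using lL L1 by simp
  have Y3: "Y ^ 3 \<ge> Y" "Y ^ 3 \<ge> 8"
    using power_increasing [of 1 3 Y] power_mono [of 2 Y 3] Y2 by auto
  have N1: "2 * Y ^ 3 \<le> real N" "real N \<le> 2 * Y ^ 3 + 1"
    unfolding N using Y3(2) by (auto simp: of_nat_nat intro: less_imp_le)
  have N3: "N \<ge> 3" using N1 Y3(2) by linarith
  have lnN: "ln (real N) \<le> 5 * L"
  proof -
    have "real N \<le> 3 * Y ^ 3" using N1 Y3(2) by linarith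
    also have "3 * Y ^ 3 \<le> Y ^ 2 * Y ^ 3" using power_mono [OF Y2, of 2] Y0 by (intro mult_right_mono) auto
    also have "\<dots> = Y ^ 5" by (simp flip: power_add)
    finally have "ln (real N) \<le> ln (Y ^ 5)" using N3 Y0 by (subst ln_le_cancel_iff) auto
    thus ?thesis using Y0 by (simp add: ln_realpow L_def)
  qed
  have RN: "R \<le> real (Suc N)"
  proof -
    have "Y powr (1/3) \<le> Y powr 1" using Y2 by (intro powr_mono) auto
    hence "R \<le> Y" using R Y0 by simp
    thus ?thesis using N1 Y3 by linarith
  qed
  define W where "W = (\<Sum>A\<in>Pow P. \<Sum>B\<in>Pow P. \<bar>w A\<bar> * \<bar>w B\<bar> * (\<Prod>q\<in>A \<union> B. 3 / sqrt (real q)))"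
  have W: "W \<le> EE * R powr (5/4)"
    unfolding W_def EE_def
  proof (rule error_sum_bound [where N = N])
    fix A assume "A \<in> Pow P"
    hence A: "\<And>a. a \<in> A \<Longrightarrow> prime a" using primes_upto_prime by (auto simp: P_def)
    show "\<bar>w A\<bar> \<le> 1" unfolding w_def by (rule sieve_wt_bounds(1) [OF R(1) p0(1) A])
    show "real (\<Prod>A) > R \<Longrightarrow> w A = 0" unfolding w_def by (rule sieve_wt_bounds(2) [OF R(1) p0(1) A])
  qed (use R in \<open>auto simp: P_def\<close>)
  define G where "G = (\<lambda>x. sieve_sum P w (4 * x) - sieve_sum P w x)"
  have G0: "G x \<ge> 0" if "x > 0" for x unfolding G_def using sieve_sum_mono [of x "4 * x" P w] that by simp
  obtain a b where ab: "\<And>x. x > 0 \<Longrightarrow> \<bar>G x - x * (a * ln x + b)\<bar> \<le> 3 * tau_const * W * sqrt x"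
    using sieve_sum_asymptotic [of P w] primes_upto_prime unfolding G_def W_def P_def by auto
  define J where "J = nat \<lfloor>L\<rfloor>"
  have J: "real J \<le> L" "L \<le> real (J + 1)" using L1 by (auto simp: J_def) linarith+
  have X0: "X > 0" using Y0 by (simp add: X_def)
  have J4: "4 ^ (J + 1) * X \<le> real N"
  proof -
    have "(4::real) \<le> exp 2"
    proof -
      have "(2::real) * 2 \<le> exp 1 * exp 1" using exp_ge_add_one_self [of 1] by (intro mult_mono) auto
      thus ?thesis by (simp add: exp_add [symmetric])
    qed
    hence "(4::real) ^ J \<le> exp 2 ^ J" by (intro power_mono) auto
    also have "\<dots> = exp (2 * real J)" by (simp add: exp_of_nat_mult [symmetric] mult.commute)
    also have "\<dots> \<le> exp (2 * L)" using J by simp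
    also have "\<dots> = Y ^ 2" using Y0 by (simp add: L_def exp_double)
    finally have "4 ^ (J + 1) * X \<le> 4 * Y ^ 2 * X" using X0 by simp
    also have "\<dots> = 2 * Y ^ 3" by (simp add: X_def power2_eq_square power3_eq_cube)
    finally show ?thesis using N1 by linarith
  qed
  define q where "q = (ln (real p) + 1)"
  have q1: "q \<ge> 1" using p0 by (simp add: q_def)
  have sieve_logsum: "sieve_logsum P w (4 ^ (J + 1) * X) \<le> (Z0 * (5 * L))\<^sup>2 * (K * q / l ^ 3)"
  proof -
    define F where "F = (\<Sum>A\<in>Pow P. \<Sum>B\<in>Pow P. w A * w B * (\<Prod>q\<in>A \<union> B. rho q))"
    have F: "F \<le> K * q / l ^ 3" using Q(2) [OF RN] by (simp add: F_def P_def w_def q_def l_def)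
    have Kq: "K * q / l ^ 3 \<ge> 0" using Q(1) q1 l0 by simp
    have pk: "(\<Prod>q\<in>P. 1 + kappa q) \<ge> 0" by (rule prod_nonneg) (use kappa_pos primes_upto_ge_2 in \<open>force simp: P_def\<close>)
    have "sieve_logsum P w (4 ^ (J + 1) * X) \<le> (\<Prod>q\<in>P. 1 + kappa q) * F"
      unfolding F_def P_def by (rule sieve_logsum_le_selberg) (use J4 in simp)
    also have "\<dots> \<le> (\<Prod>q\<in>P. 1 + kappa q) * (K * q / l ^ 3)" using F pk by (intro mult_left_mono)
    also have "\<dots> \<le> (Z0 * ln (real N))\<^sup>2 * (K * q / l ^ 3)"
      unfolding P_def Z0_def by (intro mult_right_mono kappa_prod_mertens N3 Kq)
    also have "\<dots> \<le> (Z0 * (5 * L))\<^sup>2 * (K * q / l ^ 3)"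
      using lnN N3 Kq by (intro mult_right_mono power_mono mult_left_mono) (auto simp: Z0_def)
    finally show ?thesis .
  qed
  (* The average has 1/L, the product over primes L^2, and the quadratic form L^-3. *)
  have S: "2 / real (J + 1) * (\<Sum>j\<le>J. G (4 ^ j * X) / (4 ^ j * X)) \<le> 25000 * Z0\<^sup>2 * K * (q / L\<^sup>2)"
  proof -
    have s0: "(\<Sum>j\<le>J. G (4 ^ j * X) / (4 ^ j * X)) \<ge> 0" using G0 X0 by (intro sum_nonneg) auto
    have "(\<Sum>j\<le>J. G (4 ^ j * X) / (4 ^ j * X)) \<le> 4 * sieve_logsum P w (4 ^ (J + 1) * X)"
      unfolding G_def by (rule sum_blocks_le [OF X0])
    also have "\<dots> \<le> 4 * ((Z0 * (5 * L))\<^sup>2 * (K * q / l ^ 3))" using sieve_logsum by simp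
    also have "\<dots> \<le> 4 * ((Z0 * (5 * L))\<^sup>2 * (K * q / (L / 5) ^ 3))"
      using lL L1 Q(1) q1 l0 by (intro mult_left_mono divide_left_mono power_mono mult_pos_pos) auto
    finally have "2 / real (J + 1) * (\<Sum>j\<le>J. G (4 ^ j * X) / (4 ^ j * X)) \<le> 2 / L * (4 * ((Z0 * (5 * L))\<^sup>2 * (K * q / (L / 5) ^ 3)))"
      using s0 J L1 by (intro mult_mono divide_left_mono) auto
    also have "\<dots> = 25000 * Z0\<^sup>2 * K * (q / L\<^sup>2)" using L1 by (simp add: field_simps eval_nat_numeral)
    finally show ?thesis .
  qed
  have E: "4 * (3 * tau_const * W) / sqrt X \<le> 13824 * tau_const * EE * (q / L\<^sup>2)"
  proof -
    have TC0: "tau_const \<ge> 0" by (simp add: tau_const_def)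
    have EE0: "EE \<ge> 0" by (simp add: EE_def)
    have "R powr (5/4) \<le> (Y powr (1/3)) powr (5/4)" using R by (intro powr_mono2) auto
    also have "\<dots> = Y powr (5/12)" by (simp add: powr_powr)
    finally have R54: "R powr (5/4) \<le> Y powr (5/12)" .
    have sX: "1 / sqrt X \<le> 2 / sqrt Y"
    proof -
      have "sqrt Y \<le> 2 * sqrt X"
      proof -
        have "sqrt Y \<le> sqrt (4 * X)" using Y0 by (simp add: X_def)
        also have "\<dots> = 2 * sqrt X" by (simp add: real_sqrt_mult)
        finally show ?thesis .
      qed
      thus ?thesis using X0 Y0 by (simp add: field_simps)
    qed
    (* The saving Y^(1/12) of the error term pays for the two logarithms. *)
    have lnY: "L \<le> 24 * Y powr (1/24)"
    proof -
      have "ln (Y powr (1/24)) \<le> Y powr (1/24)" using Y0 ln_le_minus_one [of "Y powr (1/24)"] by simp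
      thus ?thesis using Y0 by (simp add: ln_powr L_def)
    qed
    have "L\<^sup>2 \<le> (24 * Y powr (1/24))\<^sup>2" using lnY L1 by (intro power_mono) auto
    also have "\<dots> = 576 * Y powr (1/12)" by (simp add: power_mult_distrib power2_eq_square powr_add [symmetric])
    finally have L2: "L\<^sup>2 \<le> 576 * Y powr (1/12)" .
    have "R powr (5/4) * (1 / sqrt X) \<le> Y powr (5/12) * (2 / sqrt Y)"
      using R54 sX by (intro mult_mono) (use X0 in auto)
    also have "\<dots> = 2 * Y powr (5/12 - 1/2)"
    proof -
      have "Y powr (1/2) = sqrt Y" using Y0 by (simp add: powr_half_sqrt)
      thus ?thesis unfolding powr_diff by simp
    qed
    also have "5/12 - 1/2 = - (1/12 :: real)" by simp
    also have "2 * Y powr (- (1/12)) = 2 / Y powr (1/12)" by (simp add: powr_minus_divide)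
    also have "\<dots> \<le> 2 * 576 / L\<^sup>2" using L2 Y0 L1 by (simp add: field_simps)
    also have "\<dots> \<le> 1152 * (q / L\<^sup>2)" using q1 L1 by (simp add: divide_right_mono)
    finally have main: "R powr (5/4) * (1 / sqrt X) \<le> 1152 * (q / L\<^sup>2)" .
    have "4 * (3 * tau_const * W) / sqrt X = 12 * tau_const * (W * (1 / sqrt X))" by simp
    also have "\<dots> \<le> 12 * tau_const * (EE * R powr (5/4) * (1 / sqrt X))"
      using W TC0 X0 by (intro mult_left_mono mult_right_mono) auto
    also have "\<dots> = 12 * tau_const * EE * (R powr (5/4) * (1 / sqrt X))" by (simp add: mult_ac)
    also have "\<dots> \<le> 12 * tau_const * EE * (1152 * (q / L\<^sup>2))" using main TC0 EE0 by (intro mult_left_mono) auto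
    finally show ?thesis by (simp add: mult_ac)
  qed
  have "G X / X \<le> 2 / real (J + 1) * (\<Sum>j\<le>J. G (4 ^ j * X) / (4 ^ j * X)) + 4 * (3 * tau_const * W) / sqrt X"
    by (rule linear_average [OF G0 ab X0])
  also have "\<dots> \<le> 25000 * Z0\<^sup>2 * K * (q / L\<^sup>2) + 13824 * tau_const * EE * (q / L\<^sup>2)" by (intro add_mono S E)
  also have "\<dots> = (25000 * Z0\<^sup>2 * K + 13824 * tau_const * EE) * (q / L\<^sup>2)" by (simp only: distrib_right)
  finally show ?thesis unfolding G_def P_def w_def X_def Z0_def EE_def q_def L_def .
qed

theorem corollary5p1:
  fixes g :: "real \<Rightarrow> real"
  assumes "test_function_on {0<..} g"
    and "supp_on {0<..} g \<subseteq> {1..2}"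
    and "\<forall>x>0. g x \<ge> 0"
    and "integral {0<..} g = 1"
  shows "\<exists>C1 C2. C1 > 0 \<and> C2 > 0 \<and>
    (\<forall>(Y::real) (R::real) (p::nat).
       Y > exp 1 \<and> R > 1 \<and> Y powr (1/5) \<le> R \<and> R \<le> Y powr (1/3) \<and>
       prime p \<and> real p \<le> R powr (1/2) \<longrightarrow>
       \<bar>\<Sum>\<^sub>\<infinity>n\<in>{n::nat. n \<ge> 1 \<and> \<not> p dvd n}.
          g (real n / Y) * (moebius_mu n)\<^sup>2 * 2 ^ omega n * (Lambda0 R (p * n))\<^sup>2\<bar>
         \<le> C1 * ((ln (real p) / ln R + 1 / ln Y) * (Y / ln Y)) \<and>
       (ln (real p) / ln R + 1 / ln Y) * (Y / ln Y)
         \<le> C2 * ((1 + ln (real p)) * Y / (ln Y)\<^sup>2))"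
proof -
  obtain M where M: "M \<ge> 1" "\<And>x. x > 0 \<Longrightarrow> \<bar>g x\<bar> \<le> M"
    using test_function_bounded(1) [OF assms(1,2)] by blast
  obtain K where K: "K \<ge> 0" "\<And>N R p. ln R \<ge> 1 \<Longrightarrow> R > 1 \<Longrightarrow> R \<le> real (Suc N) \<Longrightarrow> p \<ge> 2 \<Longrightarrow>
     (\<Sum>A\<in>Pow (primes_upto N). \<Sum>B\<in>Pow (primes_upto N). sieve_wt R p A * sieve_wt R p B * (\<Prod>q\<in>A \<union> B. rho q)) \<le> K * (ln (real p) + 1) / (ln R) ^ 3"
    using quadratic_form_bound by blast
  define D where "D = 25000 * (20 ^ 4 * 80)\<^sup>2 * K + 13824 * tau_const * exp (9 * (\<Sum>n. real (Suc n) powr (- (9/8))))"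
  have D: "D > 0" unfolding D_def using K(1) by (intro add_nonneg_pos mult_nonneg_nonneg mult_pos_pos) (auto simp: tau_const_def)
  show ?thesis
  proof (rule exI [of _ "M * D"], rule exI [of _ 5], intro conjI allI impI)
    show "M * D > 0" using M D by simp
    fix Y R :: real and p :: nat
    assume as: "Y > exp 1 \<and> R > 1 \<and> Y powr (1/5) \<le> R \<and> R \<le> Y powr (1/3) \<and> prime p \<and> real p \<le> R powr (1/2)"
    define L l where "L = ln Y" and "l = ln R"
    have Y0: "Y > 0" using as exp_gt_zero order_less_trans by blast
    have L1: "L \<ge> 1" unfolding L_def using as Y0 by (subst ln_ge_iff) auto
    have lL: "L \<le> 5 * l" "l \<le> L"
    proof -
      have "ln (Y powr (1/5)) \<le> ln R" using as Y0 by (subst ln_le_cancel_iff) auto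
      thus "L \<le> 5 * l" using Y0 by (simp add: ln_powr L_def l_def)
      have "ln R \<le> ln (Y powr (1/3))" using as Y0 by (subst ln_le_cancel_iff) auto
      hence "l \<le> L / 3" using Y0 by (simp add: ln_powr L_def l_def)
      thus "l \<le> L" using L1 by simp
    qed
    have p2: "p \<ge> 2" using as prime_ge_2_nat by blast
    have lp: "ln (real p) \<ge> 0" using p2 by simp
    (* As 2 \<le> p \<le> sqrt R forces R \<ge> 4, ln R is at least 1. *)
    have l1: "ln R \<ge> 1"
    proof -
      have "R powr (1/2) = sqrt R" using as by (simp add: powr_half_sqrt)
      moreover have "2 \<le> real p" using p2 by simp
      ultimately have "2 \<le> sqrt R" using as by linarith
      hence "2\<^sup>2 \<le> (sqrt R)\<^sup>2" by (intro power_mono) auto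
      hence "4 \<le> R" using as by simp
      hence "exp 1 \<le> R" using exp_le by linarith
      thus ?thesis using as by (subst ln_ge_iff) auto
    qed
    define u where "u = ln (real p)"
    have u0: "u \<ge> 0" using lp by (simp add: u_def)
    have cmp1: "(u + 1) / L\<^sup>2 \<le> (u / l + 1 / L) / L"
    proof -
      have "u / L \<le> u / l" using lL l1 u0 L1 unfolding l_def by (intro divide_left_mono) auto
      hence "(u / L + 1 / L) / L \<le> (u / l + 1 / L) / L" using L1 by (intro divide_right_mono) auto
      thus ?thesis by (simp add: power2_eq_square add_divide_distrib)
    qed
    define N where "N = nat \<lceil>2 * Y ^ 3\<rceil>"
    define G where "G = sieve_sum (primes_upto N) (sieve_wt R p) (4 * (Y / 2)) - sieve_sum (primes_upto N) (sieve_wt R p) (Y / 2)"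
    have "G / (Y / 2) \<le> D * ((ln (real p) + 1) / (ln Y)\<^sup>2)"
      unfolding G_def D_def
      by (rule dyadic_sum_bound [OF K(1) K(2) _ _ _ _ _ N_def]) (use as l1 p2 in auto)
    also have "\<dots> \<le> D * ((u / l + 1 / L) / L)"
      using cmp1 D unfolding u_def L_def by (intro mult_left_mono) auto
    finally have "G \<le> D * ((u / l + 1 / L) / L) * (Y / 2)"
      by (rule iffD1 [OF pos_divide_le_eq, rotated]) (use Y0 in simp)
    also have "\<dots> \<le> D * ((u / l + 1 / L) / L) * Y"
      using D u0 l1 L1 Y0 unfolding l_def by (intro mult_left_mono mult_nonneg_nonneg divide_nonneg_nonneg add_nonneg_nonneg) auto
    finally have G: "G \<le> D * ((u / l + 1 / L) * (Y / L))" by simp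
    have "2 * Y \<le> real N"
    proof -
      have "2 \<le> Y" using as exp_ge_add_one_self [of 1] by linarith
      hence "Y ^ 1 \<le> Y ^ 3" by (intro power_increasing) auto
      hence "2 * Y \<le> 2 * Y ^ 3" by simp
      also have "\<dots> \<le> real N" unfolding N_def by (rule real_nat_ceiling_ge)
      finally show ?thesis .
    qed
    hence "\<bar>\<Sum>\<^sub>\<infinity>n\<in>{n::nat. n \<ge> 1 \<and> \<not> p dvd n}. g (real n / Y) * (moebius_mu n)\<^sup>2 * 2 ^ omega n * (Lambda0 R (p * n))\<^sup>2\<bar> \<le> M * G"
      unfolding G_def using as Y0 M test_function_bounded(2) [OF assms(1,2)] by (intro infsum_le_sieve_sum) auto
    also have "\<dots> \<le> M * (D * ((u / l + 1 / L) * (Y / L)))" using G M(1) by (intro mult_left_mono) auto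
    finally show "\<bar>\<Sum>\<^sub>\<infinity>n\<in>{n::nat. n \<ge> 1 \<and> \<not> p dvd n}. g (real n / Y) * (moebius_mu n)\<^sup>2 * 2 ^ omega n * (Lambda0 R (p * n))\<^sup>2\<bar>
         \<le> M * D * ((ln (real p) / ln R + 1 / ln Y) * (Y / ln Y))"
      by (simp add: u_def l_def L_def mult.assoc)
    have "u / l \<le> u / (L / 5)" using lL L1 u0 l1 unfolding l_def by (intro divide_left_mono) auto
    hence ul: "u / l \<le> 5 * (u / L)" by (simp add: mult.commute)
    have add: "a + c \<le> 5 * c + 5 * b" if "a \<le> 5 * b" "0 \<le> c" for a b c :: real
      using that by linarith
    have "u / l + 1 / L \<le> 5 * (1 / L) + 5 * (u / L)" by (rule add [OF ul]) (use L1 in simp)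
    also have "\<dots> = 5 * ((1 + u) / L)" by (simp add: add_divide_distrib)
    finally have "u / l + 1 / L \<le> 5 * ((1 + u) / L)" .
    hence "(u / l + 1 / L) * (Y / L) \<le> 5 * ((1 + u) / L) * (Y / L)" using Y0 L1 by (intro mult_right_mono) auto
    also have "\<dots> = 5 * ((1 + u) * Y / L\<^sup>2)" by (simp add: power2_eq_square)
    finally show "(ln (real p) / ln R + 1 / ln Y) * (Y / ln Y) \<le> 5 * ((1 + ln (real p)) * Y / (ln Y)\<^sup>2)"
      by (simp add: u_def l_def L_def)
  qed simp
qed

end
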